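(* Let $a\ge 2$ be an integer and let $K_{1,a-1}$ be the star on $a$ vertices. (1) If $a\le 9$, then $K_{1,a-1}$ can be embedded minimally in a Steiner triple system. (2) If $a\ge 9$, then $K_{1,a-1}$ can be embedded in some $\mathrm{STS}(v)$ where $v=4a-3$ if $a\equiv 0,4\pmod 6$; $v=4a+3$ if $a\equiv 1\pmod 6$; $v=4a-1$ if $a\equiv 2\pmod 6$; and $v=4a-5$ if $a\equiv 3,5\pmod 6$. (3) For $a\ge 9$, if $a\equiv 3,4,5\pmod 6$, the embedding in (2) is minimal; if $a\equiv 0,2 \pmod 6$, the order $v$ in (2) is the second smallest admissible order for $K_{1,a-1}$; and if $a\equiv 1\pmod 6$, the order $v$ in (2) is the third smallest admissible order for $K_{1,a-1}$.
   Context: A Steiner triple system of order $v$, denoted $\mathrm{STS}(v)$, is a pair $(V,\mathcal B)$ with $|V|=v$ and $\mathcal B$ a collection of 3-subsets (blocks) of $V$ such that every 2-subset of $V$ lies in exactly one block. (One exists iff $v\equiv 1,3 \pmod 6$.) Embedding of a graph in an STS. In the game Nofil on an STS, players alternately choose ("play") points, never completing a block of played points. The points are then partitioned into $P$ (played), $U$ (unplayable: unplayed points lying on a block whose other two points are in $P$) and $A$ (available: all other points). The available hypergraph has vertex set $A$ and a hyperedge $B\setminus P$ for each block $B$ with $B\cap U=\emptyset$. A graph $G$ is embedded in the STS if it is isomorphic to an available hypergraph reached in some play. Equivalently: there is a partition $V=P\sqcup A\sqcup U$ and an identification of $A$ with the vertex set of $G$ such that (i) no block is contained in $P$, and no block has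 two points in $P$ and one point in $A$; (ii) every point of $U$ lies on some block whose other two points are in $P$; (iii) for each edge $xy$ of $G$, the block containing $x,y$ has its third point in $P$; (iv) for each pair of distinct non-adjacent vertices $x,y$ of $G$, the block containing $x,y$ has its third point in $U$. An embedding of $G$ in an $\mathrm{STS}(v)$ is minimal if $G$ cannot be embedded in any $\mathrm{STS}(v')$ with $v'<v$. For $a\ge 4$, an integer $v$ is called an admissible (or possible) order for $K_{1,a-1}$ if $v\equiv 1,3\pmod 6$ and $v\ge 4a-6$; the inequality $v\ge 4a-6$ is a lower bound satisfied by the order of any $\mathrm{STS}(v)$ in which $K_{1,a-1}$ is embedded. *)

theory Defs
  imports "HOL-Library.Infinite_Set"
begin

definition steiner_triple_system :: "nat \<Rightarrow> 'a set \<Rightarrow> 'a set set \<Rightarrow> bool" where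
  "steiner_triple_system v V \<B> \<longleftrightarrow>
     finite V \<and> card V = v \<and>
     (\<forall>B\<in>\<B>. B \<subseteq> V \<and> card B = 3) \<and>
     (\<forall>x\<in>V. \<forall>y\<in>V. x \<noteq> y \<longrightarrow> (\<exists>!B. B \<in> \<B> \<and> {x, y} \<subseteq> B))"

text \<open>The sets of played points that occur in plays of Nofil. Which player chose which point
  does not affect the available hypergraph, so only the set is recorded.\<close>

inductive nofil_position :: "'a set \<Rightarrow> 'a set set \<Rightarrow> 'a set \<Rightarrow> bool"
  for V :: "'a set" and \<B> :: "'a set set" where
  start: "nofil_position V \<B> {}"
| play: "\<lbrakk>nofil_position V \<B> P; x \<in> V - P; \<not> (\<exists>B\<in>\<B>. B \<subseteq> insert x P)\<rbrakk>
          \<Longrightarrow> nofil_position V \<B> (insert x P)"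

definition unplayable :: "'a set \<Rightarrow> 'a set set \<Rightarrow> 'a set \<Rightarrow> 'a set" where
  "unplayable V \<B> P = {x \<in> V - P. \<exists>B\<in>\<B>. x \<in> B \<and> B - {x} \<subseteq> P}"

definition available :: "'a set \<Rightarrow> 'a set set \<Rightarrow> 'a set \<Rightarrow> 'a set" where
  "available V \<B> P = V - P - unplayable V \<B> P"

text \<open>Hypergraphs are pairs of a vertex set and a set of hyperedges; a simple graph is the case in
  which all hyperedges have two elements. The hyperedges below all have two or three elements, and
  distinct blocks give distinct hyperedges, so a set of hyperedges suffices.\<close>

type_synonym 'a hypergraph = "'a set \<times> 'a set set"

definition available_hypergraph :: "'a set \<Rightarrow> 'a set set \<Rightarrow> 'a set \<Rightarrow> 'a hypergraph" where
  "available_hypergraph V \<B> P =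
     (available V \<B> P, {B - P | B. B \<in> \<B> \<and> B \<inter> unplayable V \<B> P = {}})"

definition hypergraph_iso :: "'a hypergraph \<Rightarrow> 'b hypergraph \<Rightarrow> bool" where
  "hypergraph_iso G H \<longleftrightarrow>
     (\<exists>f. bij_betw f (fst G) (fst H) \<and> (\<lambda>e. f ` e) ` snd G = snd H)"

definition embedded_in_STS :: "'b hypergraph \<Rightarrow> 'a set \<Rightarrow> 'a set set \<Rightarrow> bool" where
  "embedded_in_STS G V \<B> \<longleftrightarrow>
     (\<exists>P. nofil_position V \<B> P \<and> hypergraph_iso G (available_hypergraph V \<B> P))"

text \<open>Systems are finite, so up to isomorphism their points may be taken to be natural numbers.\<close>

definition embeds_in_order :: "'b hypergraph \<Rightarrow> nat \<Rightarrow> bool" where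
  "embeds_in_order G v \<longleftrightarrow>
     (\<exists>(V :: nat set) \<B>. steiner_triple_system v V \<B> \<and> embedded_in_STS G V \<B>)"

definition embeds_minimally_in_order :: "'b hypergraph \<Rightarrow> nat \<Rightarrow> bool" where
  "embeds_minimally_in_order G v \<longleftrightarrow>
     embeds_in_order G v \<and> \<not> (\<exists>v'<v. embeds_in_order G v')"

text \<open>The star \<open>K\<^bsub>1,a-1\<^esub>\<close>, with centre \<open>0\<close>.\<close>

definition star :: "nat \<Rightarrow> nat hypergraph" where
  "star a = ({..<a}, {{0, i} | i. 1 \<le> i \<and> i < a})"

text \<open>Only meaningful for \<open>a \<ge> 4\<close>. Note that \<open>enumerate S n\<close> counts from \<open>0\<close>: the second and third
  smallest admissible orders are \<open>enumerate (admissible_orders a) 1\<close> and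
  \<open>enumerate (admissible_orders a) 2\<close>.\<close>

definition admissible_orders :: "nat \<Rightarrow> nat set" where
  "admissible_orders a = {v. v mod 6 \<in> {1, 3} \<and> v \<ge> 4 * a - 6}"

definition star_order :: "nat \<Rightarrow> nat" where
  "star_order a =
     (if a mod 6 \<in> {0, 4} then 4 * a - 3
      else if a mod 6 = 1 then 4 * a + 3
      else if a mod 6 = 2 then 4 * a - 1
      else 4 * a - 5)"

end

theory Submission
  imports Defs "HOL-Library.Countable"
begin

text \<open>Lower bound: if \<open>p\<close> is the played point on the block through the centre and some leaf,
  the third points of \<open>p\<close> with the other played points and with the other leaves are distinct
  and unplayable, so \<open>v \<ge> 4 a - 5\<close>.

  Constructions: colour the edges of the complete graph on \<open>Z\<^sub>m\<close> and a point at infinity by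
  \<open>x + y\<close> and adjoin the colours as points, with triples on the colours. The centre is the
  colour \<open>0\<close>; from each of its edges one end is played and the other is a leaf. The remaining
  colours are unplayable as soon as the played vertices realise all nonzero sums. With a Steiner
  triple system on the colours this gives the orders \<open>4 a - 5\<close>; edges of the centre whose
  ends are made unplayable by Pasch trades give \<open>4 a - 1\<close> and \<open>4 a + 3\<close>. For \<open>4 a - 3\<close> one edge
  of the centre is deleted altogether; then the triples on the colours must avoid a Hamiltonian
  cycle on the nonzero colours. Such triples arise from a cyclic system whose uncovered pairs form a prism
  or a Moebius ladder, which decompose into a Hamiltonian cycle and a perfect matching.\<close>

subsection \<open>Embeddings of stars\<close>

text \<open>The cases differ in what happens to the edges of colour \<open>0\<close>. There are
  \<open>(m + 1) / 2\<close> of them for \<open>m\<close> colours. If each supplies a leaf, then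
  \<open>m = 2 a - 3\<close>, and the order \<open>4 a - 5\<close> meets the lower bound. This needs
  a triple system on \<open>2 a - 3\<close> points, which is impossible for
  \<open>a \<equiv> 1, 4\<close> modulo 6, and for \<open>a \<equiv> 0, 2\<close> it yields a
  smaller order than the prescribed one. In these cases one or two edges must supply no leaf, and
  yet their ends must not become available. Deleting one edge leads to \<open>m = 2 a - 1\<close>
  and order \<open>4 a - 3\<close>, trading one away to \<open>m = 2 a - 1\<close> and order
  \<open>4 a - 1\<close>, trading two away to \<open>m = 2 a + 1\<close> and order
  \<open>4 a + 3\<close>. With these choices the full triple systems on the colours have order 3
  modulo 6 and come from Bose's construction, except that for \<open>a \<equiv> 5\<close> one
  further doubling is applied.\<close>

definition pair_design :: "'a set \<Rightarrow> 'a set set \<Rightarrow> bool" where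
  "pair_design V \<B> \<longleftrightarrow>
     (\<forall>B\<in>\<B>. B \<subseteq> V) \<and> (\<forall>x\<in>V. \<forall>y\<in>V. x \<noteq> y \<longrightarrow> (\<exists>!B. B \<in> \<B> \<and> {x, y} \<subseteq> B))"

text \<open>Block sizes are split off because the designs on the colours mix triples with the 2-sets
  of colours missing at a vertex, and contain an empty block if no vertex is removed.\<close>

lemma steiner_triple_system_alt:
  "steiner_triple_system v V \<B> \<longleftrightarrow>
     finite V \<and> card V = v \<and> (\<forall>B\<in>\<B>. card B = 3) \<and> pair_design V \<B>"
  unfolding steiner_triple_system_def pair_design_def by (simp only: ball_conj_distrib conj_ac)

lemma pair_design_unique:
  assumes "pair_design V \<B>" "B \<in> \<B>" "B' \<in> \<B>" "{x, y} \<subseteq> B" "{x, y} \<subseteq> B'" "x \<noteq> y"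
  shows "B = B'"
  using assms unfolding pair_design_def by (metis insert_subset subsetD)

lemma pair_design_image:
  assumes f: "bij_betw f V W" and "pair_design V \<B>"
  shows "pair_design W ((`) f ` \<B>)"
  unfolding pair_design_def
proof (intro conjI ballI impI)
  have inj: "inj_on f V" and W: "W = f ` V"
    using f by (auto simp: bij_betw_def)
  show "B \<subseteq> W" if "B \<in> (`) f ` \<B>" for B
    using that assms W unfolding pair_design_def by blast
  fix x y assume "x \<in> W" "y \<in> W" "x \<noteq> y"
  then obtain u w where uw: "u \<in> V" "w \<in> V" "u \<noteq> w" "x = f u" "y = f w"
    using W by blast
  have sub: "{x, y} \<subseteq> f ` B \<longleftrightarrow> {u, w} \<subseteq> B" if "B \<in> \<B>" for B
  proof -
    have "B \<subseteq> V" using that assms unfolding pair_design_def by blast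
    then show ?thesis
      using uw inj by (auto simp: inj_on_image_mem_iff)
  qed
  obtain B where B: "B \<in> \<B>" "{u, w} \<subseteq> B" "\<And>B'. B' \<in> \<B> \<Longrightarrow> {u, w} \<subseteq> B' \<Longrightarrow> B' = B"
    using assms(2) uw(1-3) unfolding pair_design_def by metis
  show "\<exists>!B. B \<in> (`) f ` \<B> \<and> {x, y} \<subseteq> B"
  proof (rule ex1I[of _ "f ` B"])
    show "f ` B \<in> (`) f ` \<B> \<and> {x, y} \<subseteq> f ` B" using B(1,2) sub by blast
    show "C = f ` B" if "C \<in> (`) f ` \<B> \<and> {x, y} \<subseteq> C" for C
      using that B(3) sub by (metis imageE)
  qed
qed

lemma steiner_triple_system_image:
  assumes f: "bij_betw f V W" and "steiner_triple_system v V \<B>"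
  shows "steiner_triple_system v W ((`) f ` \<B>)"
proof -
  have inj: "inj_on f V" and W: "W = f ` V"
    using f by (auto simp: bij_betw_def)
  have "card (f ` B) = 3" if "B \<in> \<B>" for B
    using that assms(2) inj unfolding steiner_triple_system_def
    by (metis card_image inj_on_subset)
  then show ?thesis
    using assms pair_design_image[OF f] W card_image[OF inj]
    unfolding steiner_triple_system_alt by auto
qed

lemma
  assumes "steiner_triple_system v V \<B>"
  shows steiner_triple_system_finite: "finite V" "card V = v" "finite \<B>"
    and steiner_triple_system_block: "B \<in> \<B> \<Longrightarrow> B \<subseteq> V" "B \<in> \<B> \<Longrightarrow> card B = 3"
    and steiner_triple_system_pair:
      "\<lbrakk>x \<in> V; y \<in> V; x \<noteq> y\<rbrakk> \<Longrightarrow> \<exists>B\<in>\<B>. {x, y} \<subseteq> B"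
    and steiner_triple_system_unique:
      "\<lbrakk>B \<in> \<B>; B' \<in> \<B>; {x, y} \<subseteq> B; {x, y} \<subseteq> B'; x \<noteq> y\<rbrakk> \<Longrightarrow> B = B'"
proof -
  from assms show fin: "finite V" "card V = v"
    by (simp_all add: steiner_triple_system_def)
  from assms show "B \<in> \<B> \<Longrightarrow> B \<subseteq> V" "B \<in> \<B> \<Longrightarrow> card B = 3"
    by (simp_all add: steiner_triple_system_def)
  have "\<B> \<subseteq> Pow V" using assms by (auto simp: steiner_triple_system_def)
  then show "finite \<B>" by (rule finite_subset) (simp add: fin)
  show "\<lbrakk>x \<in> V; y \<in> V; x \<noteq> y\<rbrakk> \<Longrightarrow> \<exists>B\<in>\<B>. {x, y} \<subseteq> B"
    using assms unfolding steiner_triple_system_def by metis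
  show "\<lbrakk>B \<in> \<B>; B' \<in> \<B>; {x, y} \<subseteq> B; {x, y} \<subseteq> B'; x \<noteq> y\<rbrakk> \<Longrightarrow> B = B'"
    using assms pair_design_unique unfolding steiner_triple_system_alt by metis
qed

text \<open>The conditions of the paper that characterise an embedding, for the star with centre
  \<open>c\<close> and set of leaves \<open>L\<close>; the unplayable points are those outside \<open>P\<close>, \<open>L\<close>
  and \<open>{c}\<close>.\<close>

definition star_position :: "'a set \<Rightarrow> 'a set set \<Rightarrow> 'a set \<Rightarrow> 'a \<Rightarrow> 'a set \<Rightarrow> bool" where
  "star_position V \<B> P c L \<longleftrightarrow>
     P \<subseteq> V \<and> L \<subseteq> V \<and> c \<in> V \<and> c \<notin> P \<and> c \<notin> L \<and> P \<inter> L = {} \<and>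
     (\<forall>B\<in>\<B>. \<forall>p\<in>P. \<forall>q\<in>P. p \<noteq> q \<longrightarrow> {p, q} \<subseteq> B \<longrightarrow> B \<inter> (P \<union> L \<union> {c}) = {p, q}) \<and>
     (\<forall>B\<in>\<B>. \<forall>l\<in>L. \<forall>k\<in>L. l \<noteq> k \<longrightarrow> {l, k} \<subseteq> B \<longrightarrow> B \<inter> (P \<union> L \<union> {c}) = {l, k}) \<and>
     (\<forall>l\<in>L. \<exists>p\<in>P. {c, l, p} \<in> \<B>) \<and>
     (\<forall>u\<in>V - P - L - {c}. \<exists>p\<in>P. \<exists>q\<in>P. p \<noteq> q \<and> {u, p, q} \<in> \<B>)"

lemma star_position_image:
  assumes f: "inj f" and s: "star_position V \<B> P c L"
  shows "star_position (f ` V) ((`) f ` \<B>) (f ` P) (f c) (f ` L)"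
proof -
  have a: "f ` B \<inter> (f ` P \<union> f ` L \<union> {f c}) = {f p, f q} \<longleftrightarrow> B \<inter> (P \<union> L \<union> {c}) = {p, q}"
    for B p q
  proof -
    have "f ` B \<inter> (f ` P \<union> f ` L \<union> {f c}) = f ` (B \<inter> (P \<union> L \<union> {c}))"
      using image_Int[OF f] by (simp add: image_Un)
    moreover have "{f p, f q} = f ` {p, q}" by simp
    ultimately show ?thesis using inj_image_eq_iff[OF f] by metis
  qed
  have b: "{f p, f q} \<subseteq> f ` B \<longleftrightarrow> {p, q} \<subseteq> B" for p q B
    using inj_image_mem_iff[OF f] by simp
  have c: "{f p, f q, f r} \<in> (`) f ` \<B> \<longleftrightarrow> {p, q, r} \<in> \<B>" for p q r
  proof -
    have "inj ((`) f)" using inj_image_eq_iff[OF f] by (simp add: inj_def)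
    from inj_image_mem_iff[OF this, of "{p, q, r}"] show ?thesis by simp
  qed
  have d: "f ` V - f ` P - f ` L - {f c} = f ` (V - P - L - {c})"
    using f by (auto simp: inj_def)
  have e: "f ` P \<inter> f ` L = {} \<longleftrightarrow> P \<inter> L = {}"
    using image_Int[OF f, of P L] by auto
  show ?thesis
    unfolding star_position_def
  proof (intro conjI ballI impI)
    note s' = s[unfolded star_position_def]
    show "f ` P \<subseteq> f ` V" "f ` L \<subseteq> f ` V" "f c \<in> f ` V" "f c \<notin> f ` P" "f c \<notin> f ` L"
      "f ` P \<inter> f ` L = {}"
      using s' by (simp_all add: e inj_image_mem_iff[OF f] inj_image_subset_iff[OF f])
    show "B \<inter> (f ` P \<union> f ` L \<union> {f c}) = {p, q}"
      if "B \<in> (`) f ` \<B>" "p \<in> f ` P" "q \<in> f ` P" "p \<noteq> q" "{p, q} \<subseteq> B" for B p q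
    proof -
      obtain B' p' q' where *: "B = f ` B'" "p = f p'" "q = f q'" "B' \<in> \<B>" "p' \<in> P" "q' \<in> P"
        using \<open>B \<in> _\<close> \<open>p \<in> _\<close> \<open>q \<in> _\<close> by blast
      then have "{p', q'} \<subseteq> B'" "p' \<noteq> q'" using that b by auto
      then have "B' \<inter> (P \<union> L \<union> {c}) = {p', q'}" using s' * by (elim conjE) metis
      then show ?thesis unfolding * a .
    qed
    show "B \<inter> (f ` P \<union> f ` L \<union> {f c}) = {p, q}"
      if "B \<in> (`) f ` \<B>" "p \<in> f ` L" "q \<in> f ` L" "p \<noteq> q" "{p, q} \<subseteq> B" for B p q
    proof -
      obtain B' p' q' where *: "B = f ` B'" "p = f p'" "q = f q'" "B' \<in> \<B>" "p' \<in> L" "q' \<in> L"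
        using \<open>B \<in> _\<close> \<open>p \<in> _\<close> \<open>q \<in> _\<close> by blast
      then have "{p', q'} \<subseteq> B'" "p' \<noteq> q'" using that b by auto
      then have "B' \<inter> (P \<union> L \<union> {c}) = {p', q'}" using s' * by (elim conjE) metis
      then show ?thesis unfolding * a .
    qed
    show "\<exists>p\<in>f ` P. {f c, l, p} \<in> (`) f ` \<B>" if "l \<in> f ` L" for l
    proof -
      obtain l' where l: "l' \<in> L" "l = f l'" using \<open>l \<in> _\<close> by blast
      then obtain p where "p \<in> P" "{c, l', p} \<in> \<B>" using s' by (elim conjE) metis
      then show ?thesis by (intro bexI[of _ "f p"]) (simp_all add: c l)
    qed
    show "\<exists>p\<in>f ` P. \<exists>q\<in>f ` P. p \<noteq> q \<and> {u, p, q} \<in> (`) f ` \<B>"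
      if "u \<in> f ` V - f ` P - f ` L - {f c}" for u
    proof -
      obtain u' where u: "u' \<in> V - P - L - {c}" "u = f u'" using \<open>u \<in> _\<close> unfolding d by blast
      then obtain p q where "p \<in> P" "q \<in> P" "p \<noteq> q" "{u', p, q} \<in> \<B>"
        using s' by (elim conjE) metis
      then show ?thesis
        by (intro bexI[of _ "f p"] bexI[of _ "f q"]) (simp_all add: c u inj_eq[OF f])
    qed
  qed
qed

section \<open>Star positions and positions of play\<close>

lemma nofil_positionI:
  assumes "finite P" "P \<subseteq> V" "\<And>B. B \<in> \<B> \<Longrightarrow> \<not> B \<subseteq> P"
  shows "nofil_position V \<B> P"
  using assms
proof (induction P rule: finite_induct)
  case empty
  show ?case by (rule nofil_position.start)
next
  case (insert x P)
  then show ?case by (intro nofil_position.play) auto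
qed

lemma card3_third:
  assumes "card B = 3" "{x, y} \<subseteq> B" "x \<noteq> y"
  obtains z where "B = {x, y, z}" "z \<noteq> x" "z \<noteq> y"
proof -
  have fin: "finite B" using assms(1) card_eq_0_iff by fastforce
  have "card (B - {x, y}) = 1" using assms fin by (subst card_Diff_subset) auto
  then obtain z where "B - {x, y} = {z}" using card_1_singletonE by blast
  then show ?thesis using that assms(2) by blast
qed

text \<open>A block that avoids the unplayable points lies in \<open>P\<close>, \<open>L\<close> and
  \<open>{c}\<close>; as no two of its points are both played or both leaves, it has one point of
  each kind. Hence the hyperedges are exactly the pairs of the centre with a leaf.\<close>

lemma star_position_embeds:
  fixes V :: "nat set"
  assumes S: "steiner_triple_system v V \<B>" and s: "star_position V \<B> P c L"
  shows "embedded_in_STS (star (Suc (card L))) V \<B>"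
proof -
  note S' = S[unfolded steiner_triple_system_def] and s' = s[unfolded star_position_def]
  have fin: "finite V" using S' by blast
  have PV: "P \<subseteq> V" "L \<subseteq> V" "c \<in> V" "c \<notin> P" "c \<notin> L" "P \<inter> L = {}"
    using s' by simp_all
  have B3: "card B = 3" "B \<subseteq> V" if "B \<in> \<B>" for B using that S' by blast+
  have PP: "B \<inter> (P \<union> L \<union> {c}) = {p, q}"
    if "B \<in> \<B>" "p \<in> P" "q \<in> P" "p \<noteq> q" "{p, q} \<subseteq> B" for B p q
    using s' that by (elim conjE) metis
  have LL: "B \<inter> (P \<union> L \<union> {c}) = {p, q}"
    if "B \<in> \<B>" "p \<in> L" "q \<in> L" "p \<noteq> q" "{p, q} \<subseteq> B" for B p q
    using s' that by (elim conjE) metis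
  have cL: "\<exists>p\<in>P. {c, l, p} \<in> \<B>" if "l \<in> L" for l
    using s' that by (elim conjE) metis
  have un: "\<exists>p\<in>P. \<exists>q\<in>P. p \<noteq> q \<and> {u, p, q} \<in> \<B>" if "u \<in> V - P - L - {c}" for u
    using s' that by (elim conjE) metis
  have pos: "nofil_position V \<B> P"
  proof (rule nofil_positionI)
    show "finite P" using PV fin finite_subset by blast
    show "\<not> B \<subseteq> P" if "B \<in> \<B>" for B
    proof
      assume "B \<subseteq> P"
      obtain x y z where B: "B = {x, y, z}" "x \<noteq> y" "x \<noteq> z" "y \<noteq> z"
        using B3[OF \<open>B \<in> \<B>\<close>] card_3_iff by metis
      have "B \<inter> (P \<union> L \<union> {c}) = {x, y}" using PP[OF \<open>B \<in> \<B>\<close>, of x y] B \<open>B \<subseteq> P\<close> by blast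
      moreover have "z \<in> B \<inter> (P \<union> L \<union> {c})" using B(1) \<open>B \<subseteq> P\<close> by auto
      ultimately show False using B by simp
    qed
  qed (use PV in blast)
  have U: "unplayable V \<B> P = V - P - L - {c}"
  proof (intro set_eqI iffI)
    fix x assume "x \<in> unplayable V \<B> P"
    then obtain B where B: "x \<in> V - P" "B \<in> \<B>" "x \<in> B" "B - {x} \<subseteq> P"
      unfolding unplayable_def by blast
    obtain y where y: "y \<in> B" "y \<noteq> x"
      using B3[OF B(2)] B(3) by (metis card_3_iff insertCI)
    then obtain z where z: "B = {x, y, z}" "z \<noteq> x" "z \<noteq> y"
      using card3_third[OF B3(1)[OF B(2)], of x y] B(3) by auto
    then have "B \<inter> (P \<union> L \<union> {c}) = {y, z}" using PP[of B y z] B y by auto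
    moreover have "x \<notin> {y, z}" using z y by simp
    ultimately have "x \<notin> P \<union> L \<union> {c}" using B(3) by (metis IntI)
    then show "x \<in> V - P - L - {c}" using B(1) by blast
  next
    fix x assume x: "x \<in> V - P - L - {c}"
    then obtain p q where "p \<in> P" "q \<in> P" "{x, p, q} \<in> \<B>" using un by blast
    then show "x \<in> unplayable V \<B> P" unfolding unplayable_def using x
      by (intro CollectI conjI bexI[of _ "{x, p, q}"]) auto
  qed
  then have A: "available V \<B> P = insert c L"
    unfolding available_def using PV by blast
  have E: "{B - P |B. B \<in> \<B> \<and> B \<inter> unplayable V \<B> P = {}} = {{c, l} |l. l \<in> L}"
  proof (intro set_eqI iffI)
    fix e assume "e \<in> {B - P |B. B \<in> \<B> \<and> B \<inter> unplayable V \<B> P = {}}"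
    then obtain B where B: "e = B - P" "B \<in> \<B>" "B \<inter> unplayable V \<B> P = {}" by auto
    have "B \<subseteq> P \<union> L \<union> {c}" using B(3) B3(2)[OF B(2)] unfolding U by auto
    then have BA: "B \<inter> (P \<union> L \<union> {c}) = B" by (rule Int_absorb2)
    have no2: "False" if "{x, y} \<subseteq> B" "x \<noteq> y" "{x, y} \<subseteq> P \<or> {x, y} \<subseteq> L" for x y
    proof -
      have "B = {x, y}" using PP[OF B(2), of x y] LL[OF B(2), of x y] that BA by auto
      then show False using B3[OF B(2)] that by simp
    qed
    obtain x y z where xyz: "B = {x, y, z}" "x \<noteq> y" "x \<noteq> z" "y \<noteq> z"
      using B3[OF B(2)] card_3_iff by metis
    have mem: "w = c \<or> w \<in> L \<or> w \<in> P" if "w \<in> B" for w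
      using \<open>B \<subseteq> _\<close> that by auto
    have disj: "l \<notin> P" if "l \<in> L" for l using PV that by auto
    have "x = c \<or> x \<in> L \<or> x \<in> P" "y = c \<or> y \<in> L \<or> y \<in> P" "z = c \<or> z \<in> L \<or> z \<in> P"
      using mem xyz by simp_all
    moreover have "\<not> (x \<in> P \<and> y \<in> P)" "\<not> (x \<in> P \<and> z \<in> P)" "\<not> (y \<in> P \<and> z \<in> P)"
      "\<not> (x \<in> L \<and> y \<in> L)" "\<not> (x \<in> L \<and> z \<in> L)" "\<not> (y \<in> L \<and> z \<in> L)"
      using no2[of x y] no2[of x z] no2[of y z] xyz by auto
    ultimately have "\<exists>l\<in>L. B - P = {c, l}"
      using xyz PV(4,5) disj by (elim disjE) (auto simp: insert_Diff_if)
    then show "e \<in> {{c, l} |l. l \<in> L}" using B by auto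
  next
    fix e assume "e \<in> {{c, l} |l. l \<in> L}"
    then obtain l where l: "e = {c, l}" "l \<in> L" by auto
    then obtain p where p: "p \<in> P" "{c, l, p} \<in> \<B>" using cL by auto
    have "l \<notin> P" using l PV by auto
    then have "{c, l, p} - P = e" "{c, l, p} \<inter> unplayable V \<B> P = {}"
      using PV(4) U l p by auto
    then show "e \<in> {B - P |B. B \<in> \<B> \<and> B \<inter> unplayable V \<B> P = {}}"
      by (intro CollectI exI[of _ "{c, l, p}"]) (simp add: p)
  qed
  have finL: "finite L" using PV fin finite_subset by blast
  have "card {1..<Suc (card L)} = card L" by simp
  then obtain h where h: "bij_betw h {1..<Suc (card L)} L"
    using finite_same_card_bij[of "{1..<Suc (card L)}" L] finL by auto
  define f where "f = (\<lambda>i. if i = 0 then c else h i)"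
  have split: "{..<Suc (card L)} = insert 0 {1..<Suc (card L)}" by auto
  have him: "f ` {1..<Suc (card L)} = L"
    using h unfolding f_def bij_betw_def by auto
  have "inj_on f {1..<Suc (card L)}"
    using h inj_on_cong[of "{1..<Suc (card L)}" f h] unfolding f_def bij_betw_def by simp
  moreover have "f 0 \<notin> f ` ({1..<Suc (card L)} - {0})" using him PV(5) by (auto simp: f_def)
  ultimately have "inj_on f {..<Suc (card L)}" unfolding split inj_on_insert by blast
  moreover have "f ` {..<Suc (card L)} = insert c L" unfolding split image_insert him by (simp add: f_def)
  ultimately have bij: "bij_betw f {..<Suc (card L)} (insert c L)" unfolding bij_betw_def by blast
  have edges: "(\<lambda>e. f ` e) ` {{0, i} |i. 1 \<le> i \<and> i < Suc (card L)} = {{c, l} |l. l \<in> L}"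
  proof -
    have "{{0, i} |i. 1 \<le> i \<and> i < Suc (card L)} = (\<lambda>i. {0, i}) ` {1..<Suc (card L)}"
      by auto
    then have "(\<lambda>e. f ` e) ` {{0, i} |i. 1 \<le> i \<and> i < Suc (card L)} =
        (\<lambda>l. {c, l}) ` (f ` {1..<Suc (card L)})"
      by (simp add: image_image f_def insert_commute)
    then show ?thesis unfolding him Setcompr_eq_image .
  qed
  have "hypergraph_iso (star (Suc (card L))) (available_hypergraph V \<B> P)"
    unfolding hypergraph_iso_def star_def available_hypergraph_def A E
    using bij edges unfolding Setcompr_eq_image fst_conv snd_conv by blast
  then show ?thesis using pos unfolding embedded_in_STS_def by blast
qed

text \<open>\<open>embeds_in_order\<close> speaks of systems on natural numbers, while the
  constructions live on sum and product types; countability transfers them.\<close>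

lemma star_position_embeds_in_order:
  fixes V :: "'a::countable set"
  assumes "steiner_triple_system v V \<B>" "star_position V \<B> P c L"
  shows "embeds_in_order (star (Suc (card L))) v"
proof -
  let ?f = "to_nat :: 'a \<Rightarrow> nat"
  have S: "steiner_triple_system v (?f ` V) ((`) ?f ` \<B>)"
    by (rule steiner_triple_system_image[OF _ assms(1)])
      (simp add: bij_betw_def inj_on_subset[OF inj_to_nat])
  have "card (?f ` L) = card L"
    by (simp add: card_image inj_on_subset[OF inj_to_nat])
  then show ?thesis
    using S star_position_embeds[OF S star_position_image[OF inj_to_nat assms(2)]]
    unfolding embeds_in_order_def by auto
qed

subsection \<open>Lower bound and admissible orders\<close>

text \<open>Deleting \<open>x\<close> from its blocks partitions the other points into
  pairs.\<close>

lemma steiner_triple_system_replication: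
  assumes "steiner_triple_system v V \<B>" "x \<in> V"
  shows "2 * card {B \<in> \<B>. x \<in> B} = v - 1"
proof -
  note S = assms(1)
  note fin = steiner_triple_system_finite[OF S]
  note block = steiner_triple_system_block[OF S]
  let ?D = "(\<lambda>B. B - {x}) ` {B \<in> \<B>. x \<in> B}"
  have "inj_on (\<lambda>B. B - {x}) {B \<in> \<B>. x \<in> B}"
    by (rule inj_onI) blast
  then have cD: "card ?D = card {B \<in> \<B>. x \<in> B}" by (rule card_image)
  have U: "\<Union>?D = V - {x}"
  proof (intro set_eqI iffI)
    fix y assume "y \<in> V - {x}"
    then obtain B where "B \<in> \<B>" "{x, y} \<subseteq> B"
      using steiner_triple_system_pair[OF S assms(2), of y] by auto
    then show "y \<in> \<Union>?D" using \<open>y \<in> V - {x}\<close> by auto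
  qed (use block in auto)
  have "card (\<Union>?D) = 2 * card ?D"
  proof (rule card_partition[symmetric])
    show "finite ?D" using fin by simp
    show "finite (\<Union>?D)" using U fin by simp
    show "card D = 2" if "D \<in> ?D" for D
      using that block by (auto simp: card_Diff_singleton)
    show "D \<inter> D' = {}" if "D \<in> ?D" "D' \<in> ?D" "D \<noteq> D'" for D D'
    proof (rule ccontr)
      assume "D \<inter> D' \<noteq> {}"
      then obtain y where y: "y \<in> D" "y \<in> D'" by blast
      obtain B where B: "B \<in> \<B>" "x \<in> B" "D = B - {x}" using \<open>D \<in> ?D\<close> by auto
      obtain B' where B': "B' \<in> \<B>" "x \<in> B'" "D' = B' - {x}" using \<open>D' \<in> ?D\<close> by auto
      have "B = B'" using steiner_triple_system_unique[OF S B(1) B'(1), of x y] B B' y by auto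
      then show False using B B' \<open>D \<noteq> D'\<close> by simp
    qed
  qed
  then show ?thesis using U cD fin assms(2) by simp
qed

text \<open>Counting the incidences of points and blocks gives
  \<open>3 * (2 * card \<B>) = v * (v - 1)\<close>; the parity already follows at a single
  point.\<close>

lemma steiner_triple_system_order:
  assumes S: "steiner_triple_system v V \<B>" and "v > 0"
  shows "odd v" "3 dvd v * (v - 1)"
proof -
  note fin = steiner_triple_system_finite[OF S]
  note block = steiner_triple_system_block[OF S]
  obtain x where "x \<in> V" using fin assms(2) by fastforce
  from steiner_triple_system_replication[OF S this] have "even (v - 1)" by (metis dvd_triv_left)
  then show "odd v" using assms(2) by simp
  have "card B = 3" if "B \<in> \<B>" for B using that block by simp
  moreover have "{x \<in> V. x \<in> B} = B" if "B \<in> \<B>" for B using block(1)[OF that] by auto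
  ultimately have "(\<Sum>x\<in>V. card {B \<in> \<B>. x \<in> B}) = 3 * card \<B>"
    using sum_multicount[OF fin(1,3), of "(\<in>)" 3] by simp
  then have "3 * (2 * card \<B>) = (\<Sum>x\<in>V. 2 * card {B \<in> \<B>. x \<in> B})"
    by (simp add: sum_distrib_left[symmetric])
  also have "\<dots> = v * (v - 1)"
    using steiner_triple_system_replication[OF S] fin(2) by simp
  finally show "3 dvd v * (v - 1)" by (metis dvd_triv_left)
qed

lemma embedded_star_order_ge:
  assumes S: "steiner_triple_system v V \<B>" and emb: "embedded_in_STS (star a) V \<B>" and a: "a \<ge> 2"
  shows "v \<ge> 4 * a - 5"
proof -
  note fin = steiner_triple_system_finite[OF S]
  have B3: "card B = 3" "B \<subseteq> V" if "B \<in> \<B>" for B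
    using that steiner_triple_system_block[OF S] by simp_all
  note uniq = steiner_triple_system_unique[OF S]
  obtain P f where pos: "nofil_position V \<B> P"
    and f: "bij_betw f {..<a} (available V \<B> P)"
    and ed: "(\<lambda>e. f ` e) ` {{0, i} |i. 1 \<le> i \<and> i < a} =
      {B - P |B. B \<in> \<B> \<and> B \<inter> unplayable V \<B> P = {}}"
    using emb unfolding embedded_in_STS_def hypergraph_iso_def star_def available_hypergraph_def
    by auto
  have "P \<subseteq> V \<and> (\<forall>B\<in>\<B>. \<not> B \<subseteq> P)"
    using pos
  proof (induction rule: nofil_position.induct)
    case start
    then show ?case using B3 by fastforce
  qed blast
  then have PV: "P \<subseteq> V" and noB: "\<And>B. B \<in> \<B> \<Longrightarrow> \<not> B \<subseteq> P" by blast+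
  define A where "A = available V \<B> P"
  define U where "U = unplayable V \<B> P"
  have AU: "U \<subseteq> V" "U \<inter> P = {}" "A = V - P - U"
    unfolding A_def U_def available_def unplayable_def by blast+
  have two: "z \<in> U" if "{x, y, z} \<in> \<B>" "x \<in> P" "y \<in> P" "x \<noteq> y" for x y z
  proof -
    have "z \<in> V" "z \<notin> P" using B3[OF that(1)] noB[OF that(1)] that by auto
    then show ?thesis unfolding U_def unplayable_def using that(1-3)
      by (intro CollectI conjI bexI[of _ "{x, y, z}"]) auto
  qed
  define c where "c = f 0"
  define L where "L = f ` {1..<a}"
  have fA: "inj_on f {..<a}" "f ` {..<a} = A" using f unfolding A_def bij_betw_def by auto
  have cA: "c \<in> A" "L \<subseteq> A" unfolding c_def L_def using fA a by auto
  have cL: "c \<notin> L"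
  proof
    assume "c \<in> L"
    then obtain i where "f 0 = f i" "1 \<le> i" "i < a" unfolding c_def L_def by auto
    then show False using inj_onD[OF fA(1), of 0 i] by simp
  qed
  have cardL: "card L = a - 1"
    unfolding L_def using card_image inj_on_subset[OF fA(1), of "{1..<a}"] by fastforce
  have cardA: "card A = a" using fA card_image by fastforce
  have edge: "\<exists>p\<in>P. {c, l, p} \<in> \<B>" if "l \<in> L" for l
  proof -
    obtain i where i: "l = f i" "1 \<le> i" "i < a" using \<open>l \<in> L\<close> unfolding L_def by auto
    have "f ` {0, i} \<in> (\<lambda>e. f ` e) ` {{0, i} |i. 1 \<le> i \<and> i < a}" by (rule imageI) (use i in auto)
    then have "{c, l} \<in> {B - P |B. B \<in> \<B> \<and> B \<inter> unplayable V \<B> P = {}}"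
      unfolding ed using i c_def by simp
    then obtain B where B: "B \<in> \<B>" "{c, l} = B - P" by auto
    have "{c, l} \<subseteq> B" "c \<noteq> l" using B(2) cL that by auto
    then obtain p where p: "B = {c, l, p}" "p \<noteq> c" "p \<noteq> l"
      using card3_third[OF B3(1)[OF B(1)]] by metis
    have "p \<in> P"
    proof (rule ccontr)
      assume "p \<notin> P"
      then have "p \<in> {c, l}" unfolding B(2) using p by simp
      then show False using p by simp
    qed
    then show ?thesis using B p by auto
  qed
  \<comment> \<open>Both points are available and the third is played, so the block leaves an edge;
    every edge of the star contains the centre.\<close>
  have noedge: "l = c \<or> k = c" if "{l, k, p} \<in> \<B>" "l \<in> A" "k \<in> A" "p \<in> P" "l \<noteq> k" for l k p
  proof -
    have "{l, k, p} - P = {l, k}" "{l, k, p} \<inter> unplayable V \<B> P = {}"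
      using that AU by (auto simp: U_def)
    then have "{l, k} \<in> {B - P |B. B \<in> \<B> \<and> B \<inter> unplayable V \<B> P = {}}"
      by (intro CollectI exI[of _ "{l, k, p}"]) (simp add: that)
    then obtain i where "{l, k} = f ` {0, i}" unfolding ed[symmetric] by auto
    then have "c \<in> {l, k}" unfolding c_def by simp
    then show ?thesis by auto
  qed
  obtain pt where pt: "\<And>l. l \<in> L \<Longrightarrow> pt l \<in> P \<and> {c, l, pt l} \<in> \<B>" using edge by metis
  have cP: "c \<notin> P" "P \<inter> L = {}" using cA AU by blast+
  \<comment> \<open>A block is determined by \<open>c\<close> and a played point, so distinct leaves
    use distinct played points.\<close>
  have "inj_on pt L"
  proof (rule inj_onI)
    fix l k assume lk: "l \<in> L" "k \<in> L" "pt l = pt k"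
    have "pt l \<in> P" "c \<noteq> pt l" "l \<noteq> pt l" using pt[of l] lk cP by auto
    then have "{c, l, pt l} = {c, k, pt l}"
      using uniq[of "{c, l, pt l}" "{c, k, pt k}" c "pt l"] pt[of l] pt[of k] lk by auto
    moreover have "c \<noteq> l" using lk cL by auto
    ultimately show "l = k" using \<open>l \<noteq> pt l\<close> by auto
  qed
  have finP: "finite P" "finite L" using PV fin finite_subset cardL L_def by auto
  have cardP: "card P \<ge> a - 1"
    using card_inj_on_le[of pt L P] \<open>inj_on pt L\<close> pt finP cardL by auto
  have "L \<noteq> {}" using cardL a by auto
  then obtain l0 where l0: "l0 \<in> L" by blast
  define p where "p = pt l0"
  have p: "p \<in> P" "{c, l0, p} \<in> \<B>" using pt l0 p_def by auto
  have third: "\<exists>z. {p, x, z} \<in> \<B>" if "x \<in> V" "x \<noteq> p" for x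
  proof -
    obtain B where "B \<in> \<B>" "{p, x} \<subseteq> B"
      using steiner_triple_system_pair[OF S, of p x] \<open>x \<in> V\<close> \<open>x \<noteq> p\<close> p PV by auto
    then show ?thesis using card3_third[OF B3(1), of B p x] \<open>x \<noteq> p\<close> by metis
  qed
  \<comment> \<open>The leaf \<open>l0\<close> is left out because its block with \<open>p\<close>
    goes through the centre and not through an unplayable point.\<close>
  define X where "X = (P - {p}) \<union> (L - {l0})"
  have XV: "X \<subseteq> V" "p \<notin> X" unfolding X_def using cA AU PV cP p by blast+
  obtain th where th: "\<And>x. x \<in> X \<Longrightarrow> {p, x, th x} \<in> \<B>"
  proof -
    have "\<forall>x\<in>X. \<exists>z. {p, x, z} \<in> \<B>" using third XV by blast
    then show ?thesis using that by metis
  qed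
  have dist: "th x \<noteq> p" "th x \<noteq> x" if "x \<in> X" for x
    using B3(1)[OF th[OF that]] XV that by (auto simp: card_insert_if split: if_splits)
  have thU: "th x \<in> U" if x: "x \<in> X" for x
  proof (cases "x \<in> P")
    case True
    then show ?thesis using two[OF th[OF x]] p XV x by blast
  next
    case False
    then have xL: "x \<in> L" "x \<noteq> l0" using x unfolding X_def by auto
    have "th x \<in> V" using B3[OF th[OF x]] by blast
    moreover have "th x \<notin> P"
    proof
      assume "th x \<in> P"
      then have "x \<in> U" using two[of p "th x" x] th[OF x] p dist[OF x] by (simp add: insert_commute)
      then show False using xL cA AU by blast
    qed
    \<comment> \<open>Otherwise \<open>x\<close> and \<open>th x\<close> span an edge, so
      \<open>th x\<close> is the centre; but the block through \<open>p\<close> and the centre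
      already contains \<open>l0\<close>.\<close>
    moreover have "th x \<notin> A"
    proof
      assume "th x \<in> A"
      then have "x = c \<or> th x = c"
        using noedge[of x "th x" p] th[OF x] p dist[OF x] xL cA by (auto simp: insert_commute)
      then have "th x = c" using xL cL by auto
      then have "{p, x, c} = {c, l0, p}"
        using uniq[OF th[OF x] p(2), of p c] p cP by auto
      then have "x \<in> {c, l0, p}" by (metis insertCI)
      then show False using xL cL cP p by auto
    qed
    ultimately show ?thesis using AU by blast
  qed
  have "inj_on th X"
  proof (rule inj_onI)
    fix x y assume xy: "x \<in> X" "y \<in> X" "th x = th y"
    then have "{p, x, th x} = {p, y, th x}"
      using uniq[OF th[of x] th[of y], of p "th x"] dist[of x] by auto
    then have "x \<in> {p, y, th x}" by (metis insertCI)
    then show "x = y" using dist[of x] xy XV by auto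
  qed
  then have "card X \<le> card U"
    using card_inj_on_le[of th X U] thU AU fin finite_subset by (metis image_subsetI)
  moreover have "card X = (card P - 1) + (a - 2)"
    unfolding X_def using finP cP p l0 cardL by (subst card_Un_disjoint) auto
  moreover have "v = card P + card A + card U"
  proof -
    have V: "P \<union> A \<union> U = V" using AU PV by auto
    have "finite A" "finite U" using finite_subset[of _ V] AU fin(1) by auto
    have "card (P \<union> A \<union> U) = card (P \<union> A) + card U"
      by (rule card_Un_disjoint) (use AU finP \<open>finite A\<close> \<open>finite U\<close> in auto)
    also have "card (P \<union> A) = card P + card A"
      by (rule card_Un_disjoint) (use AU finP \<open>finite A\<close> in auto)
    finally show ?thesis unfolding V fin(2) .
  qed
  \<comment> \<open>The order is at least \<open>card P + a + (card P - 1) + (a - 2)\<close>, where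
    \<open>card P \<ge> a - 1\<close>.\<close>
  ultimately show ?thesis using cardP cardA a by linarith
qed

lemma star_order_minimal:
  assumes "a \<ge> 9" "a mod 6 \<in> {3, 4, 5}" "embeds_in_order (star a) v"
  shows "star_order a \<le> v"
proof -
  obtain V :: "nat set" and \<B> where V: "steiner_triple_system v V \<B>" "embedded_in_STS (star a) V \<B>"
    using assms(3) unfolding embeds_in_order_def by blast
  have ge: "v \<ge> 4 * a - 5" using embedded_star_order_ge[OF V] assms(1) by simp
  have odd: "odd v" "3 dvd v * (v - 1)" using steiner_triple_system_order[OF V(1)] ge assms(1) by auto
  show ?thesis
  proof (cases "a mod 6 = 4")
    case False
    then show ?thesis using ge assms(2) unfolding star_order_def by auto
  next
    case True
    then obtain k where a: "a = 6 * k + 4" by (metis mult_div_mod_eq)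
    \<comment> \<open>This number is \<open>4 a - 5\<close>; it is 2 modulo 3, so
      \<open>v * (v - 1)\<close> is not divisible by 3. The next candidate \<open>4 a - 4\<close> is
      even. For the residues 3 and 5 the lower bound equals \<open>star_order a\<close>
      already.\<close>
    have "v \<noteq> 24 * k + 11"
    proof
      assume v: "v = 24 * k + 11"
      have "v * (v - 1) = 3 * (192 * k * k + 168 * k + 36) + 2"
        unfolding v by (simp add: algebra_simps)
      then show False using odd(2) by presburger
    qed
    then have "v \<noteq> 4 * a - 5" using a by simp
    moreover have "v \<noteq> 4 * a - 4" using odd(1) assms(1) by auto
    ultimately show ?thesis using ge True unfolding star_order_def by auto
  qed
qed

section \<open>The smallest admissible orders\<close>

lemma infinite_admissible_orders: "infinite (admissible_orders a)"
  unfolding infinite_nat_iff_unbounded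
proof (intro allI)
  fix m
  have "6 * (m + 4 * a) + 1 \<in> admissible_orders a"
    unfolding admissible_orders_def by simp presburger
  then show "\<exists>n>m. n \<in> admissible_orders a" by (intro exI[of _ "6 * (m + 4 * a) + 1"]) simp
qed

lemma enumerate_0_eqI: "\<lbrakk>x \<in> S; \<And>y. y \<in> S \<Longrightarrow> x \<le> y\<rbrakk> \<Longrightarrow> enumerate S 0 = x"
  for S :: "nat set"
  unfolding enumerate_0 by (rule Least_equality)

lemma enumerate_Suc_eqI:
  fixes S :: "nat set"
  assumes "infinite S" "enumerate S n = w" "x \<in> S" "w < x" "\<And>y. \<lbrakk>y \<in> S; w < y\<rbrakk> \<Longrightarrow> x \<le> y"
  shows "enumerate S (Suc n) = x"
  unfolding enumerate_Suc''[OF assms(1)] assms(2) by (rule Least_equality) (use assms in auto)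

lemma admissible_ordersE:
  assumes "v \<in> admissible_orders a"
  obtains j where "v = 6 * j + 1 \<or> v = 6 * j + 3" "v \<ge> 4 * a - 6"
proof -
  have "v mod 6 = 1 \<or> v mod 6 = 3" and "v \<ge> 4 * a - 6"
    using assms unfolding admissible_orders_def by auto
  moreover have "v = 6 * (v div 6) + v mod 6" by simp
  ultimately show ?thesis using that[of "v div 6"] by metis
qed

lemma admissible_ordersI:
  assumes "v = 6 * j + 1 \<or> v = 6 * j + 3" "v \<ge> 4 * a - 6"
  shows "v \<in> admissible_orders a"
proof -
  have "v mod 6 = 1 \<or> v mod 6 = 3" using assms(1) by presburger
  then show ?thesis using assms(2) unfolding admissible_orders_def by simp
qed

lemma star_order_second:
  assumes "a \<ge> 9" "a mod 6 \<in> {0, 2}"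
  shows "star_order a = enumerate (admissible_orders a) 1"
proof -
  have "a mod 6 = 0 \<or> a mod 6 = 2" using assms by simp
  then have "a = 6 * (a div 6) \<or> a = 6 * (a div 6) + 2" by presburger
  moreover have "a div 6 \<ge> 1" using assms by simp
  ultimately obtain k where k: "k \<ge> 1" "a = 6 * k \<or> a = 6 * k + 2" by blast
  define k' where "k' = 4 * k - 1"
  let ?S = "admissible_orders a"
  let ?w = "4 * a - 5"
  \<comment> \<open>From residue 1 the next admissible order is 2 larger, from residue 3 it is 4
    larger. The smallest one, \<open>4 a - 5\<close>, has residue 1 for \<open>a = 6 k\<close> and
    residue 3 for \<open>a = 6 k + 2\<close>.\<close>
  have cases: "?w = 6 * k' + 1 \<and> star_order a = 6 * k' + 3 \<or>
      ?w = 6 * (k' + 1) + 3 \<and> star_order a = 6 * (k' + 2) + 1"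
  proof -
    have "star_order a = (if a mod 6 = 0 then 4 * a - 3 else 4 * a - 1)"
      using assms unfolding star_order_def by auto
    moreover have "(6 * k) mod 6 = 0" "(6 * k + 2) mod 6 = 2" by presburger+
    ultimately show ?thesis using k unfolding k'_def by (elim disjE; cases k) simp_all
  qed
  have 0: "enumerate ?S 0 = ?w"
  proof (rule enumerate_0_eqI)
    show "?w \<in> ?S" using cases admissible_ordersI[of ?w k' a] admissible_ordersI[of ?w "k' + 1" a]
      by auto
    show "?w \<le> y" if "y \<in> ?S" for y
    proof -
      from that obtain j where j: "y = 6 * j + 1 \<or> y = 6 * j + 3" "y \<ge> 4 * a - 6"
        by (rule admissible_ordersE)
      show ?thesis
      proof (cases "?w = 6 * k' + 1")
        case True
        then have "j \<ge> k'" using j by auto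
        then show ?thesis using True j by auto
      next
        case False
        then have "?w = 6 * (k' + 1) + 3" using cases by blast
        moreover from this j have "j \<ge> k' + 1" by auto
        moreover from calculation j have "y \<noteq> 6 * j + 1 \<or> j \<ge> k' + 2" by auto
        ultimately show ?thesis using j by auto
      qed
    qed
  qed
  have "enumerate ?S (Suc 0) = star_order a"
  proof (rule enumerate_Suc_eqI[OF infinite_admissible_orders 0])
    show "star_order a \<in> ?S"
      using cases admissible_ordersI[of "star_order a" k' a] admissible_ordersI[of "star_order a" "k' + 2" a]
      by auto
    show "?w < star_order a" using cases by auto
    show "star_order a \<le> y" if "y \<in> ?S" "?w < y" for y
    proof -
      from that(1) obtain j where j: "y = 6 * j + 1 \<or> y = 6 * j + 3"
        by (rule admissible_ordersE)
      show ?thesis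
      proof (cases "?w = 6 * k' + 1")
        case True
        then have "j \<ge> k'" using j that by auto
        moreover from True have "y \<noteq> 6 * j + 1 \<or> j \<ge> k' + 1" using that by auto
        ultimately show ?thesis using True cases j by auto
      next
        case False
        then have *: "?w = 6 * (k' + 1) + 3" using cases by blast
        then have "j \<ge> k' + 2" using j that by auto
        then show ?thesis using * cases j by auto
      qed
    qed
  qed
  then show ?thesis by simp
qed

lemma star_order_third:
  assumes "a \<ge> 9" "a mod 6 = 1"
  shows "star_order a = enumerate (admissible_orders a) 2"
proof -
  have "a = 6 * (a div 6) + 1" using assms by presburger
  moreover have "a div 6 \<ge> 1" using assms by simp
  ultimately obtain k where k: "k \<ge> 1" "a = 6 * k + 1" by blast
  define k' where "k' = 4 * k"
  let ?S = "admissible_orders a"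
  \<comment> \<open>The bound lies above \<open>6 * k' - 3\<close> and below
    \<open>6 * k' + 1\<close>, so the list of admissible orders starts with
    \<open>6 * k' + 1\<close>, \<open>6 * k' + 3\<close>, \<open>6 * k' + 7\<close>.\<close>
  have a: "4 * a - 6 = 6 * k' - 2" using k by (simp add: k'_def)
  have 0: "enumerate ?S 0 = 6 * k' + 1"
  proof (rule enumerate_0_eqI)
    show "6 * k' + 1 \<in> ?S" using a by (intro admissible_ordersI[of _ k']) auto
    show "6 * k' + 1 \<le> y" if "y \<in> ?S" for y
    proof -
      from that obtain j where j: "y = 6 * j + 1 \<or> y = 6 * j + 3" "y \<ge> 4 * a - 6"
        by (rule admissible_ordersE)
      then have "j \<ge> k'" using a by auto
      then show ?thesis using j by auto
    qed
  qed
  have 1: "enumerate ?S (Suc 0) = 6 * k' + 3"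
  proof (rule enumerate_Suc_eqI[OF infinite_admissible_orders 0])
    show "6 * k' + 3 \<in> ?S" using a by (intro admissible_ordersI[of _ k']) auto
    show "6 * k' + 3 \<le> y" if "y \<in> ?S" "6 * k' + 1 < y" for y
    proof -
      from that(1) obtain j where j: "y = 6 * j + 1 \<or> y = 6 * j + 3"
        by (rule admissible_ordersE)
      then have "j \<ge> k'" "y \<noteq> 6 * j + 1 \<or> j \<ge> k' + 1" using that by auto
      then show ?thesis using j by auto
    qed
  qed simp
  have "enumerate ?S (Suc (Suc 0)) = 6 * (k' + 1) + 1"
  proof (rule enumerate_Suc_eqI[OF infinite_admissible_orders 1])
    show "6 * (k' + 1) + 1 \<in> ?S" using a by (intro admissible_ordersI[of _ "k' + 1"]) auto
    show "6 * (k' + 1) + 1 \<le> y" if "y \<in> ?S" "6 * k' + 3 < y" for y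
    proof -
      from that(1) obtain j where j: "y = 6 * j + 1 \<or> y = 6 * j + 3"
        by (rule admissible_ordersE)
      then have "j \<ge> k' + 1" using that by auto
      then show ?thesis using j by auto
    qed
  qed simp
  moreover have "star_order a = 6 * (k' + 1) + 1" using assms k by (simp add: star_order_def k'_def)
  ultimately show ?thesis by (simp add: numeral_2_eq_2)
qed

subsection \<open>Doubling and Pasch trades\<close>

text \<open>A trade: at a pair covered by \<open>\<O>\<close> the old block is gone and exactly one
  new block takes over, and all other pairs are untouched. New blocks lie in \<open>V\<close>
  because each of their points is in a pair covered by an old block.\<close>

lemma steiner_triple_system_replace:
  assumes S: "steiner_triple_system v V \<B>" and "\<O> \<subseteq> \<B>"
    and new: "\<And>B. B \<in> \<N> \<Longrightarrow> card B = 3"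
    and cover: "\<And>x y. x \<noteq> y \<Longrightarrow> (\<exists>B\<in>\<N>. {x, y} \<subseteq> B) \<longleftrightarrow> (\<exists>B\<in>\<O>. {x, y} \<subseteq> B)"
    and linear: "\<And>x y B B'. \<lbrakk>B \<in> \<N>; B' \<in> \<N>; x \<noteq> y; {x, y} \<subseteq> B; {x, y} \<subseteq> B'\<rbrakk> \<Longrightarrow> B = B'"
  shows "steiner_triple_system v V (\<B> - \<O> \<union> \<N>)"
proof -
  note uniq = steiner_triple_system_unique[OF S]
  have sub: "B \<subseteq> V" if "B \<in> \<N>" for B
  proof
    fix x assume "x \<in> B"
    obtain y where "y \<in> B" "x \<noteq> y"
      using new[OF \<open>B \<in> \<N>\<close>] \<open>x \<in> B\<close> by (metis card_3_iff insertCI)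
    then obtain C where "C \<in> \<O>" "{x, y} \<subseteq> C" using cover[of x y] \<open>B \<in> \<N>\<close> \<open>x \<in> B\<close> by auto
    then show "x \<in> V" using assms(2) steiner_triple_system_block[OF S] by auto
  qed
  have "\<exists>!B. B \<in> \<B> - \<O> \<union> \<N> \<and> {x, y} \<subseteq> B" if xy: "x \<in> V" "y \<in> V" "x \<noteq> y" for x y
  proof (cases "\<exists>C\<in>\<O>. {x, y} \<subseteq> C")
    case True
    then obtain C where C: "C \<in> \<O>" "{x, y} \<subseteq> C" by auto
    obtain B where B: "B \<in> \<N>" "{x, y} \<subseteq> B" using True cover[OF xy(3)] by auto
    show ?thesis
    proof (rule ex1I[of _ B])
      fix B' assume B': "B' \<in> \<B> - \<O> \<union> \<N> \<and> {x, y} \<subseteq> B'"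
      have "B' \<notin> \<B> - \<O>"
      proof
        assume "B' \<in> \<B> - \<O>"
        then have "B' = C" using uniq[of B' C x y] B' C assms(2) xy(3) by auto
        then show False using \<open>B' \<in> \<B> - \<O>\<close> C by simp
      qed
      then show "B' = B" using linear[of B' B x y] B' B xy(3) by auto
    qed (use B in auto)
  next
    case False
    obtain B where B: "B \<in> \<B>" "{x, y} \<subseteq> B" using steiner_triple_system_pair[OF S xy] by auto
    have no: "\<not> (\<exists>B\<in>\<N>. {x, y} \<subseteq> B)" using False cover[OF xy(3)] by simp
    show ?thesis
    proof (rule ex1I[of _ B])
      show "B \<in> \<B> - \<O> \<union> \<N> \<and> {x, y} \<subseteq> B" using B False by auto
      fix B' assume B': "B' \<in> \<B> - \<O> \<union> \<N> \<and> {x, y} \<subseteq> B'"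
      then have "B' \<in> \<B>" using no by auto
      then show "B' = B" using uniq[of B' B x y] B B' xy(3) by simp
    qed
  qed
  moreover have "B \<subseteq> V" "card B = 3" if "B \<in> \<B> - \<O> \<union> \<N>" for B
    using that sub[of B] new[of B] steiner_triple_system_block[OF S, of B] by blast+
  ultimately show ?thesis
    using steiner_triple_system_finite[OF S] unfolding steiner_triple_system_def by simp
qed

text \<open>Exchanging the opposite points \<open>a\<close> and \<open>w\<close> of a Pasch configuration
  replaces its four blocks by four others on the same pairs.\<close>

definition pasch :: "'a \<Rightarrow> 'a \<Rightarrow> 'a \<Rightarrow> 'a \<Rightarrow> 'a \<Rightarrow> 'a \<Rightarrow> 'a set set" where
  "pasch a p q s t w = {{a, p, s}, {a, q, t}, {w, p, q}, {w, s, t}}"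

text \<open>For six distinct points both families cover all pairs except the opposite ones
  \<open>a, w\<close>, \<open>p, t\<close> and \<open>q, s\<close>, a condition symmetric in
  \<open>a\<close> and \<open>w\<close>.\<close>

lemma pasch_pairs:
  assumes "x \<noteq> y"
  shows "(\<exists>B\<in>pasch w p q s t a. {x, y} \<subseteq> B) \<longleftrightarrow> (\<exists>B\<in>pasch a p q s t w. {x, y} \<subseteq> B)"
  unfolding pasch_def using assms by auto

lemma pasch_linear:
  assumes "distinct [a, p, q, s, t, w]" "B \<in> pasch a p q s t w" "B' \<in> pasch a p q s t w"
    "x \<noteq> y" "{x, y} \<subseteq> B" "{x, y} \<subseteq> B'"
  shows "B = B'"
  using assms unfolding pasch_def by auto

lemma pasch_card: "\<lbrakk>distinct [a, p, q, s, t, w]; B \<in> pasch a p q s t w\<rbrakk> \<Longrightarrow> card B = 3"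
  unfolding pasch_def by auto

lemma pasch_trades:
  assumes S: "steiner_triple_system v V \<B>"
    and old: "\<And>i. i \<in> I \<Longrightarrow> pasch (a i) (p i) (q i) (s i) (t i) (w i) \<subseteq> \<B>"
    and dist: "\<And>i. i \<in> I \<Longrightarrow> distinct [a i, p i, q i, s i, t i, w i]"
    and disj: "\<And>i j. \<lbrakk>i \<in> I; j \<in> I; i \<noteq> j\<rbrakk> \<Longrightarrow>
       pasch (a i) (p i) (q i) (s i) (t i) (w i) \<inter> pasch (a j) (p j) (q j) (s j) (t j) (w j) = {}"
  shows "steiner_triple_system v V
    (\<B> - (\<Union>i\<in>I. pasch (a i) (p i) (q i) (s i) (t i) (w i)) \<union>
      (\<Union>i\<in>I. pasch (w i) (p i) (q i) (s i) (t i) (a i)))"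
proof (rule steiner_triple_system_replace[OF S])
  have dist': "distinct [w i, p i, q i, s i, t i, a i]" if "i \<in> I" for i
    using dist[OF that] by auto
  show "(\<Union>i\<in>I. pasch (a i) (p i) (q i) (s i) (t i) (w i)) \<subseteq> \<B>" using old by auto
  show "card B = 3" if "B \<in> (\<Union>i\<in>I. pasch (w i) (p i) (q i) (s i) (t i) (a i))" for B
  proof -
    from that obtain i where "i \<in> I" "B \<in> pasch (w i) (p i) (q i) (s i) (t i) (a i)" by auto
    then show ?thesis using pasch_card[OF dist'] by simp
  qed
  show "(\<exists>B\<in>\<Union>i\<in>I. pasch (w i) (p i) (q i) (s i) (t i) (a i). {x, y} \<subseteq> B) \<longleftrightarrow>
        (\<exists>B\<in>\<Union>i\<in>I. pasch (a i) (p i) (q i) (s i) (t i) (w i). {x, y} \<subseteq> B)" if "x \<noteq> y" for x y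
    using pasch_pairs[OF that] by simp
  fix x y B B'
  assume B: "B \<in> (\<Union>i\<in>I. pasch (w i) (p i) (q i) (s i) (t i) (a i))"
    and B': "B' \<in> (\<Union>i\<in>I. pasch (w i) (p i) (q i) (s i) (t i) (a i))"
    and xy: "x \<noteq> y" "{x, y} \<subseteq> B" "{x, y} \<subseteq> B'"
  obtain i where i: "i \<in> I" "B \<in> pasch (w i) (p i) (q i) (s i) (t i) (a i)" using B by auto
  obtain j where j: "j \<in> I" "B' \<in> pasch (w j) (p j) (q j) (s j) (t j) (a j)" using B' by auto
  \<comment> \<open>The pair is traced back to old blocks, which coincide because they lie in
    \<open>\<B>\<close>; disjointness of the configurations then gives \<open>i = j\<close>.\<close>
  have "\<exists>C\<in>pasch (w i) (p i) (q i) (s i) (t i) (a i). {x, y} \<subseteq> C" using i xy by auto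
  then obtain C where C: "C \<in> pasch (a i) (p i) (q i) (s i) (t i) (w i)" "{x, y} \<subseteq> C"
    unfolding pasch_pairs[OF xy(1)] by (rule bexE)
  have "\<exists>C\<in>pasch (w j) (p j) (q j) (s j) (t j) (a j). {x, y} \<subseteq> C" using j xy by auto
  then obtain C' where C': "C' \<in> pasch (a j) (p j) (q j) (s j) (t j) (w j)" "{x, y} \<subseteq> C'"
    unfolding pasch_pairs[OF xy(1)] by (rule bexE)
  have "C \<in> \<B>" "C' \<in> \<B>" using C C' old[OF i(1)] old[OF j(1)] by auto
  then have "C = C'" using steiner_triple_system_unique[OF S _ _ C(2) C'(2) xy(1)] by simp
  then have "i = j" using disj[OF i(1) j(1)] C C' by auto
  then show "B = B'" using pasch_linear[OF dist'[OF i(1)] i(2) _ xy] j by simp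
qed

text \<open>A proper edge colouring \<open>g\<close> of the complete graph on \<open>X\<close> with colour set
  \<open>W\<close>, where every vertex sees every colour, turns the edges into triples with third point
  the colour. If a pair \<open>R\<close> of vertices is removed, each remaining vertex misses two
  colours, with which it forms a further block.\<close>

locale doubling =
  fixes W :: "'a set" and X :: "'b set" and g :: "'b \<Rightarrow> 'b \<Rightarrow> 'a" and R :: "'b set"
    and T :: "'a set set"
  assumes fin: "finite W" "finite X"
    and sym: "\<lbrakk>x \<in> X; y \<in> X\<rbrakk> \<Longrightarrow> g x y = g y x"
    and closed: "\<lbrakk>x \<in> X; y \<in> X; x \<noteq> y\<rbrakk> \<Longrightarrow> g x y \<in> W"
    and partner: "\<lbrakk>x \<in> X; u \<in> W\<rbrakk> \<Longrightarrow> \<exists>y\<in>X. y \<noteq> x \<and> g x y = u"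
    and proper: "\<lbrakk>x \<in> X; y \<in> X; z \<in> X; y \<noteq> x; z \<noteq> x; g x y = g x z\<rbrakk> \<Longrightarrow> y = z"
    and removed: "R \<subseteq> X" "R = {} \<or> card R = 2"
    and T3: "t \<in> T \<Longrightarrow> card t = 3"
    and design: "pair_design W (T \<union> (\<lambda>x. g x ` R) ` (X - R))"
    and inj: "R \<noteq> {} \<Longrightarrow> inj_on (\<lambda>x. g x ` R) (X - R)"
begin

definition points :: "('a + 'b) set" where
  "points = Inl ` W \<union> Inr ` (X - R)"

definition tri :: "'b \<Rightarrow> 'b \<Rightarrow> ('a + 'b) set" where
  "tri x y = {Inr x, Inr y, Inl (g x y)}"

definition blocks :: "('a + 'b) set set" where
  "blocks = (`) Inl ` T \<union> {tri x y | x y. x \<in> X - R \<and> y \<in> X - R \<and> x \<noteq> y} \<union>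
     {insert (Inr x) (Inl ` g x ` R) | x. x \<in> X - R \<and> R \<noteq> {}}"

lemma removed_colours:
  assumes "x \<in> X - R" "R \<noteq> {}"
  shows "card (g x ` R) = 2"
proof -
  have "inj_on (g x) R"
    using assms removed proper[of x] by (intro inj_onI) auto
  then show ?thesis using removed assms card_image by metis
qed

lemma blocksE:
  assumes "B \<in> blocks"
  obtains (1) t where "B = Inl ` t" "t \<in> T"
  | (2) x y where "B = tri x y" "x \<in> X - R" "y \<in> X - R" "x \<noteq> y"
  | (3) x where "B = insert (Inr x) (Inl ` g x ` R)" "x \<in> X - R" "R \<noteq> {}"
  using assms unfolding blocks_def
proof (elim UnE imageE CollectE exE conjE)
  show thesis if "B = Inl ` t" "t \<in> T" for t by (rule 1[OF that])
  show thesis if "B = tri x y" "x \<in> X - R" "y \<in> X - R" "x \<noteq> y" for x y by (rule 2[OF that])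
  show thesis if "B = insert (Inr x) (Inl ` g x ` R)" "x \<in> X - R" "R \<noteq> {}" for x
    by (rule 3[OF that])
qed

lemma tri_in_blocks: "\<lbrakk>x \<in> X - R; y \<in> X - R; x \<noteq> y\<rbrakk> \<Longrightarrow> tri x y \<in> blocks"
  unfolding blocks_def by (rule UnI1, rule UnI2, rule CollectI) blast

lemma tri_commute: "\<lbrakk>x \<in> X; y \<in> X\<rbrakk> \<Longrightarrow> tri x y = tri y x"
  using sym[of x y] unfolding tri_def by auto

lemma block_subset: "B \<in> blocks \<Longrightarrow> B \<subseteq> points"
proof (erule blocksE)
  fix t assume "B = Inl ` t" "t \<in> T"
  moreover from this have "t \<subseteq> W" using design unfolding pair_design_def by auto
  ultimately show ?thesis unfolding points_def by auto
next
  fix x assume x: "B = insert (Inr x) (Inl ` g x ` R)" "x \<in> X - R"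
  have "g x r \<in> W" if "r \<in> R" for r using closed[of x r] x removed(1) that by auto
  then show ?thesis using x unfolding points_def by auto
qed (use closed in \<open>auto simp: points_def tri_def\<close>)

lemma block_card: "B \<in> blocks \<Longrightarrow> card B = 3"
proof (erule blocksE)
  fix t assume "B = Inl ` t" "t \<in> T"
  then show ?thesis using T3 by (simp add: card_image)
next
  fix x y :: 'b assume "B = tri x y" "x \<noteq> y"
  then show ?thesis by (simp add: tri_def)
next
  fix x assume x: "B = insert (Inr x) (Inl ` g x ` R)" "x \<in> X - R" "R \<noteq> {}"
  have "card (Inl ` g x ` R :: ('a + 'b) set) = 2"
    using removed_colours[OF x(2,3)] by (simp add: card_image)
  moreover have "finite R" using finite_subset[OF removed(1)] fin by simp
  ultimately show ?thesis unfolding x(1) by (subst card_insert_disjoint) auto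
qed

text \<open>Distinct vertices miss distinct pairs of colours by \<open>inj\<close>, and a triple of
  \<open>T\<close> is told apart from such a pair by its size.\<close>

lemma colour_pair_block:
  assumes "u \<in> W" "u' \<in> W" "u \<noteq> u'"
  shows "\<exists>!B. B \<in> blocks \<and> {Inl u, Inl u'} \<subseteq> B"
proof -
  obtain e where e: "e \<in> T \<union> (\<lambda>x. g x ` R) ` (X - R)" "{u, u'} \<subseteq> e"
    using design assms unfolding pair_design_def by metis
  note uniq = pair_design_unique[OF design _ e(1) _ e(2) assms(3)]
  have R2: "card (g x ` R) = 2" "R \<noteq> {}" if "x \<in> X - R" "{u, u'} \<subseteq> g x ` R" for x
    using removed_colours[OF that(1)] that(2) by auto
  show ?thesis
  proof (cases "e \<in> T")
    case True
    show ?thesis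
    proof (rule ex1I[of _ "Inl ` e"])
      show "Inl ` e \<in> blocks \<and> {Inl u, Inl u'} \<subseteq> Inl ` e"
        using True e unfolding blocks_def by auto
      fix B assume B: "B \<in> blocks \<and> {Inl u, Inl u'} \<subseteq> B"
      from B have "B \<in> blocks" by simp
      then show "B = Inl ` e"
      proof (cases rule: blocksE)
        case (1 t)
        then show ?thesis using uniq[of t] B by auto
      next
        case (2 x y)
        then show ?thesis using B assms by (auto simp: tri_def)
      next
        case (3 x)
        then have "{u, u'} \<subseteq> g x ` R" using B by auto
        then have "g x ` R = e" using uniq[of "g x ` R"] 3 by auto
        then show ?thesis using R2[OF 3(2)] T3[OF True] e by auto
      qed
    qed
  next
    case False
    then obtain x where x: "x \<in> X - R" "e = g x ` R" using e by auto
    have "R \<noteq> {}" using R2 x e by auto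
    show ?thesis
    proof (rule ex1I[of _ "insert (Inr x) (Inl ` e)"])
      show "insert (Inr x) (Inl ` e) \<in> blocks \<and> {Inl u, Inl u'} \<subseteq> insert (Inr x) (Inl ` e)"
        using x e \<open>R \<noteq> {}\<close> unfolding blocks_def by auto
      fix B assume B: "B \<in> blocks \<and> {Inl u, Inl u'} \<subseteq> B"
      from B have "B \<in> blocks" by simp
      then show "B = insert (Inr x) (Inl ` e)"
      proof (cases rule: blocksE)
        case (1 t)
        then have "t = e" using uniq[of t] B by auto
        then show ?thesis using False 1 by simp
      next
        case (2 x y)
        then show ?thesis using B assms by (auto simp: tri_def)
      next
        case (3 y)
        then have "{u, u'} \<subseteq> g y ` R" using B by auto
        then have "g y ` R = g x ` R" using uniq[of "g y ` R"] 3 x by auto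
        then have "y = x" using inj_onD[OF inj[OF \<open>R \<noteq> {}\<close>]] 3 x by auto
        then show ?thesis using 3 x by simp
      qed
    qed
  qed
qed

text \<open>The neighbour \<open>y\<close> of \<open>x\<close> in colour \<open>u\<close> decides:
  if it remains, the edge gives the block; if it is removed, \<open>u\<close> is a colour missing at
  \<open>x\<close>.\<close>

lemma mixed_pair_block:
  assumes x: "x \<in> X - R" and u: "u \<in> W"
  shows "\<exists>!B. B \<in> blocks \<and> {Inr x, Inl u} \<subseteq> B"
proof -
  obtain y where y: "y \<in> X" "y \<noteq> x" "g x y = u" using partner[of x u] x u by auto
  note uniq = proper[of x _ y, OF _ _ y(1) _ y(2)]
  have tri: "{z, z'} = {x, y}"
    if "z \<in> X - R" "z' \<in> X - R" "z \<noteq> z'" "{Inr x, Inl u} \<subseteq> tri z z'" for z z'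
  proof -
    have "g z z' = u" and "x = z \<or> x = z'" using that(4) by (auto simp: tri_def)
    then show ?thesis
      using uniq[of z'] uniq[of z] that sym[of z z'] y(3) x by auto
  qed
  have rem: "y \<in> R" if "u \<in> g x ` R"
  proof -
    from that obtain r where "r \<in> R" "g x r = u" by auto
    moreover from this have "r \<in> X" "r \<noteq> x" using removed(1) x by auto
    ultimately show ?thesis using uniq[of r] y x by auto
  qed
  show ?thesis
  proof (cases "y \<in> R")
    case False
    show ?thesis
    proof (rule ex1I[of _ "tri x y"])
      show "tri x y \<in> blocks \<and> {Inr x, Inl u} \<subseteq> tri x y"
        using tri_in_blocks[of x y] False x y by (auto simp: tri_def)
      fix B assume B: "B \<in> blocks \<and> {Inr x, Inl u} \<subseteq> B"
      from B have "B \<in> blocks" by simp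
      then show "B = tri x y"
      proof (cases rule: blocksE)
        case (2 z z')
        then have "{z, z'} = {x, y}" using tri[of z z'] B by auto
        then show ?thesis using 2 tri_commute[of x y] x y by (auto simp: doubleton_eq_iff)
      next
        case (3 z)
        then have "z = x" "u \<in> g x ` R" using B by auto
        then show ?thesis using rem False by simp
      qed (use B in auto)
    qed
  next
    case True
    show ?thesis
    proof (rule ex1I[of _ "insert (Inr x) (Inl ` g x ` R)"])
      show "insert (Inr x) (Inl ` g x ` R) \<in> blocks \<and>
          {Inr x, Inl u} \<subseteq> insert (Inr x) (Inl ` g x ` R)"
        using True x y unfolding blocks_def by auto
      fix B assume B: "B \<in> blocks \<and> {Inr x, Inl u} \<subseteq> B"
      from B have "B \<in> blocks" by simp
      then show "B = insert (Inr x) (Inl ` g x ` R)"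
      proof (cases rule: blocksE)
        case (2 z z')
        then have "{z, z'} = {x, y}" using tri[of z z'] B by auto
        then show ?thesis using 2 True by auto
      next
        case (3 z)
        then show ?thesis using B by auto
      qed (use B in auto)
    qed
  qed
qed

lemma outer_pair_block:
  assumes "x \<in> X - R" "y \<in> X - R" "x \<noteq> y"
  shows "\<exists>!B. B \<in> blocks \<and> {Inr x, Inr y} \<subseteq> B"
proof (rule ex1I[of _ "tri x y"])
  show "tri x y \<in> blocks \<and> {Inr x, Inr y} \<subseteq> tri x y"
    using tri_in_blocks[OF assms] by (auto simp: tri_def)
  fix B assume B: "B \<in> blocks \<and> {Inr x, Inr y} \<subseteq> B"
  from B have "B \<in> blocks" by simp
  then show "B = tri x y"
  proof (cases rule: blocksE)
    case (2 z z')
    then have "z = x \<and> z' = y \<or> z = y \<and> z' = x" using B assms by (auto simp: tri_def)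
    then show ?thesis using 2 tri_commute[of x y] assms by auto
  qed (use B assms in auto)
qed

lemma steiner: "steiner_triple_system (card W + card (X - R)) points blocks"
  unfolding steiner_triple_system_alt pair_design_def
proof (intro conjI ballI impI)
  show "finite points" unfolding points_def using fin by simp
  have "card points = card (Inl ` W :: ('a + 'b) set) + card (Inr ` (X - R) :: ('a + 'b) set)"
    unfolding points_def by (rule card_Un_disjoint) (use fin in auto)
  then show "card points = card W + card (X - R)" by (simp add: card_image)
  show "card B = 3" "B \<subseteq> points" if "B \<in> blocks" for B
    using block_card[OF that] block_subset[OF that] .
  fix a b assume ab: "a \<in> points" "b \<in> points" "a \<noteq> b"
  consider u u' where "a = Inl u" "b = Inl u'" "u \<in> W" "u' \<in> W"
    | x u where "a = Inr x" "b = Inl u" "x \<in> X - R" "u \<in> W"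
    | x u where "a = Inl u" "b = Inr x" "x \<in> X - R" "u \<in> W"
    | x y where "a = Inr x" "b = Inr y" "x \<in> X - R" "y \<in> X - R" "x \<noteq> y"
    using ab unfolding points_def by blast
  then show "\<exists>!B. B \<in> blocks \<and> {a, b} \<subseteq> B"
  proof cases
    case 1
    then show ?thesis using colour_pair_block ab by simp
  next
    case 2
    then show ?thesis using mixed_pair_block by simp
  next
    case (3 x u)
    then show ?thesis using mixed_pair_block[of x u] by (simp only: insert_commute)
  next
    case 4
    then show ?thesis using outer_pair_block by simp
  qed
qed

end

text \<open>The vertices outside \<open>P\<close> and \<open>L\<close> are to become unplayable: for \<open>(z, p, q)\<close> in
  \<open>K\<close>, a Pasch trade creates the block \<open>{z, p, q}\<close>.\<close>

locale doubling_star = doubling W X g R T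
  for W :: "'a::countable set" and X :: "'b::countable set" and g R T +
  fixes P L :: "'b set" and c :: 'a and K :: "('b \<times> 'b \<times> 'b) set"
  assumes P: "P \<subseteq> X - R" and L: "L \<subseteq> X - R" and PL: "P \<inter> L = {}" and c: "c \<in> W"
    and PLc: "p \<in> P \<Longrightarrow> \<exists>l\<in>L. g p l = c"
    and LPc: "l \<in> L \<Longrightarrow> \<exists>p\<in>P. g l p = c"
    and K: "(z, p, q) \<in> K \<Longrightarrow>
      z \<in> X - R - P - L \<and> p \<in> P \<and> q \<in> P \<and> p \<noteq> q \<and> {g z p, g z q, g p q} \<in> T"
    and K_cover: "X - R \<subseteq> P \<union> L \<union> fst ` K"
    and K_disjoint: "\<lbrakk>(z, p, q) \<in> K; (z', p', q') \<in> K; (z, p, q) \<noteq> (z', p', q')\<rbrakk> \<Longrightarrow>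
      z \<noteq> z' \<and> {g z p, g z q, g p q} \<inter> {g z' p', g z' q', g p' q'} = {}"
    and covered: "u \<in> W - {c} \<Longrightarrow>
      \<exists>p\<in>P. \<exists>q\<in>P. p \<noteq> q \<and> g p q = u \<and> (\<forall>(z, p', q')\<in>K. {p', q'} \<noteq> {p, q})"
begin

section \<open>Stars in doublings with Pasch trades\<close>

lemma centre_colour:
  assumes "x \<in> P" "y \<in> X" "y \<notin> L" "x \<noteq> y"
  shows "g x y \<noteq> c"
proof
  assume "g x y = c"
  obtain l where l: "l \<in> L" "g x l = c" using PLc[OF assms(1)] by auto
  have "x \<in> X" "l \<in> X" "l \<noteq> x" using assms(1) l P L PL by auto
  then have "l = y" using proper[of x l y] l assms \<open>g x y = c\<close> by simp
  then show False using l assms by simp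
qed

lemma centre_colour_leaf:
  assumes "x \<in> L" "y \<in> L" "x \<noteq> y"
  shows "g x y \<noteq> c"
proof
  assume "g x y = c"
  obtain p where p: "p \<in> P" "g x p = c" using LPc[OF assms(1)] by auto
  have "x \<in> X" "y \<in> X" "p \<in> X" "p \<noteq> x" using assms p P L PL by auto
  then have "p = y" using proper[of x p y] p assms \<open>g x y = c\<close> by simp
  then show False using p assms PL by auto
qed

text \<open>A triangle \<open>z, p, q\<close> whose three edge colours form a triple of
  \<open>T\<close> gives a Pasch configuration in which \<open>z\<close> is opposite to the colour
  of \<open>p q\<close>.\<close>

definition old :: "'b \<times> 'b \<times> 'b \<Rightarrow> ('a + 'b) set set" where
  "old = (\<lambda>(z, p, q). pasch (Inr z) (Inr p) (Inr q) (Inl (g z p)) (Inl (g z q)) (Inl (g p q)))"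

definition new :: "'b \<times> 'b \<times> 'b \<Rightarrow> ('a + 'b) set set" where
  "new = (\<lambda>(z, p, q). pasch (Inl (g p q)) (Inr p) (Inr q) (Inl (g z p)) (Inl (g z q)) (Inr z))"

definition traded :: "('a + 'b) set set" where
  "traded = blocks - (\<Union>k\<in>K. old k) \<union> (\<Union>k\<in>K. new k)"

lemma old_eq:
  "old (z, p, q) = {tri z p, tri z q, tri p q, Inl ` {g z p, g z q, g p q}}"
  if "p \<in> X" "q \<in> X" for z p q
  unfolding old_def pasch_def tri_def by (simp add: insert_commute)

lemma KD:
  assumes "(z, p, q) \<in> K"
  shows "z \<in> X" "z \<notin> R" "z \<notin> P" "z \<notin> L" "p \<in> P" "q \<in> P" "p \<noteq> q" "{g z p, g z q, g p q} \<in> T"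
    "p \<in> X" "q \<in> X" "p \<notin> R" "q \<notin> R" "z \<noteq> p" "z \<noteq> q"
  using K[OF assms] P by auto

text \<open>The colours form a triple of \<open>T\<close> and are distinct by its size; none is
  \<open>c\<close>, because the neighbours of played vertices in colour \<open>c\<close> are
  leaves.\<close>

lemma K_colours:
  assumes "(z, p, q) \<in> K"
  shows "distinct [g z p, g z q, g p q, c]"
proof -
  note k = KD[OF assms]
  have "g z p \<noteq> c" using centre_colour[of p z] k sym[of z p] by simp
  moreover have "g z q \<noteq> c" using centre_colour[of q z] k sym[of z q] by simp
  moreover have "g p q \<noteq> c" using centre_colour[of p q] k PL by auto
  moreover have "card {g z p, g z q, g p q} = 3" using T3 k by simp
  then have "distinct [g z p, g z q, g p q]" using card_distinct[of "[g z p, g z q, g p q]"] by simp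
  ultimately show ?thesis by auto
qed

lemma traded_steiner: "steiner_triple_system (card W + card (X - R)) points traded"
proof -
  define a p q s t w :: "'b \<times> 'b \<times> 'b \<Rightarrow> 'a + 'b" where
    "a = (\<lambda>(z, p, q). Inr z)" and "p = (\<lambda>(z, p, q). Inr p)" and "q = (\<lambda>(z, p, q). Inr q)" and
    "s = (\<lambda>(z, p, q). Inl (g z p))" and "t = (\<lambda>(z, p, q). Inl (g z q))" and
    "w = (\<lambda>(z, p, q). Inl (g p q))"
  note defs = a_def p_def q_def s_def t_def w_def
  have o: "old k = pasch (a k) (p k) (q k) (s k) (t k) (w k)" for k
    by (cases k) (simp add: old_def defs)
  have n: "new k = pasch (w k) (p k) (q k) (s k) (t k) (a k)" for k
    by (cases k) (simp add: new_def defs)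
  have "old k \<subseteq> blocks" if "k \<in> K" for k
  proof -
    obtain z x y where k: "k = (z, x, y)" by (cases k)
    note kd = KD[OF that[unfolded k]]
    have "Inl ` {g z x, g z y, g x y} \<in> blocks"
      unfolding blocks_def by (intro UnI1 imageI) (rule kd)
    then show ?thesis unfolding k using kd by (simp add: old_eq tri_in_blocks)
  qed
  moreover have "distinct [a k, p k, q k, s k, t k, w k]" if "k \<in> K" for k
  proof -
    obtain z x y where k: "k = (z, x, y)" by (cases k)
    show ?thesis
      using KD[OF that[unfolded k]] K_colours[OF that[unfolded k]] unfolding k defs by auto
  qed
  moreover have "old k \<inter> old k' = {}" if "k \<in> K" "k' \<in> K" "k \<noteq> k'" for k k'
  proof -
    obtain z x y where k: "k = (z, x, y)" by (cases k)
    obtain z' x' y' where k': "k' = (z', x', y')" by (cases k')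
    have d: "{g z x, g z y, g x y} \<inter> {g z' x', g z' y', g x' y'} = {}"
      using K_disjoint[of z x y z' x' y'] that unfolding k k' by auto
    \<comment> \<open>Each old block contains some colour, and only colours of its own triple; as
      these triples are disjoint, so are the configurations.\<close>
    have col: "(\<exists>u. Inl u \<in> B) \<and> (\<forall>u. Inl u \<in> B \<longrightarrow> u \<in> {g z x, g z y, g x y})"
      if "B \<in> old (z, x, y)" for z x y B
      using that unfolding old_def pasch_def by auto
    show ?thesis
    proof (rule ccontr)
      assume "old k \<inter> old k' \<noteq> {}"
      then obtain B where B: "B \<in> old (z, x, y)" "B \<in> old (z', x', y')"
        unfolding k k' by auto
      then obtain u where "Inl u \<in> B" using col by metis
      then have "u \<in> {g z x, g z y, g x y}" "u \<in> {g z' x', g z' y', g x' y'}"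
        using col[OF B(1)] col[OF B(2)] by simp_all
      then show False using d by blast
    qed
  qed
  ultimately show ?thesis
    unfolding traded_def using pasch_trades[OF steiner, of K a p q s t w] unfolding o n by blast
qed

lemma traded_star_position: "star_position points traded (Inr ` P) (Inl c) (Inr ` L)"
proof -
  have mem: "Inr x \<in> Inr ` P \<union> Inr ` L \<union> {Inl c} \<longleftrightarrow> x \<in> P \<or> x \<in> L"
    "Inl u \<in> Inr ` P \<union> Inr ` L \<union> {Inl c} \<longleftrightarrow> u = c" for x u
    by auto
  have tri_Int: "tri x y \<inter> (Inr ` P \<union> Inr ` L \<union> {Inl c}) = {Inr x, Inr y}"
    if "{x, y} \<subseteq> P \<or> {x, y} \<subseteq> L" "x \<noteq> y" for x y
  proof -
    have "g x y \<noteq> c"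
      using centre_colour[of x y] centre_colour_leaf[of x y] that P PL by blast
    then show ?thesis using that(1) unfolding tri_def by auto
  qed
  have outer: "B \<inter> (Inr ` P \<union> Inr ` L \<union> {Inl c}) = {Inr x, Inr y}"
    if B: "B \<in> traded" and xy: "{x, y} \<subseteq> P \<or> {x, y} \<subseteq> L" "x \<noteq> y" "{Inr x, Inr y} \<subseteq> B"
    for B x y
  proof (cases "B \<in> blocks")
    case True
    then show ?thesis
    proof (cases rule: blocksE)
      case (2 u v)
      then have "{u, v} = {x, y}" using xy(2,3) by (auto simp: tri_def)
      then have "tri u v = tri x y" using 2 tri_commute[of u v] by (auto simp: doubleton_eq_iff)
      then show ?thesis using 2 tri_Int[OF xy(1,2)] by simp
    qed (use xy in auto)
  next
    case False
    then obtain z p q where k: "(z, p, q) \<in> K" "B \<in> new (z, p, q)"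
      using B unfolding traded_def by auto
    note kd = KD[OF k(1)]
    \<comment> \<open>The only new block with two vertices is \<open>{z, p, q}\<close>, and
      \<open>z\<close> is neither played nor a leaf.\<close>
    have "z \<notin> {x, y}" using xy(1) kd(3,4) by auto
    then have "B = {Inr z, Inr p, Inr q}" "{x, y} = {p, q}"
      using k(2) xy(2,3) kd unfolding new_def pasch_def by auto
    then show ?thesis using kd mem by auto
  qed
  show ?thesis
    unfolding star_position_def
  proof (intro conjI ballI impI)
    show "Inr ` P \<subseteq> points" "Inr ` L \<subseteq> points" "Inl c \<in> points"
      using P L c unfolding points_def by auto
    show "Inl c \<notin> Inr ` P" "Inl c \<notin> Inr ` L" by auto
    show "Inr ` P \<inter> Inr ` L = {}" using PL by auto
    show "B \<inter> (Inr ` P \<union> Inr ` L \<union> {Inl c}) = {p, q}"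
      if "B \<in> traded" "p \<in> Inr ` P" "q \<in> Inr ` P" "p \<noteq> q" "{p, q} \<subseteq> B" for B p q
    proof -
      obtain x y where "p = Inr x" "q = Inr y" "x \<in> P" "y \<in> P"
        using \<open>p \<in> _\<close> \<open>q \<in> _\<close> by auto
      then show ?thesis using outer[of B x y] that by simp
    qed
    show "B \<inter> (Inr ` P \<union> Inr ` L \<union> {Inl c}) = {p, q}"
      if "B \<in> traded" "p \<in> Inr ` L" "q \<in> Inr ` L" "p \<noteq> q" "{p, q} \<subseteq> B" for B p q
    proof -
      obtain x y where "p = Inr x" "q = Inr y" "x \<in> L" "y \<in> L"
        using \<open>p \<in> _\<close> \<open>q \<in> _\<close> by auto
      then show ?thesis using outer[of B x y] that by simp
    qed
    \<comment> \<open>The triple of an edge is lost only if the edge contains a traded vertex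
      \<open>z\<close> or is the edge \<open>p q\<close> of a traded triangle. Edges between leaves
      and played vertices, and those provided by \<open>covered\<close>, are neither.\<close>
    have kept: "tri x y \<in> traded"
      if xy: "x \<in> X - R" "y \<in> X - R" "x \<noteq> y"
        and no: "\<And>z p q. (z, p, q) \<in> K \<Longrightarrow> z \<notin> {x, y} \<and> {p, q} \<noteq> {x, y}" for x y
    proof -
      have "tri x y \<notin> old (z, p, q)" if k: "(z, p, q) \<in> K" for z p q
      proof
        assume "tri x y \<in> old (z, p, q)"
        then have "Inr z \<in> tri x y \<or> tri x y = tri p q \<or> tri x y \<subseteq> Inl ` UNIV"
          unfolding old_eq[OF KD(9,10)[OF k]] by (auto simp: tri_def)
        then show False
          using no[OF k] KD(7)[OF k] \<open>x \<noteq> y\<close> by (auto simp: tri_def doubleton_eq_iff)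
      qed
      then show ?thesis using tri_in_blocks[OF xy] unfolding traded_def by auto
    qed
    show "\<exists>p\<in>Inr ` P. {Inl c, l, p} \<in> traded" if "l \<in> Inr ` L" for l
    proof -
      from that obtain x where x: "x \<in> L" "l = Inr x" by auto
      obtain p where p: "p \<in> P" "g x p = c" using LPc[OF x(1)] by auto
      have "tri x p \<in> traded"
      proof (rule kept)
        show "z \<notin> {x, p} \<and> {p', q'} \<noteq> {x, p}" if "(z, p', q') \<in> K" for z p' q'
        proof -
          have "x \<notin> {p', q'}" using KD(5,6)[OF that] x PL by auto
          then show ?thesis using KD(3,4)[OF that] x p by auto
        qed
      qed (use x p P L PL in auto)
      then show ?thesis using p x by (auto simp: tri_def insert_commute)
    qed
    show "\<exists>p\<in>Inr ` P. \<exists>q\<in>Inr ` P. p \<noteq> q \<and> {u, p, q} \<in> traded"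
      if "u \<in> points - Inr ` P - Inr ` L - {Inl c}" for u
    proof (cases u)
      case (Inl w)
      then have "w \<in> W - {c}" using that unfolding points_def by auto
      then obtain p q where pq: "p \<in> P" "q \<in> P" "p \<noteq> q" "g p q = w"
          "\<forall>(z, p', q')\<in>K. {p', q'} \<noteq> {p, q}"
        using covered by metis
      have "tri p q \<in> traded"
      proof (rule kept)
        show "z \<notin> {p, q} \<and> {p', q'} \<noteq> {p, q}" if "(z, p', q') \<in> K" for z p' q'
          using that pq KD(3)[OF that] by auto
      qed (use pq P in auto)
      then show ?thesis using pq Inl
        by (intro bexI[of _ "Inr p"] bexI[of _ "Inr q"]) (auto simp: tri_def insert_commute)
    next
      case (Inr z)
      then have "z \<in> fst ` K" using that K_cover unfolding points_def by auto
      then obtain p q where k: "(z, p, q) \<in> K" by auto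
      have "{Inr z, Inr p, Inr q} \<in> new (z, p, q)" unfolding new_def pasch_def by simp
      then have "{Inr z, Inr p, Inr q} \<in> traded" using k unfolding traded_def by blast
      then show ?thesis using Inr KD(5-7)[OF k]
        by (intro bexI[of _ "Inr p"] bexI[of _ "Inr q"]) auto
    qed
  qed
qed

theorem embeds: "embeds_in_order (star (Suc (card L))) (card W + card (X - R))"
  using star_position_embeds_in_order[OF traded_steiner traded_star_position]
  by (simp add: card_image)

end

subsection \<open>The 1-factorisation by sums\<close>

text \<open>The standard 1-factorisation of the complete graph on \<open>{..m}\<close> for odd \<open>m\<close>, with
  \<open>m\<close> as the point at infinity. The diagonal values are junk.\<close>

definition gk :: "nat \<Rightarrow> nat \<Rightarrow> nat \<Rightarrow> nat" where
  "gk m x y = (if x = m then 2 * y else if y = m then 2 * x else x + y) mod m"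

lemma mod_double: "(a::nat) < 2 * m \<Longrightarrow> a mod m = (if a < m then a else a - m)"
  by (simp add: le_mod_geq)

lemma gk_commute: "gk m x y = gk m y x"
  unfolding gk_def by (simp add: add.commute)

lemma gk_less: "m > 0 \<Longrightarrow> gk m x y < m"
  unfolding gk_def by simp

text \<open>Sums with a finite vertex cancel. The colours at infinity are doubles, which are
  distinct since \<open>m\<close> is odd, and \<open>2 x = x + z\<close> would force
  \<open>z = x\<close>.\<close>

lemma gk_proper:
  assumes "odd m" "x \<le> m" "y \<le> m" "z \<le> m" "y \<noteq> x" "z \<noteq> x" "gk m x y = gk m x z"
  shows "y = z"
proof -
  obtain q where m: "m = 2 * q + 1" using assms(1) by (rule oddE)
  consider "x = m" "y < m" "z < m" | "x < m" "y = m" "z = m" | "x < m" "y = m" "z < m"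
    | "x < m" "y < m" "z = m" | "x < m" "y < m" "z < m"
    using assms by linarith
  then show ?thesis
  proof cases
    case 1
    then show ?thesis using assms(7) m by (simp add: gk_def mod_double split: if_splits) presburger+
  next
    case 3
    then have "(2 * x) mod m = (x + z) mod m" using assms(7) by (simp add: gk_def)
    then show ?thesis using 3 assms(6) by (simp add: mod_double split: if_splits)
  next
    case 4
    then have "(2 * x) mod m = (x + y) mod m" using assms(7) by (simp add: gk_def)
    then show ?thesis using 4 assms(5) by (simp add: mod_double split: if_splits)
  next
    case 5
    then have "(x + y) mod m = (x + z) mod m" using assms(7) by (simp add: gk_def)
    then show ?thesis using 5 by (simp add: mod_double split: if_splits)
  qed simp
qed

text \<open>The \<open>m\<close> other vertices receive distinct values among \<open>m\<close>
  colours, so every colour occurs.\<close>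

lemma gk_partner:
  assumes "odd m" "x \<le> m" "u < m"
  shows "\<exists>y\<in>{..m}. y \<noteq> x \<and> gk m x y = u"
proof -
  have "m > 0" using assms(3) by simp
  have "inj_on (gk m x) ({..m} - {x})"
    using gk_proper[OF assms(1,2)] by (intro inj_onI) auto
  then have "card (gk m x ` ({..m} - {x})) = m"
    using assms(2) by (simp add: card_image)
  moreover have "gk m x ` ({..m} - {x}) \<subseteq> {..<m}" using gk_less[OF \<open>m > 0\<close>] by auto
  ultimately have "gk m x ` ({..m} - {x}) = {..<m}" by (intro card_subset_eq) auto
  then have "u \<in> gk m x ` ({..m} - {x})" using assms(3) by simp
  then show ?thesis by auto
qed

section \<open>Doublings from the colouring by sums\<close>

lemma gk_doubling:
  assumes "odd m" "R \<subseteq> {..m}" "R = {} \<or> card R = 2" "\<And>t. t \<in> T \<Longrightarrow> card t = 3"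
    and "pair_design {..<m} (T \<union> (\<lambda>x. gk m x ` R) ` ({..m} - R))"
    and "R \<noteq> {} \<Longrightarrow> inj_on (\<lambda>x. gk m x ` R) ({..m} - R)"
  shows "doubling {..<m} {..m} (gk m) R T"
proof unfold_locales
  have "m > 0" using assms(1) by (simp add: odd_pos)
  then show "gk m x y \<in> {..<m}" for x y using gk_less by simp
  show "\<exists>y\<in>{..m}. y \<noteq> x \<and> gk m x y = u" if "x \<in> {..m}" "u \<in> {..<m}" for x u
    using gk_partner[OF assms(1)] that by simp
  show "y = z" if "x \<in> {..m}" "y \<in> {..m}" "z \<in> {..m}" "y \<noteq> x" "z \<noteq> x" "gk m x y = gk m x z" for x y z
    using gk_proper[OF assms(1), of x y z] that by simp
  show "gk m x y = gk m y x" for x y by (rule gk_commute)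
  show "t \<in> T \<Longrightarrow> card t = 3" for t by (rule assms(4))
qed (use assms in simp_all)

text \<open>If no vertex is removed, the set of missing colours is empty at each vertex and turns up
  as an empty block in the assumption on the colours.\<close>

lemma pair_design_insert_empty:
  assumes "pair_design V \<B>"
  shows "pair_design V (insert {} \<B>)"
  unfolding pair_design_def
proof (intro conjI ballI impI)
  show "B \<subseteq> V" if "B \<in> insert {} \<B>" for B
    using that assms unfolding pair_design_def by auto
  fix x y assume "x \<in> V" "y \<in> V" "x \<noteq> y"
  then have "\<exists>!B. B \<in> \<B> \<and> {x, y} \<subseteq> B" using assms unfolding pair_design_def by metis
  moreover have "B \<in> insert {} \<B> \<and> {x, y} \<subseteq> B \<longleftrightarrow> B \<in> \<B> \<and> {x, y} \<subseteq> B" for B by auto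
  ultimately show "\<exists>!B. B \<in> insert {} \<B> \<and> {x, y} \<subseteq> B" by simp
qed

lemma gk_doubling_steiner:
  assumes "odd m" "steiner_triple_system m {..<m} T"
  shows "doubling {..<m} {..m} (gk m) {} T"
proof (rule gk_doubling)
  have "pair_design {..<m} T" using assms(2) unfolding steiner_triple_system_alt by simp
  then have "pair_design {..<m} (insert {} T)" by (rule pair_design_insert_empty)
  then show "pair_design {..<m} (T \<union> (\<lambda>x. gk m x ` {}) ` ({..m} - {}))"
    by (simp add: image_constant_conv)
qed (use assms in \<open>auto simp: steiner_triple_system_alt\<close>)

lemma steiner_triple_system_lessThan:
  assumes "steiner_triple_system v V \<B>"
  obtains \<C> where "steiner_triple_system v {..<v} \<C>"
proof -
  have "finite V" "card V = v" using steiner_triple_system_finite[OF assms] by simp_all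
  then obtain f where "bij_betw f V {..<v}"
    using finite_same_card_bij[of V "{..<v}"] by auto
  then show ?thesis using steiner_triple_system_image[OF _ assms] that by metis
qed

text \<open>The classical step from order \<open>m\<close> to \<open>2 m + 1\<close>, with
  \<open>m\<close> colours and \<open>m + 1\<close> vertices.\<close>

lemma steiner_triple_system_double:
  assumes "odd m" "steiner_triple_system m {..<m} T"
  obtains T' where "steiner_triple_system (2 * m + 1) {..<2 * m + 1} T'"
proof -
  interpret doubling "{..<m}" "{..m}" "gk m" "{}" T
    using gk_doubling_steiner[OF assms] .
  have "steiner_triple_system (2 * m + 1) points blocks"
    using steiner by (simp add: mult_2)
  then show ?thesis using steiner_triple_system_lessThan that by metis
qed

text \<open>In each pair \<open>{x, m - x}\<close> with \<open>0 < x \<le> q\<close> the smaller element is played, except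
  that \<open>m - 4\<close> is played instead of \<open>4\<close>: thus also the sums \<open>m - 1\<close>, \<open>m - 2\<close> and
  \<open>m - 3\<close> occur.\<close>

definition halves :: "nat \<Rightarrow> nat \<Rightarrow> nat set" where
  "halves m q = {1, 2, 3, m - 4} \<union> {5..q}"

definition cohalves :: "nat \<Rightarrow> nat \<Rightarrow> nat set" where
  "cohalves m q = {m - 1, m - 2, m - 3, 4} \<union> {m - q..m - 5}"

text \<open>The forbidden pairs are the edges between played vertices that the Pasch trades use up,
  so their sums 7, 8, 4 and 11 need other representations. The last two are forbidden only for
  \<open>q \<ge> 12\<close>, since for \<open>q = 7\<close> the sum 4 is taken from
  \<open>1 + 3\<close>.\<close>

lemma halves_sums:
  assumes q: "q \<ge> 7" and m: "m = 2 * q + 1 \<or> m = 2 * q + 3" and u: "0 < u" "u < m"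
  shows "\<exists>x\<in>halves m q. \<exists>y\<in>halves m q. x < y \<and> (x + y) mod m = u \<and>
    (x, y) \<notin> {(2, 5), (3, 5)} \<and> (12 \<le> q \<longrightarrow> (x, y) \<notin> {(1, 3), (5, 6)})"
    (is "\<exists>x\<in>_. \<exists>y\<in>_. ?Q x y")
proof -
  have *: ?thesis if "x \<in> halves m q" "y \<in> halves m q" "x < y" "x + y = u \<or> x + y = u + m"
    "(x, y) \<notin> {(2, 5), (3, 5)}" "12 \<le> q \<longrightarrow> (x, y) \<notin> {(1, 3), (5, 6)}" for x y
  proof -
    have "(x + y) mod m = u" using that(4) u(2) by (elim disjE) simp_all
    then show ?thesis using that by blast
  qed
  have mem: "x \<in> halves m q" if "x = 1 \<or> x = 2 \<or> x = 3 \<or> x = m - 4 \<or> 5 \<le> x \<and> x \<le> q" for x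
    using that unfolding halves_def by auto
  \<comment> \<open>The sums \<open>1 + y\<close> reach up to \<open>q + 1\<close>, and
    \<open>x + q\<close> with \<open>x \<ge> 5\<close> starts at \<open>q + 5\<close>; the gap
    between them and both ends are filled one by one, mostly with 2, 3 or
    \<open>m - 4\<close>.\<close>
  consider "u \<le> 5" | "6 \<le> u" "u \<le> q + 1" | "q + 2 \<le> u" "u \<le> q + 4"
    | "q + 5 \<le> u" "u \<le> 2 * q - 1" | "2 * q - 1 < u"
    by linarith
  then show ?thesis
  proof cases
    case 1
    consider "u = 1" | "u = 2" | "u = 3" | "u = 4" "q \<ge> 8" | "u = 4" "q = 7" | "u = 5"
      using 1 q u(1) by linarith
    then show ?thesis
    proof cases
      case 1 then show ?thesis using q m by (intro *[of 5 "m - 4"] mem) auto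
    next
      case 2 then show ?thesis using q m by (intro *[of 6 "m - 4"] mem) auto
    next
      case 3 then show ?thesis using q m by (intro *[of 1 2] mem) auto
    next
      case 4 then show ?thesis using q m by (intro *[of 8 "m - 4"] mem) auto
    next
      case 5 then show ?thesis using q m by (intro *[of 1 3] mem) auto
    next
      case 6 then show ?thesis using q m by (intro *[of 2 3] mem) auto
    qed
  next
    case 2 then show ?thesis using q m by (intro *[of 1 "u - 1"] mem) auto
  next
    case 3
    consider "u = q + 2" | "u = q + 3" | "u = q + 4" using 3 by linarith
    then show ?thesis
    proof cases
      case 1 then show ?thesis using q m by (intro *[of 2 q] mem) auto
    next
      case 2 then show ?thesis using q m by (intro *[of 3 q] mem) auto
    next
      case 3 then show ?thesis using q m by (intro *[of 5 "q - 1"] mem) auto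
    qed
  next
    case 4 then show ?thesis using q m by (intro *[of "u - q" q] mem) auto
  next
    case 5
    consider "u = m - 1" | "u = m - 2" | "u = m - 3" using 5 m u(2) by linarith
    then show ?thesis
    proof cases
      case 1 then show ?thesis using q m by (intro *[of 3 "m - 4"] mem) auto
    next
      case 2 then show ?thesis using q m by (intro *[of 2 "m - 4"] mem) auto
    next
      case 3 then show ?thesis using q m by (intro *[of 1 "m - 4"] mem) auto
    qed
  qed
qed

text \<open>The interval \<open>{q + 1..<m - q}\<close> is empty for \<open>m = 2 q + 1\<close> and
  is the pair \<open>{q + 1, q + 2}\<close> for \<open>m = 2 q + 3\<close>; like
  \<open>{0, m}\<close>, this pair is an edge of colour \<open>0\<close>.\<close>

lemma halves_cover:
  assumes q: "q \<ge> 5" and m: "m = 2 * q + 1 \<or> m = 2 * q + 3"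
  shows "{..m} = halves m q \<union> cohalves m q \<union> {0, m} \<union> {q + 1..<m - q}"
    and "halves m q \<inter> cohalves m q = {}"
    and "(halves m q \<union> cohalves m q) \<inter> ({0, m} \<union> {q + 1..<m - q}) = {}"
proof -
  have h: "x \<in> halves m q \<longleftrightarrow> 0 < x \<and> x < 4 \<or> x = m - 4 \<or> 5 \<le> x \<and> x \<le> q" for x
    unfolding halves_def by auto
  have c: "x \<in> cohalves m q \<longleftrightarrow>
      m - 4 < x \<and> x < m \<or> x = 4 \<or> m - q \<le> x \<and> x \<le> m - 5" for x
    unfolding cohalves_def using assms by auto
  have "x \<in> halves m q \<union> cohalves m q \<union> {0, m} \<union> {q + 1..<m - q}" if "x \<le> m" for x
  proof -
    consider "x \<le> 4" | "5 \<le> x" "x < m - 4" | "m - 4 \<le> x" by linarith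
    then show ?thesis
    proof cases
      case 1
      then consider "x = 0" | "0 < x" "x < 4" | "x = 4" by linarith
      then show ?thesis by cases (simp_all add: h c)
    next
      case 2
      then consider "x \<le> q" | "q + 1 \<le> x" "x < m - q" | "m - q \<le> x" "x \<le> m - 5" by linarith
      then show ?thesis using 2 by cases (simp_all add: h c)
    next
      case 3
      then consider "x = m - 4" | "m - 4 < x" "x < m" | "x = m" using \<open>x \<le> m\<close> by linarith
      then show ?thesis by cases (simp_all add: h c)
    qed
  qed
  moreover have "halves m q \<union> cohalves m q \<union> {0, m} \<union> {q + 1..<m - q} \<subseteq> {..m}"
    using assms unfolding halves_def cohalves_def by auto
  ultimately show "{..m} = halves m q \<union> cohalves m q \<union> {0, m} \<union> {q + 1..<m - q}"
    by (intro equalityI) (auto simp only: atMost_iff)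
  have "x \<notin> cohalves m q" if "x \<in> halves m q" for x
    using that unfolding h c using assms by auto
  then show "halves m q \<inter> cohalves m q = {}" by auto
  have "x \<noteq> 0 \<and> x \<noteq> m \<and> (x \<le> q \<or> m - q \<le> x)" if "x \<in> halves m q \<or> x \<in> cohalves m q" for x
    using that unfolding h c using assms by auto
  then show "(halves m q \<union> cohalves m q) \<inter> ({0, m} \<union> {q + 1..<m - q}) = {}"
    by (intro equals0I) fastforce
qed

lemma cohalves_eq: "\<lbrakk>q \<ge> 5; m > 2 * q\<rbrakk> \<Longrightarrow> cohalves m q = (\<lambda>x. m - x) ` halves m q"
proof (intro set_eqI iffI)
  fix y assume "q \<ge> 5" "m > 2 * q" "y \<in> cohalves m q"
  then show "y \<in> (\<lambda>x. m - x) ` halves m q"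
    unfolding halves_def cohalves_def by (intro image_eqI[of _ _ "m - y"]) auto
qed (auto simp: halves_def cohalves_def)

lemma card_cohalves:
  assumes "q \<ge> 5" "m > 2 * q"
  shows "card (cohalves m q) = q"
proof -
  have "card ({m - 1, m - 2, m - 3, 4} \<union> {m - q..m - 5}) =
      card {m - 1, m - 2, m - 3, 4} + card {m - q..m - 5}"
    by (rule card_Un_disjoint) (use assms in auto)
  moreover have "card {m - 1, m - 2, m - 3, 4} = 4"
    using assms by (subst card_insert_disjoint; auto)+
  ultimately show ?thesis unfolding cohalves_def using assms by simp
qed

lemma gk_zero: "\<lbrakk>0 < p; p < m\<rbrakk> \<Longrightarrow> gk m p (m - p) = 0" "gk m 0 m = 0" "gk m m 0 = 0"
  unfolding gk_def by auto

lemma gk_add: "\<lbrakk>x < m; y < m\<rbrakk> \<Longrightarrow> gk m x y = (x + y) mod m"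
  unfolding gk_def by simp

lemma halves_cohalves:
  assumes "q \<ge> 5" "m > 2 * q"
  shows "p \<in> halves m q \<Longrightarrow> 0 < p \<and> p < m \<and> m - p \<in> cohalves m q \<and> gk m p (m - p) = 0"
    and "l \<in> cohalves m q \<Longrightarrow> 0 < l \<and> l < m \<and> m - l \<in> halves m q \<and> gk m l (m - l) = 0"
proof -
  have h: "0 < p \<and> p < m" if "p \<in> halves m q" for p
    using that assms unfolding halves_def by auto
  show "0 < p \<and> p < m \<and> m - p \<in> cohalves m q \<and> gk m p (m - p) = 0" if "p \<in> halves m q"
    using h[OF that] that gk_zero(1)[of p m] by (simp add: cohalves_eq[OF assms])
  assume "l \<in> cohalves m q"
  then obtain p where "p \<in> halves m q" "l = m - p" unfolding cohalves_eq[OF assms] by auto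
  moreover from this have "0 < l \<and> l < m" "m - l = p" using h[of p] by auto
  ultimately show "0 < l \<and> l < m \<and> m - l \<in> halves m q \<and> gk m l (m - l) = 0"
    using gk_zero(1)[of l m] by simp
qed

section \<open>Stars in the doubled systems\<close>

lemma doubling_star_embeds:
  assumes D: "doubling {..<m} {..m} (gk m) R T" and "m > 0"
    and PL: "{..m} - R = P \<union> L" "P \<inter> L = {}"
    and "\<And>p. p \<in> P \<Longrightarrow> \<exists>l\<in>L. gk m p l = 0" "\<And>l. l \<in> L \<Longrightarrow> \<exists>p\<in>P. gk m l p = 0"
    and cov: "\<And>u. \<lbrakk>0 < u; u < m\<rbrakk> \<Longrightarrow> \<exists>p\<in>P. \<exists>q\<in>P. p \<noteq> q \<and> gk m p q = u"
  shows "embeds_in_order (star (Suc (card L))) (m + card ({..m} - R))"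
proof -
  have "doubling_star {..<m} {..m} (gk m) R T P L 0 {}"
  proof (intro doubling_star.intro D doubling_star_axioms.intro)
    show "P \<subseteq> {..m} - R" "L \<subseteq> {..m} - R" unfolding PL by auto
    show "{..m} - R \<subseteq> P \<union> L \<union> fst ` {}" unfolding PL by auto
    show "\<exists>p\<in>P. \<exists>q\<in>P. p \<noteq> q \<and> gk m p q = u \<and> (\<forall>(z, p', q')\<in>{}. {p', q'} \<noteq> {p, q})"
      if "u \<in> {..<m} - {0}" for u
      using cov[of u] that by simp
  qed (use assms in simp_all)
  from doubling_star.embeds[OF this] show ?thesis by simp
qed

text \<open>The edge \<open>{0, m}\<close> supplies a played vertex and a leaf as well, so there are
  \<open>q + 1\<close> leaves. The two values of \<open>m\<close> treat the complete graph and the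
  graph with \<open>q + 1\<close> and \<open>q + 2\<close> deleted alike.\<close>

lemma star_embeds_untraded:
  assumes q: "q \<ge> 7" and m: "m = 2 * q + 1 \<or> m = 2 * q + 3"
    and D: "doubling {..<m} {..m} (gk m) {q + 1..<m - q} T"
  shows "embeds_in_order (star (q + 2)) (m + 2 * q + 2)"
proof -
  have q5: "q \<ge> 5" "m > 2 * q" using q m by auto
  note cover = halves_cover[OF q5(1) m]
  let ?P = "insert 0 (halves m q)" and ?L = "insert m (cohalves m q)"
  have PL: "{..m} - {q + 1..<m - q} = ?P \<union> ?L"
  proof -
    have "(?P \<union> ?L) \<inter> {q + 1..<m - q} = {}" using cover(3) q5 m by auto
    then show ?thesis unfolding cover(1) by blast
  qed
  have disj: "?P \<inter> ?L = {}" using cover(2,3) q5 by auto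
  have fin: "finite (cohalves m q)" unfolding cohalves_def by simp
  have "m \<notin> cohalves m q" using cover(3) by auto
  then have cardL: "card ?L = q + 1" using card_cohalves[OF q5] fin by simp
  have cardR: "card ({..m} - {q + 1..<m - q}) = 2 * q + 2"
    using m by (subst card_Diff_subset) auto
  have "embeds_in_order (star (Suc (card ?L))) (m + card ({..m} - {q + 1..<m - q}))"
  proof (rule doubling_star_embeds[OF D _ PL disj])
    show "\<exists>l\<in>?L. gk m p l = 0" if "p \<in> ?P" for p
      using that halves_cohalves(1)[OF q5, of p] gk_zero(2) by (cases "p = 0") auto
    show "\<exists>p\<in>?P. gk m l p = 0" if "l \<in> ?L" for l
      using that halves_cohalves(2)[OF q5, of l] gk_zero(3) by (cases "l = m") auto
    show "\<exists>p\<in>?P. \<exists>p'\<in>?P. p \<noteq> p' \<and> gk m p p' = u" if "0 < u" "u < m" for u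
    proof -
      obtain x y where xy: "x \<in> halves m q" "y \<in> halves m q" "x < y" "(x + y) mod m = u"
        using halves_sums[OF q m \<open>0 < u\<close> \<open>u < m\<close>] by blast
      then have "gk m x y = u"
        using halves_cohalves(1)[OF q5 xy(1)] halves_cohalves(1)[OF q5 xy(2)] by (simp add: gk_add)
      then show ?thesis using xy(1-3) by (intro bexI[of _ x] bexI[of _ y]) auto
    qed
  qed (use q5 in auto)
  then show ?thesis using cardL cardR by (simp add: add.assoc)
qed

text \<open>The edge \<open>{0, m}\<close>, and for \<open>m = 2 q + 3\<close> also
  \<open>{q + 1, q + 2}\<close>, supplies no leaf: \<open>K\<close> makes its ends unplayable. The
  required colour triples are pairwise disjoint (for the last two, \<open>q \<ge> 12\<close> ensures
  this), so they can be prescribed as blocks of \<open>T\<close> all at once.\<close>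

lemma star_embeds_traded:
  fixes q m :: nat and K :: "(nat \<times> nat \<times> nat) set"
  defines "K \<equiv> {(0, 2, 5), (m, 3, 5)} \<union> (if m = 2 * q + 3 then {(q + 1, 1, 3), (q + 2, 5, 6)} else {})"
  assumes q: "q \<ge> 7" and m: "m = 2 * q + 1 \<or> m = 2 * q + 3 \<and> q \<ge> 12"
    and T: "steiner_triple_system m {..<m} T" "{2, 5, 7} \<in> T" "{6, 8, 10} \<in> T"
    and T': "m = 2 * q + 3 \<Longrightarrow> {4, q + 2, q + 4} \<in> T \<and> {11, q + 7, q + 8} \<in> T"
  shows "embeds_in_order (star (q + 1)) (2 * m + 1)"
proof -
  have q5: "q \<ge> 5" "m > 2 * q" using q m by auto
  have m': "m = 2 * q + 1 \<or> m = 2 * q + 3" and odd: "odd m" using m by auto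
  note cover = halves_cover[OF q5(1) m']
  have colours: "gk m 0 2 = 2" "gk m 0 5 = 5" "gk m 2 5 = 7" "gk m m 3 = 6" "gk m m 5 = 10"
    "gk m 3 5 = 8" "gk m (q + 1) 1 = q + 2" "gk m (q + 1) 3 = q + 4" "gk m 1 3 = 4"
    using q m by (auto simp: gk_def)
  have colours': "gk m (q + 2) 5 = q + 7" "gk m (q + 2) 6 = q + 8" "gk m 5 6 = 11" if "q \<ge> 12"
    using that q m by (auto simp: gk_def)
  have K: "k \<in> K \<Longrightarrow> k = (0, 2, 5) \<or> k = (m, 3, 5) \<or>
      q \<ge> 12 \<and> m = 2 * q + 3 \<and> (k = (q + 1, 1, 3) \<or> k = (q + 2, 5, 6))" for k
    using m unfolding K_def by (auto split: if_splits)
  define col where "col = (\<lambda>(z, p, p'). {gk m z p, gk m z p', gk m p p'})"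
  have Kcol: "k = (0, 2, 5) \<and> col k = {2, 5, 7} \<or> k = (m, 3, 5) \<and> col k = {6, 10, 8} \<or>
      q \<ge> 12 \<and> m = 2 * q + 3 \<and> k = (q + 1, 1, 3) \<and> col k = {q + 2, q + 4, 4} \<or>
      q \<ge> 12 \<and> m = 2 * q + 3 \<and> k = (q + 2, 5, 6) \<and> col k = {q + 7, q + 8, 11}" if "k \<in> K" for k
    using K[OF that] colours colours' unfolding col_def by (elim disjE conjE) (simp_all only: prod.case simp_thms)
  have low: "1 \<in> halves m q" "2 \<in> halves m q" "3 \<in> halves m q" "5 \<in> halves m q" "6 \<in> halves m q"
    using q unfolding halves_def by auto
  have "doubling_star {..<m} {..m} (gk m) {} T (halves m q) (cohalves m q) 0 K"
  proof (intro doubling_star.intro doubling_star_axioms.intro gk_doubling_steiner[OF odd T(1)])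
    show "halves m q \<subseteq> {..m} - {}" "cohalves m q \<subseteq> {..m} - {}" using cover(1) by auto
    show "halves m q \<inter> cohalves m q = {}" by (rule cover)
    show "0 \<in> {..<m}" using q5 by simp
    show "\<exists>l\<in>cohalves m q. gk m p l = 0" if "p \<in> halves m q" for p
      using halves_cohalves(1)[OF q5 that] by auto
    show "\<exists>p\<in>halves m q. gk m l p = 0" if "l \<in> cohalves m q" for l
      using halves_cohalves(2)[OF q5 that] by auto
    show "{..m} - {} \<subseteq> halves m q \<union> cohalves m q \<union> fst ` K"
    proof -
      have "{0, m} \<union> {q + 1..<m - q} \<subseteq> fst ` K" using m unfolding K_def by auto
      then show ?thesis unfolding cover(1) by auto
    qed
    have out: "z \<in> {..m} - {} - halves m q - cohalves m q" if "z = 0 \<or> z = m \<or> q + 1 \<le> z \<and> z < m - q" for z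
      using that cover(3) m by auto
    show "z \<in> {..m} - {} - halves m q - cohalves m q \<and> p \<in> halves m q \<and> p' \<in> halves m q \<and>
        p \<noteq> p' \<and> {gk m z p, gk m z p', gk m p p'} \<in> T" if "(z, p, p') \<in> K" for z p p'
      using K[OF that]
    proof (elim disjE conjE)
      assume k: "(z, p, p') = (0, 2, 5)"
      then show ?thesis using out[of 0] low T colours by (simp add: insert_commute)
    next
      assume k: "(z, p, p') = (m, 3, 5)"
      then show ?thesis using out[of m] low T colours by (simp add: insert_commute)
    next
      assume k: "(z, p, p') = (q + 1, 1, 3)" "m = 2 * q + 3"
      then show ?thesis using out[of "q + 1"] low T' colours by (simp add: insert_commute)
    next
      assume k: "(z, p, p') = (q + 2, 5, 6)" "m = 2 * q + 3" "q \<ge> 12"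
      then show ?thesis using out[of "q + 2"] low T' colours' by (simp add: insert_commute)
    qed
    show "z \<noteq> z' \<and> {gk m z p, gk m z p', gk m p p'} \<inter> {gk m z' r, gk m z' r', gk m r r'} = {}"
      if "(z, p, p') \<in> K" "(z', r, r') \<in> K" "(z, p, p') \<noteq> (z', r, r')" for z p p' z' r r'
      using Kcol[OF that(1)] Kcol[OF that(2)] that(3) q5 q
      unfolding col_def prod.case by (elim disjE conjE) auto
    show "\<exists>p\<in>halves m q. \<exists>p'\<in>halves m q. p \<noteq> p' \<and> gk m p p' = u \<and>
        (\<forall>(z, r, r')\<in>K. {r, r'} \<noteq> {p, p'})" if "u \<in> {..<m} - {0}" for u
    proof -
      have "0 < u" "u < m" using that by auto
      then obtain x y where xy: "x \<in> halves m q" "y \<in> halves m q" "x < y" "(x + y) mod m = u"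
          "(x, y) \<notin> {(2, 5), (3, 5)}" "12 \<le> q \<longrightarrow> (x, y) \<notin> {(1, 3), (5, 6)}"
        using halves_sums[OF q m' \<open>0 < u\<close> \<open>u < m\<close>] by blast
      then have "gk m x y = u"
        using halves_cohalves(1)[OF q5 xy(1)] halves_cohalves(1)[OF q5 xy(2)] by (simp add: gk_add)
      moreover have "{r, r'} \<noteq> {x, y}" if "(z, r, r') \<in> K" for z r r'
        using K[OF that] xy(3,5,6) by (auto simp: doubleton_eq_iff)
      ultimately show ?thesis using xy(1-3) by (intro bexI[of _ x] bexI[of _ y]) auto
    qed
  qed
  from doubling_star.embeds[OF this] show ?thesis
    using card_cohalves[OF q5] by (simp add: mult_2)
qed

text \<open>With two vertices \<open>n\<close> and \<open>n + 1\<close> removed, the colours that are missing at the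
  remaining vertices form the cycle \<open>1, 2, \<dots>, 2n\<close>.\<close>

definition cycle_edges :: "nat \<Rightarrow> nat set set" where
  "cycle_edges l = (\<lambda>i. {i, if i = l then 1 else i + 1}) ` {1..l}"

text \<open>Vertex \<open>x\<close> misses the colours \<open>x + n\<close> and
  \<open>x + n + 1\<close>, of which \<open>h x\<close> is the first along the cycle; the vertex at
  infinity gives the closing edge \<open>{2 n, 1}\<close>. The removed pair is itself an edge of
  colour \<open>0\<close>, so \<open>0\<close> is never missing.\<close>

lemma gk_doubling_cycle:
  assumes m: "m = 2 * n + 1" "n \<ge> 2" and T: "\<And>t. t \<in> T \<Longrightarrow> card t = 3"
    and design: "pair_design {..<m} (T \<union> cycle_edges (2 * n))"
  shows "doubling {..<m} {..m} (gk m) {n, n + 1} T"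
proof -
  define e where "e = (\<lambda>i. {i, if i = 2 * n then 1 else i + 1})"
  define h where "h = (\<lambda>x. if x = m then 2 * n else if x < n then x + n else x - (n + 1))"
  let ?O = "{..m} - {n, n + 1}"
  have eh: "gk m x ` {n, n + 1} = e (h x)" if "x \<in> ?O" for x
  proof -
    consider "x = m" | "x < n" | "n + 1 < x" "x < m" using \<open>x \<in> ?O\<close> by fastforce
    then show ?thesis
    proof cases
      case 1
      then show ?thesis using m by (simp add: gk_def e_def h_def mod_double)
    next
      case 2
      then show ?thesis using m by (auto simp: gk_def e_def h_def)
    next
      case 3
      then have "(x + n) mod m = x - (n + 1)" "(x + (n + 1)) mod m = x - n"
        using m by (auto simp: mod_double)
      then show ?thesis using 3 m by (auto simp: gk_def e_def h_def)
    qed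
  qed
  have h_mem: "h x \<in> {1..2 * n}" if "x \<in> ?O" for x
    using that m by (auto simp: h_def)
  have h_inj: "inj_on h ?O"
    using m by (auto simp: inj_on_def h_def split: if_splits)
  have "card ?O = 2 * n" using m by (subst card_Diff_subset) auto
  then have "card (h ` ?O) = 2 * n" using card_image[OF h_inj] by simp
  then have him: "h ` ?O = {1..2 * n}"
    using h_mem by (intro card_subset_eq image_subsetI) simp_all
  \<comment> \<open>For \<open>n \<ge> 2\<close> the cycle has length at least four, so its edges
    are distinct as sets.\<close>
  have "inj_on e {1..2 * n}"
    using m(2) by (auto simp: inj_on_def e_def doubleton_eq_iff split: if_splits)
  then have "inj_on (e \<circ> h) ?O" using h_inj him by (simp add: comp_inj_on)
  then have inj: "inj_on (\<lambda>x. gk m x ` {n, n + 1}) ?O"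
    using inj_on_cong[of ?O "\<lambda>x. gk m x ` {n, n + 1}" "e \<circ> h"] eh by (simp only: comp_apply)
  have "(\<lambda>x. gk m x ` {n, n + 1}) ` ?O = (\<lambda>x. e (h x)) ` ?O"
    by (rule image_cong[OF refl]) (rule eh)
  also have "\<dots> = e ` h ` ?O" by (simp only: image_image)
  also have "\<dots> = cycle_edges (2 * n)" unfolding him cycle_edges_def e_def ..
  finally have im: "(\<lambda>x. gk m x ` {n, n + 1}) ` ?O = cycle_edges (2 * n)" .
  show ?thesis
  proof (rule gk_doubling)
    show "pair_design {..<m} (T \<union> (\<lambda>x. gk m x ` {n, n + 1}) ` ?O)" unfolding im by (rule design)
    show "inj_on (\<lambda>x. gk m x ` {n, n + 1}) ?O" by (rule inj)
    show "card t = 3" if "t \<in> T" for t using T that .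
  qed (use m in simp_all)
qed

subsection \<open>Bose's construction\<close>

text \<open>An idempotent commutative quasigroup: commutativity makes \<open>triple\<close>
  independent of the order of its arguments, and idempotence leaves the pairs within a column to the
  columns.\<close>

locale bose =
  fixes Q :: "'a set" and f :: "'a \<Rightarrow> 'a \<Rightarrow> 'a"
  assumes fin: "finite Q"
    and closed: "\<lbrakk>x \<in> Q; y \<in> Q\<rbrakk> \<Longrightarrow> f x y \<in> Q"
    and comm: "\<lbrakk>x \<in> Q; y \<in> Q\<rbrakk> \<Longrightarrow> f x y = f y x"
    and idem: "x \<in> Q \<Longrightarrow> f x x = x"
    and cancel: "\<lbrakk>x \<in> Q; y \<in> Q; z \<in> Q; f x y = f x z\<rbrakk> \<Longrightarrow> y = z"
begin

definition column :: "'a \<Rightarrow> ('a \<times> nat) set" where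
  "column x = {(x, 0), (x, 1), (x, 2)}"

definition triple :: "nat \<Rightarrow> 'a \<Rightarrow> 'a \<Rightarrow> ('a \<times> nat) set" where
  "triple i x y = {(x, i), (y, i), (f x y, Suc i mod 3)}"

definition blocks :: "('a \<times> nat) set set" where
  "blocks = column ` Q \<union> {triple i x y | i x y. i < 3 \<and> x \<in> Q \<and> y \<in> Q \<and> x \<noteq> y}"

lemma solve:
  assumes "x \<in> Q" "h \<in> Q"
  shows "\<exists>y\<in>Q. f x y = h"
proof -
  have "inj_on (f x) Q" using cancel[OF assms(1)] by (auto intro: inj_onI)
  moreover have "f x ` Q \<subseteq> Q" using closed[OF assms(1)] by auto
  ultimately have "f x ` Q = Q" using endo_inj_surj[OF fin] by simp
  then show ?thesis using assms(2) by (metis imageE)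
qed

lemma blocksE:
  assumes "B \<in> blocks"
  obtains (1) x where "B = column x" "x \<in> Q"
  | (2) i x y where "B = triple i x y" "i < 3" "x \<in> Q" "y \<in> Q" "x \<noteq> y"
  using assms unfolding blocks_def
proof (elim UnE imageE CollectE exE conjE)
  show thesis if "B = column x" "x \<in> Q" for x by (rule 1[OF that])
  show thesis if "B = triple i x y" "i < 3" "x \<in> Q" "y \<in> Q" "x \<noteq> y" for i x y by (rule 2[OF that])
qed

lemma column_in_blocks: "x \<in> Q \<Longrightarrow> column x \<in> blocks"
  unfolding blocks_def by simp

lemma triple_in_blocks: "\<lbrakk>i < 3; x \<in> Q; y \<in> Q; x \<noteq> y\<rbrakk> \<Longrightarrow> triple i x y \<in> blocks"
  unfolding blocks_def by (rule UnI2, rule CollectI) blast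

lemma triple_commute: "\<lbrakk>x \<in> Q; y \<in> Q\<rbrakk> \<Longrightarrow> triple i x y = triple i y x"
  unfolding triple_def using comm[of x y] by auto

lemma not_fixed:
  assumes "x \<in> Q" "y \<in> Q" "x \<noteq> y"
  shows "f x y \<noteq> x" "f x y \<noteq> y"
  using assms cancel[of x y x] cancel[of y x y] idem comm[of x y] by metis+

lemma Suc_mod_3: "i < 3 \<Longrightarrow> Suc i mod 3 \<noteq> i \<and> Suc (Suc i mod 3) mod 3 \<noteq> i \<and> Suc i mod 3 < 3" for i :: nat
  by presburger

lemma same_level:
  assumes "x \<in> Q" "y \<in> Q" "x \<noteq> y" "i < 3"
  shows "\<exists>!B. B \<in> blocks \<and> {(x, i), (y, i)} \<subseteq> B"
proof (rule ex1I[of _ "triple i x y"])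
  show "triple i x y \<in> blocks \<and> {(x, i), (y, i)} \<subseteq> triple i x y"
    using triple_in_blocks[OF assms(4,1-3)] by (simp add: triple_def)
  fix B assume B: "B \<in> blocks \<and> {(x, i), (y, i)} \<subseteq> B"
  from B have "B \<in> blocks" by simp
  then show "B = triple i x y"
  proof (cases rule: blocksE)
    case (1 z)
    then show ?thesis using B assms by (auto simp: column_def)
  next
    case (2 j u v)
    then have "j = i \<and> (u = x \<and> v = y \<or> u = y \<and> v = x)"
      using B assms(3) Suc_mod_3[of j] by (auto simp: triple_def)
    then show ?thesis using 2 triple_commute[of x y i] assms by auto
  qed
qed

lemma same_column:
  assumes "x \<in> Q" "i < 3" "j < 3" "i \<noteq> j"
  shows "\<exists>!B. B \<in> blocks \<and> {(x, i), (x, j)} \<subseteq> B"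
proof (rule ex1I[of _ "column x"])
  have "i = 0 \<or> i = 1 \<or> i = 2" "j = 0 \<or> j = 1 \<or> j = 2" using assms by linarith+
  then show "column x \<in> blocks \<and> {(x, i), (x, j)} \<subseteq> column x"
    using column_in_blocks[OF assms(1)] by (auto simp: column_def)
  fix B assume B: "B \<in> blocks \<and> {(x, i), (x, j)} \<subseteq> B"
  from B have "B \<in> blocks" by simp
  then show "B = column x"
  proof (cases rule: blocksE)
    case (1 z)
    then show ?thesis using B by (auto simp: column_def)
  next
    case (2 k u v)
    then show ?thesis
      using B assms(4) not_fixed[of u v] by (auto simp: triple_def)
  qed
qed

text \<open>The other point on level \<open>i\<close> must solve \<open>f x z = y\<close>, which has
  one solution; it differs from \<open>x\<close> by idempotence.\<close>

lemma next_level: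
  assumes "x \<in> Q" "y \<in> Q" "x \<noteq> y" "i < 3" "j = Suc i mod 3"
  shows "\<exists>!B. B \<in> blocks \<and> {(x, i), (y, j)} \<subseteq> B"
proof -
  obtain z where z: "z \<in> Q" "f x z = y" using solve[OF assms(1,2)] by auto
  have "z \<noteq> x" using z idem[OF assms(1)] assms(3) by auto
  show ?thesis
  proof (rule ex1I[of _ "triple i x z"])
    show "triple i x z \<in> blocks \<and> {(x, i), (y, j)} \<subseteq> triple i x z"
      using triple_in_blocks[OF assms(4,1) z(1)] \<open>z \<noteq> x\<close> z assms by (simp add: triple_def)
    fix B assume B: "B \<in> blocks \<and> {(x, i), (y, j)} \<subseteq> B"
    from B have "B \<in> blocks" by simp
    then show "B = triple i x z"
    proof (cases rule: blocksE)
      case (1 z)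
      then show ?thesis using B assms(3) by (auto simp: column_def)
    next
      case (2 k u v)
      have "Suc i mod 3 \<noteq> i" "Suc (Suc i mod 3) mod 3 \<noteq> i" using Suc_mod_3[OF assms(4)] by auto
      then have k: "k = i" "f u v = y" "u = x \<or> v = x"
        using B 2 assms(3,5) by (auto simp: triple_def)
      then consider "u = x" "f x v = f x z" | "v = x" "f x u = f x z"
        using z comm[of u v] 2 by auto
      then show ?thesis
      proof cases
        case 1
        then show ?thesis using cancel[of x v z] 2 k z assms(1) by simp
      next
        case c: 2
        then have "u = z" using cancel[of x u z] 2 z assms(1) by simp
        then show ?thesis using 2 c k triple_commute[of u v i] by simp
      qed
    qed
  qed
qed

lemma steiner: "steiner_triple_system (3 * card Q) (Q \<times> {..<3}) blocks"
  unfolding steiner_triple_system_alt pair_design_def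
proof (intro conjI ballI impI)
  show "finite (Q \<times> {..<3::nat})" "card (Q \<times> {..<3::nat}) = 3 * card Q"
    using fin by (simp_all add: card_cartesian_product)
  show "card B = 3" if "B \<in> blocks" for B
    using that
  proof (cases rule: blocksE)
    case (2 i x y)
    then show ?thesis using Suc_mod_3[of i] by (auto simp: triple_def)
  qed (simp add: column_def)
  show "B \<subseteq> Q \<times> {..<3}" if "B \<in> blocks" for B
    using that
  proof (cases rule: blocksE)
    case (2 i x y)
    then show ?thesis using Suc_mod_3[of i] closed by (auto simp: triple_def)
  qed (simp add: column_def)
  fix a b assume ab: "a \<in> Q \<times> {..<3::nat}" "b \<in> Q \<times> {..<3::nat}" "a \<noteq> b"
  obtain x i where a: "a = (x, i)" "x \<in> Q" "i < 3" using ab by auto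
  obtain y j where b: "b = (y, j)" "y \<in> Q" "j < 3" using ab by auto
  have "i = 0 \<or> i = 1 \<or> i = 2" "j = 0 \<or> j = 1 \<or> j = 2" using a(3) b(3) by linarith+
  then have lev: "i = j \<or> j = Suc i mod 3 \<or> i = Suc j mod 3" by auto
  consider "i = j" "x \<noteq> y" | "x = y" "i \<noteq> j" | "x \<noteq> y" "j = Suc i mod 3" | "x \<noteq> y" "i = Suc j mod 3"
    using ab(3) a(1) b(1) lev by auto
  then show "\<exists>!B. B \<in> blocks \<and> {a, b} \<subseteq> B"
  proof cases
    case 1
    then show ?thesis using same_level[of x y i] a b by simp
  next
    case 2
    then show ?thesis using same_column[of x i j] a b by simp
  next
    case 3
    then show ?thesis using next_level[of x y i j] a b by simp
  next
    case 4
    then have "\<exists>!B. B \<in> blocks \<and> {b, a} \<subseteq> B" using next_level[of y x j i] a b by simp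
    then show ?thesis by (simp only: insert_commute)
  qed
qed

end

text \<open>Modulo \<open>2 t + 1\<close> the factor \<open>t + 1\<close> is the inverse of 2, so
  the operation is the mean of \<open>x\<close> and \<open>y\<close>.\<close>

lemma bose_mod: "bose {..<2 * t + 1} (\<lambda>x y. ((x + y) * (t + 1)) mod (2 * t + 1))"
  for t :: nat
proof
  let ?M = "2 * t + 1"
  have dbl: "(a * (2 * t + 2)) mod ?M = a mod ?M" for a :: nat
  proof -
    have "a * (2 * t + 2) = a + a * ?M" by (simp add: algebra_simps)
    then show ?thesis by (metis mod_mult_self1)
  qed
  fix x y z assume x: "x \<in> {..<?M}"
  have "((x + x) * (t + 1)) mod ?M = (x * (2 * t + 2)) mod ?M"
    by (simp add: algebra_simps mult_2 mult_2_right)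
  then show "((x + x) * (t + 1)) mod ?M = x" using x dbl by simp
  assume y: "y \<in> {..<?M}"
  show "((x + y) * (t + 1)) mod ?M \<in> {..<?M}" by simp
  show "((x + y) * (t + 1)) mod ?M = ((y + x) * (t + 1)) mod ?M" by (simp add: add.commute)
  assume z: "z \<in> {..<?M}" and eq: "((x + y) * (t + 1)) mod ?M = ((x + z) * (t + 1)) mod ?M"
  have "((x + y) * (t + 1) * 2) mod ?M = ((x + z) * (t + 1) * 2) mod ?M"
    using eq by (metis mod_mult_left_eq)
  moreover have "(x + w) * (t + 1) * 2 = (x + w) * (2 * t + 2)" for w
    by (simp add: algebra_simps mult_2 mult_2_right)
  ultimately have "(x + y) mod ?M = (x + z) mod ?M" by (simp only: dbl)
  then show "y = z" using x y z by (auto simp: mod_double split: if_splits)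
qed simp

text \<open>The columns of Bose's system form a parallel class; they are used to realise
  prescribed disjoint blocks.\<close>

lemma steiner_triple_system_with_blocks:
  assumes m: "m = 3 * (2 * t + 1)" and F: "finite F" "card F \<le> 2 * t + 1"
    and F3: "\<And>A. A \<in> F \<Longrightarrow> A \<subseteq> {..<m} \<and> card A = 3"
    and disj: "\<And>A A'. \<lbrakk>A \<in> F; A' \<in> F; A \<noteq> A'\<rbrakk> \<Longrightarrow> A \<inter> A' = {}"
  obtains T where "steiner_triple_system m {..<m} T" "F \<subseteq> T"
proof -
  interpret bose "{..<2 * t + 1}" "\<lambda>x y. ((x + y) * (t + 1)) mod (2 * t + 1)"
    by (rule bose_mod)
  let ?Q = "{..<2 * t + 1}"
  \<comment> \<open>Each prescribed block gets a column of its own, which \<open>h\<close> maps onto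
    it.\<close>
  obtain c where c: "c ` F \<subseteq> ?Q" "inj_on c F"
    using card_le_inj[OF F(1), of ?Q] F(2) by auto
  have "\<exists>b. bij_betw b {..<3::nat} A" if "A \<in> F" for A
    using F3[OF that] by (intro finite_same_card_bij) (auto intro: card_ge_0_finite)
  then obtain b where b: "\<And>A. A \<in> F \<Longrightarrow> bij_betw (b A) {..<3::nat} A" by metis
  define h where "h = (\<lambda>(x, i). b (inv_into F c x) i)"
  have h: "h (c A, i) = b A i" if "A \<in> F" for A i
    using that c(2) by (simp add: h_def)
  have img: "h ` ({c A} \<times> {..<3}) = A" if "A \<in> F" for A
  proof -
    have "h ` ({c A} \<times> {..<3}) = b A ` {..<3}" using h[OF that] by (auto simp: image_iff)
    then show ?thesis using b[OF that] by (simp add: bij_betw_def)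
  qed
  have hF: "h ` (c ` F \<times> {..<3}) = \<Union>F"
  proof -
    have "h ` (c ` F \<times> {..<3}) = (\<Union>A\<in>F. h ` ({c A} \<times> {..<3}))" by blast
    then show ?thesis using img by simp
  qed
  have "inj_on h (c ` F \<times> {..<3})"
  proof (rule inj_onI)
    fix p p' assume p: "p \<in> c ` F \<times> {..<3}" "p' \<in> c ` F \<times> {..<3}" "h p = h p'"
    obtain A i where A: "A \<in> F" "i < 3" "p = (c A, i)" using p(1) by auto
    obtain A' i' where A': "A' \<in> F" "i' < 3" "p' = (c A', i')" using p(2) by auto
    have "h p \<in> A" "h p' \<in> A'"
      using A A' h b[OF A(1)] b[OF A'(1)] by (auto simp: bij_betw_def)
    then have "A = A'" using disj[OF A(1) A'(1)] p(3) by auto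
    then show "p = p'"
      using p(3) A A' h b[OF A(1)] by (auto simp: bij_betw_def inj_on_def)
  qed
  then have bij1: "bij_betw h (c ` F \<times> {..<3}) (\<Union>F)" using hF by (simp add: bij_betw_def)
  have sub: "c ` F \<times> {..<3::nat} \<subseteq> ?Q \<times> {..<3}" "\<Union>F \<subseteq> {..<m}" using c F3 by auto
  have "card (?Q \<times> {..<3::nat} - c ` F \<times> {..<3}) = card ({..<m} - \<Union>F)"
  proof -
    have "card (c ` F \<times> {..<3::nat}) = card (\<Union>F)" using bij_betw_same_card[OF bij1] .
    moreover have "finite (c ` F \<times> {..<3::nat})" "finite (\<Union>F)"
      using sub finite_subset by (blast intro: finite_subset[OF sub(2)] finite_SigmaI finite_imageI F)+
    ultimately show ?thesis
      using sub m by (simp add: card_Diff_subset card_cartesian_product)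
  qed
  \<comment> \<open>Points outside the chosen columns may be renamed arbitrarily; only their number
    matters.\<close>
  then obtain h' where bij2: "bij_betw h' (?Q \<times> {..<3::nat} - c ` F \<times> {..<3}) ({..<m} - \<Union>F)"
    using finite_same_card_bij[of "?Q \<times> {..<3::nat} - c ` F \<times> {..<3}" "{..<m} - \<Union>F"] by auto
  define g where "g = (\<lambda>p. if p \<in> c ` F \<times> {..<3} then h p else h' p)"
  have g1: "bij_betw g (c ` F \<times> {..<3}) (\<Union>F)"
    using bij1 by (subst bij_betw_cong[of _ g h]) (simp_all add: g_def)
  have "bij_betw g (?Q \<times> {..<3::nat} - c ` F \<times> {..<3}) ({..<m} - \<Union>F)"
    using bij2 by (subst bij_betw_cong[of _ g h']) (simp_all add: g_def)
  from bij_betw_combine[OF g1 this] have g: "bij_betw g (?Q \<times> {..<3}) {..<m}"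
    using sub by (simp add: Un_absorb1)
  have "steiner_triple_system m {..<m} ((`) g ` blocks)"
    using steiner_triple_system_image[OF g steiner] m by simp
  moreover have "F \<subseteq> (`) g ` blocks"
  proof
    fix A assume A: "A \<in> F"
    have "column (c A) = {c A} \<times> {..<3}" by (auto simp: column_def)
    then have "g ` column (c A) = h ` ({c A} \<times> {..<3})" using A by (auto simp: g_def image_iff)
    then have "g ` column (c A) = A" using img[OF A] by simp
    moreover have "column (c A) \<in> blocks" using A c by (intro column_in_blocks) auto
    ultimately show "A \<in> (`) g ` blocks" by (metis imageI)
  qed
  ultimately show ?thesis using that by blast
qed

subsection \<open>Triple systems with an uncovered cycle\<close>

lemma add_mod_cancel:
  fixes x :: nat
  assumes "x < N" "y < N" "a < N" "(x + a) mod N = (y + a) mod N"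
  shows "x = y"
  using assms by (auto simp: mod_double split: if_splits)

text \<open>Cyclic difference triples: every \<open>(a, b)\<close> in \<open>I\<close> contributes the translates of
  \<open>{0, a, b}\<close>, all of whose differences are less than half of the modulus.\<close>

locale difference_triples =
  fixes n :: nat and I :: "(nat \<times> nat) set"
  assumes bounds: "(a, b) \<in> I \<Longrightarrow> 0 < a \<and> a < b \<and> b < n \<and> b \<noteq> 2 * a"
    and disjoint: "\<lbrakk>(a, b) \<in> I; (a', b') \<in> I; d \<in> {a, b, b - a}; d \<in> {a', b', b' - a'}\<rbrakk>
      \<Longrightarrow> a = a' \<and> b = b'"
begin

definition translate :: "nat \<Rightarrow> nat \<Rightarrow> nat \<Rightarrow> nat set" where
  "translate x a b = {x, (x + a) mod (2 * n), (x + b) mod (2 * n)}"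

definition translates :: "nat set set" where
  "translates = {translate x a b | x a b. x < 2 * n \<and> (a, b) \<in> I}"

definition diffs :: "nat set" where
  "diffs = (\<Union>(a, b)\<in>I. {a, b, b - a})"

text \<open>Orients a pair of points so that its difference is \<open>a\<close>, \<open>b\<close> or
  \<open>b - a\<close>; this difference and the starting point then determine the translate.\<close>

lemma translate_pair:
  assumes "(a, b) \<in> I" "x < 2 * n" "u \<in> translate x a b" "v \<in> translate x a b" "u \<noteq> v"
  obtains s e d where "s = u \<and> e = v \<or> s = v \<and> e = u" "e = (s + d) mod (2 * n)"
    "d \<in> {a, b} \<and> s = x \<or> d = b - a \<and> s = (x + a) mod (2 * n)"
proof -
  have "x + a + (b - a) = x + b" using bounds[OF assms(1)] by simp
  then have ab: "(x + b) mod (2 * n) = ((x + a) mod (2 * n) + (b - a)) mod (2 * n)"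
    by (simp only: mod_add_left_eq)
  consider "u = x" "v = (x + a) mod (2 * n)" | "v = x" "u = (x + a) mod (2 * n)"
    | "u = x" "v = (x + b) mod (2 * n)" | "v = x" "u = (x + b) mod (2 * n)"
    | "u = (x + a) mod (2 * n)" "v = (x + b) mod (2 * n)"
    | "v = (x + a) mod (2 * n)" "u = (x + b) mod (2 * n)"
    using assms(3-5) unfolding translate_def by auto
  then show ?thesis
  proof cases
    case 1 then show ?thesis using that[of u v a] by simp
  next
    case 2 then show ?thesis using that[of v u a] by simp
  next
    case 3 then show ?thesis using that[of u v b] by simp
  next
    case 4 then show ?thesis using that[of v u b] by simp
  next
    case 5 then show ?thesis using that[of u v "b - a"] ab by simp
  next
    case 6 then show ?thesis using that[of v u "b - a"] ab by simp
  qed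
qed

text \<open>Reversing a pair turns the difference \<open>d\<close> into \<open>2 n - d\<close>,
  which exceeds \<open>n\<close>, so only one orientation has a difference below
  \<open>n\<close>.\<close>

lemma direction:
  assumes "s < 2 * n" "e < 2 * n" "e = (s + d) mod (2 * n)" "0 < d" "d < n"
    "s' = s \<and> e' = e \<or> s' = e \<and> e' = s" "e' = (s' + d') mod (2 * n)" "0 < d'" "d' < n"
  shows "s' = s" "d' = d"
proof -
  have "\<not> (s' = e \<and> e' = s)"
    using assms by (auto simp: mod_double split: if_splits)
  then show "s' = s" using assms(6) by blast
  then show "d' = d" using assms \<open>\<not> _\<close> by (auto simp: mod_double split: if_splits)
qed

lemma translates_unique:
  assumes "t \<in> translates" "t' \<in> translates" "u < 2 * n" "v < 2 * n" "u \<noteq> v"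
    "{u, v} \<subseteq> t" "{u, v} \<subseteq> t'"
  shows "t = t'"
proof -
  obtain x a b where t: "t = translate x a b" "x < 2 * n" "(a, b) \<in> I"
    using assms(1) unfolding translates_def by auto
  obtain x' a' b' where t': "t' = translate x' a' b'" "x' < 2 * n" "(a', b') \<in> I"
    using assms(2) unfolding translates_def by auto
  obtain s e d where d: "s = u \<and> e = v \<or> s = v \<and> e = u" "e = (s + d) mod (2 * n)"
      "d \<in> {a, b} \<and> s = x \<or> d = b - a \<and> s = (x + a) mod (2 * n)"
    using translate_pair[OF t(3,2), of u v] assms t by auto
  obtain s' e' d' where d': "s' = u \<and> e' = v \<or> s' = v \<and> e' = u" "e' = (s' + d') mod (2 * n)"
      "d' \<in> {a', b'} \<and> s' = x' \<or> d' = b' - a' \<and> s' = (x' + a') mod (2 * n)"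
    using translate_pair[OF t'(3,2), of u v] assms t' by auto
  have bd: "0 < d" "d < n" "d \<in> {a, b, b - a}" using d(3) bounds[OF t(3)] by auto
  have bd': "0 < d'" "d' < n" "d' \<in> {a', b', b' - a'}" using d'(3) bounds[OF t'(3)] by auto
  have lt: "s < 2 * n" "e < 2 * n" using d(1) assms by auto
  have or: "s' = s \<and> e' = e \<or> s' = e \<and> e' = s" using d(1) d'(1) by auto
  have eq: "s' = s" "d' = d"
    using direction[OF lt d(2) bd(1,2) or d'(2) bd'(1,2)] by auto
  have ab: "a = a'" "b = b'" using disjoint[OF t(3) t'(3) bd(3)] bd'(3) eq by auto
  have "a \<noteq> b - a" "b \<noteq> b - a" using bounds[OF t(3)] by auto
  then have "s = x \<and> s = x' \<or> s = (x + a) mod (2 * n) \<and> s = (x' + a) mod (2 * n)"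
    using d(3) d'(3) eq ab by auto
  then have "x = x'" using add_mod_cancel[OF t(2) t'(2), of a] bounds[OF t(3)] by auto
  then show ?thesis using t t' ab by simp
qed

lemma translates_exist:
  assumes "d \<in> diffs" "u < 2 * n"
  shows "\<exists>t\<in>translates. {u, (u + d) mod (2 * n)} \<subseteq> t"
proof -
  obtain a b where ab: "(a, b) \<in> I" "d = a \<or> d = b \<or> d = b - a"
    using assms(1) unfolding diffs_def by auto
  note bd = bounds[OF ab(1)]
  show ?thesis
  proof (cases "d = b - a")
    case False
    then have "{u, (u + d) mod (2 * n)} \<subseteq> translate u a b"
      using ab unfolding translate_def by auto
    then show ?thesis using assms ab unfolding translates_def by blast
  next
    case True
    \<comment> \<open>The translate starts \<open>a\<close> steps before \<open>u\<close>, so that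
      \<open>u\<close> and \<open>u + (b - a)\<close> are its last two points;
      \<open>2 * n - a\<close> replaces a negative shift.\<close>
    define x where "x = (u + (2 * n - a)) mod (2 * n)"
    have "(x + a) mod (2 * n) = (u + (2 * n - a) + a) mod (2 * n)"
      unfolding x_def by (rule mod_add_left_eq)
    also have "u + (2 * n - a) + a = u + 2 * n" using bd by simp
    finally have xa: "(x + a) mod (2 * n) = u" using assms(2) by simp
    have "(u + d) mod (2 * n) = ((x + a) mod (2 * n) + (b - a)) mod (2 * n)" using xa True by simp
    also have "\<dots> = (x + a + (b - a)) mod (2 * n)" by (rule mod_add_left_eq)
    also have "x + a + (b - a) = x + b" using bd by simp
    finally have "{u, (u + d) mod (2 * n)} \<subseteq> translate x a b"
      using xa unfolding translate_def by auto
    moreover have "x < 2 * n" unfolding x_def using assms(2) by simp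
    ultimately show ?thesis using ab(1) unfolding translates_def by blast
  qed
qed

lemma translates_diff:
  assumes "t \<in> translates" "{u, v} \<subseteq> t" "u \<noteq> v"
  shows "\<exists>d\<in>diffs. v = (u + d) mod (2 * n) \<or> u = (v + d) mod (2 * n)"
proof -
  obtain x a b where t: "t = translate x a b" "x < 2 * n" "(a, b) \<in> I"
    using assms(1) unfolding translates_def by auto
  obtain s e d where d: "s = u \<and> e = v \<or> s = v \<and> e = u" "e = (s + d) mod (2 * n)"
      "d \<in> {a, b} \<and> s = x \<or> d = b - a \<and> s = (x + a) mod (2 * n)"
    using translate_pair[OF t(3,2), of u v] assms t by auto
  then have "d \<in> diffs" using t(3) unfolding diffs_def by auto
  then show ?thesis using d by auto
qed

lemma translates_card:
  assumes "t \<in> translates"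
  shows "card t = 3" "t \<subseteq> {..<2 * n}"
proof -
  obtain x a b where t: "t = translate x a b" "x < 2 * n" "(a, b) \<in> I"
    using assms unfolding translates_def by auto
  have "x \<noteq> (x + a) mod (2 * n)" "x \<noteq> (x + b) mod (2 * n)" "(x + a) mod (2 * n) \<noteq> (x + b) mod (2 * n)"
    using bounds[OF t(3)] t(2) by (auto simp: mod_double split: if_splits)
  then show "card t = 3" unfolding t(1) translate_def by simp
  show "t \<subseteq> {..<2 * n}" using t unfolding translate_def by auto
qed

end

text \<open>Pairs within \<open>{1..l}\<close> are edges of the cycle, edges of the perfect matching
  \<open>\<mu>\<close>, or covered once by \<open>T\<close>. Joining the new point \<open>0\<close>
  to the matching edges covers these, and also every pair containing \<open>0\<close>, exactly
  once.\<close>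

lemma pair_design_cycle:
  fixes l :: nat and nxt :: "nat \<Rightarrow> nat"
  defines "nxt \<equiv> \<lambda>i. if i = l then 1 else i + 1"
  assumes \<mu>: "\<And>i. i \<in> {1..l} \<Longrightarrow> \<mu> i \<in> {1..l} \<and> \<mu> i \<noteq> i \<and> \<mu> (\<mu> i) = i"
    and \<mu>_nxt: "\<And>i. i \<in> {1..l} \<Longrightarrow> \<mu> i \<noteq> nxt i"
    and T: "\<And>t. t \<in> T \<Longrightarrow> t \<subseteq> {1..l}"
    and adj: "\<And>i j t. \<lbrakk>i \<in> {1..l}; j \<in> {1..l}; i \<noteq> j; j = nxt i \<or> i = nxt j \<or> j = \<mu> i; t \<in> T\<rbrakk>
      \<Longrightarrow> \<not> {i, j} \<subseteq> t"
    and nonadj: "\<And>i j. \<lbrakk>i \<in> {1..l}; j \<in> {1..l}; i \<noteq> j; \<not> (j = nxt i \<or> i = nxt j \<or> j = \<mu> i)\<rbrakk>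
      \<Longrightarrow> \<exists>!t. t \<in> T \<and> {i, j} \<subseteq> t"
    and l: "l \<ge> 3"
  shows "pair_design {..<l + 1} (T \<union> (\<lambda>i. {0, i, \<mu> i}) ` {1..l} \<union> cycle_edges l)"
proof -
  define M where "M = (\<lambda>i. {0, i, \<mu> i}) ` {1..l}"
  define E where "E = cycle_edges l"
  let ?D = "T \<union> M \<union> E"
  have ce: "E = (\<lambda>i. {i, nxt i}) ` {1..l}"
    unfolding E_def cycle_edges_def nxt_def ..
  have MI: "{0, i, \<mu> i} \<in> M" if "i \<in> {1..l}" for i
    unfolding M_def using that by (rule imageI)
  have nxt: "nxt i \<in> {1..l}" "nxt i \<noteq> i" if "i \<in> {1..l}" for i
    using that l unfolding nxt_def by auto
  have Mset: "B = {0, i, \<mu> i}" if B: "B \<in> M" "i \<in> B" and i: "i \<in> {1..l}" for B i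
  proof -
    obtain k where k: "k \<in> {1..l}" "B = {0, k, \<mu> k}" using B(1) unfolding M_def by (rule imageE)
    then have "i = k \<or> i = \<mu> k" using B(2) i by auto
    then show ?thesis using \<mu>[OF k(1)] k(2) by (elim disjE) (simp_all add: insert_commute)
  qed
  have zero: "\<exists>!B. B \<in> ?D \<and> {0, i} \<subseteq> B" if i: "i \<in> {1..l}" for i
  proof (rule ex1I[of _ "{0, i, \<mu> i}"])
    have "{0, i, \<mu> i} \<in> M" using i by (rule MI)
    then show "{0, i, \<mu> i} \<in> ?D \<and> {0, i} \<subseteq> {0, i, \<mu> i}" by simp
    fix B assume B: "B \<in> ?D \<and> {0, i} \<subseteq> B"
    have "B \<notin> T"
    proof
      assume "B \<in> T"
      then have "0 \<in> {1..l}" using T[of B] B by (meson insert_subset subsetD)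
      then show False by simp
    qed
    moreover have "B \<notin> E"
    proof
      assume "B \<in> E"
      then obtain k where "k \<in> {1..l}" "B = {k, nxt k}" unfolding ce by auto
      then show False using B nxt(1)[of k] by auto
    qed
    ultimately have "B \<in> M" using B by simp
    then show "B = {0, i, \<mu> i}" using B i Mset[of B i] by simp
  qed
  have pair: "\<exists>!B. B \<in> ?D \<and> {i, j} \<subseteq> B" if ij: "i \<in> {1..l}" "j \<in> {1..l}" "i \<noteq> j" for i j
  proof -
    have M: "j = \<mu> i" if "B \<in> M" "{i, j} \<subseteq> B" for B
      using Mset[OF that(1), of i] that(2) ij by auto
    have C: "(j = nxt i \<or> i = nxt j) \<and> B = {i, j}" if "B \<in> E" "{i, j} \<subseteq> B" for B
      using that ij(3) unfolding ce by auto
    consider "j = \<mu> i" | "j = nxt i \<or> i = nxt j" "j \<noteq> \<mu> i" | "\<not> (j = nxt i \<or> i = nxt j \<or> j = \<mu> i)"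
      by auto
    then show ?thesis
    proof cases
      case 1
      have nn: "\<not> (j = nxt i \<or> i = nxt j)" using 1 \<mu>_nxt[OF ij(1)] \<mu>_nxt[OF ij(2)] \<mu>[OF ij(1)] by auto
      show ?thesis
      proof (rule ex1I[of _ "{0, i, j}"])
        have "{0, i, j} \<in> M" unfolding 1 using ij(1) by (rule MI)
        then show "{0, i, j} \<in> ?D \<and> {i, j} \<subseteq> {0, i, j}" by simp
        fix B assume B: "B \<in> ?D \<and> {i, j} \<subseteq> B"
        then have "B \<notin> T" "B \<notin> E" using adj[OF ij, of B] 1 C[of B] nn by auto
        then have "B \<in> M" using B by simp
        then show "B = {0, i, j}" using Mset[of B i] B ij(1) 1 by simp
      qed
    next
      case 2
      show ?thesis
      proof (rule ex1I[of _ "{i, j}"])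
        have "{i, j} \<in> E" using 2 ij unfolding ce by (auto simp: insert_commute)
        then show "{i, j} \<in> ?D \<and> {i, j} \<subseteq> {i, j}" by simp
        fix B assume B: "B \<in> ?D \<and> {i, j} \<subseteq> B"
        then have "B \<notin> T" "B \<notin> M" using adj[OF ij, of B] 2 M[of B] by auto
        then have "B \<in> E" using B by simp
        then show "B = {i, j}" using C[of B] B by simp
      qed
    next
      case 3
      obtain t where t: "t \<in> T" "{i, j} \<subseteq> t" "\<And>t'. t' \<in> T \<Longrightarrow> {i, j} \<subseteq> t' \<Longrightarrow> t' = t"
        using nonadj[OF ij 3] by metis
      show ?thesis
      proof (rule ex1I[of _ t])
        show "t \<in> ?D \<and> {i, j} \<subseteq> t" using t(1,2) by simp
        fix B assume B: "B \<in> ?D \<and> {i, j} \<subseteq> B"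
        then have "B \<notin> M" "B \<notin> E" using 3 M[of B] C[of B] by auto
        then have "B \<in> T" using B by simp
        then show "B = t" using t(3)[of B] B by simp
      qed
    qed
  qed
  show ?thesis
    unfolding pair_design_def M_def[symmetric] E_def[symmetric]
  proof (intro conjI ballI impI)
    show "B \<subseteq> {..<l + 1}" if "B \<in> ?D" for B
    proof -
      consider "B \<in> T" | "B \<in> M" | "B \<in> E" using \<open>B \<in> T \<union> M \<union> E\<close> by auto
      then show ?thesis
      proof cases
        case 1
        then show ?thesis using T[of B] by fastforce
      next
        case 2
        then obtain i where "i \<in> {1..l}" "B = {0, i, \<mu> i}" unfolding M_def by (rule imageE)
        then show ?thesis using \<mu>[of i] by auto
      next
        case 3
        then obtain i where "i \<in> {1..l}" "B = {i, nxt i}" unfolding ce by auto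
        then show ?thesis using nxt[of i] by auto
      qed
    qed
    fix x y assume xy: "x \<in> {..<l + 1}" "y \<in> {..<l + 1}" "x \<noteq> y"
    consider "x = 0" "y \<in> {1..l}" | "y = 0" "x \<in> {1..l}" | "x \<in> {1..l}" "y \<in> {1..l}"
      using xy by fastforce
    then show "\<exists>!B. B \<in> ?D \<and> {x, y} \<subseteq> B"
    proof cases
      case 1
      then show ?thesis using zero[of y] by simp
    next
      case 2
      then show ?thesis using zero[of x] by (simp only: insert_commute)
    next
      case 3
      then show ?thesis using pair xy(3) by simp
    qed
  qed
qed

text \<open>There are \<open>k\<close> even and \<open>K\<close> odd small differences, so the two
  choices of \<open>K\<close> give \<open>n = 6 k + 3\<close> and \<open>n = 6 k + 5\<close>. The
  resulting star has \<open>n + 1\<close> vertices, whence the residues 4 and 0 modulo 6.\<close>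

locale prism_design =
  fixes k K n \<delta> E :: nat
  assumes k: "k \<ge> 1" and K: "K = k \<or> K = k + 1"
    and n: "n = 4 * k + 2 * K + 3" and \<delta>: "\<delta> = 2 * k + K + 1" and E: "E = 4 * k + K + 3"
begin

text \<open>The even differences \<open>2 j\<close> are combined with the pairs \<open>\<delta> - j, \<delta> + j\<close> and the
  odd ones with pairs nested around \<open>E - 1/2\<close>. Among \<open>1, \<dots>, n\<close> this leaves \<open>\<delta>\<close>, \<open>n\<close> and,
  for \<open>K = k\<close>, the difference \<open>4 k + 2\<close>, which is a third of \<open>2 n\<close> and thus has short
  orbits.\<close>

definition triples :: "(nat \<times> nat) set" where
  "triples = (\<lambda>j. (2 * j, \<delta> + j)) ` {1..k} \<union> (\<lambda>j. (2 * j + 1, E + j)) ` {..<K}"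

lemma triplesE:
  assumes "(a, b) \<in> triples"
  obtains (1) j where "1 \<le> j" "j \<le> k" "a = 2 * j" "b = \<delta> + j" "b - a = \<delta> - j"
  | (2) j where "j < K" "a = 2 * j + 1" "b = E + j" "b - a = E - (j + 1)"
proof -
  have "(\<exists>j. 1 \<le> j \<and> j \<le> k \<and> a = 2 * j \<and> b = \<delta> + j) \<or> (\<exists>j. j < K \<and> a = 2 * j + 1 \<and> b = E + j)"
    using assms unfolding triples_def by auto
  then show ?thesis
  proof (elim disjE exE conjE)
    fix j assume j: "1 \<le> j" "j \<le> k" "a = 2 * j" "b = \<delta> + j"
    then have "b - a = \<delta> - j" using \<delta> by simp
    then show ?thesis using 1 j by simp
  next
    fix j assume j: "j < K" "a = 2 * j + 1" "b = E + j"
    then have "b - a = E - (j + 1)" using E by simp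
    then show ?thesis using 2 j by simp
  qed
qed

sublocale difference_triples n triples
proof
  show "0 < a \<and> a < b \<and> b < n \<and> b \<noteq> 2 * a" if "(a, b) \<in> triples" for a b
    using that
  proof (cases rule: triplesE)
    case (1 j)
    \<comment> \<open>This is the condition \<open>b \<noteq> 2 * a\<close>; it holds as
      \<open>\<delta>\<close> is \<open>3 k + 1\<close> or \<open>3 k + 2\<close>.\<close>
    have "3 * j \<noteq> \<delta>" unfolding \<delta> using K by presburger
    then show ?thesis using 1 K n \<delta> by auto
  next
    case (2 j)
    then show ?thesis using K n E by auto
  qed
  have kK: "k \<le> K" "K \<le> k + 1" using K by auto
  fix a b a' b' d
  assume ab: "(a, b) \<in> triples" "(a', b') \<in> triples"
    and d: "d \<in> {a, b, b - a}" "d \<in> {a', b', b' - a'}"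
  show "a = a' \<and> b = b'"
    using ab(1)
  proof (cases rule: triplesE)
    case j: (1 j)
    show ?thesis
      using ab(2)
    proof (cases rule: triplesE)
      case (1 i)
      have "d = 2 * j \<or> d = \<delta> + j \<or> d = \<delta> - j" "d = 2 * i \<or> d = \<delta> + i \<or> d = \<delta> - i"
        using d j 1 by auto
      then have "i = j" using j(1,2) 1(1,2) \<delta> kK by (elim disjE) linarith+
      then show ?thesis using j 1 by simp
    next
      case (2 i)
      have "d = 2 * j \<or> d = \<delta> + j \<or> d = \<delta> - j" "d = 2 * i + 1 \<or> d = E + i \<or> d = E - (i + 1)"
        using d j 2 by auto
      then have False
      proof (cases "d = 2 * j \<and> d = 2 * i + 1")
        case True
        then show ?thesis by presburger
      next
        case False
        then show ?thesis using \<open>d = 2 * j \<or> _\<close> \<open>d = 2 * i + 1 \<or> _\<close> j(1,2) 2(1) \<delta> E kK by (elim disjE) linarith+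
      qed
      then show ?thesis ..
    qed
  next
    case j: (2 j)
    show ?thesis
      using ab(2)
    proof (cases rule: triplesE)
      case (1 i)
      have "d = 2 * i \<or> d = \<delta> + i \<or> d = \<delta> - i" "d = 2 * j + 1 \<or> d = E + j \<or> d = E - (j + 1)"
        using d j 1 by auto
      then have False
      proof (cases "d = 2 * i \<and> d = 2 * j + 1")
        case True
        then show ?thesis by presburger
      next
        case False
        then show ?thesis using \<open>d = 2 * i \<or> _\<close> \<open>d = 2 * j + 1 \<or> _\<close> j(1) 1(1,2) \<delta> E kK by (elim disjE) linarith+
      qed
      then show ?thesis ..
    next
      case (2 i)
      have "d = 2 * j + 1 \<or> d = E + j \<or> d = E - (j + 1)" "d = 2 * i + 1 \<or> d = E + i \<or> d = E - (i + 1)"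
        using d j 2 by auto
      then have "i = j" using j(1) 2(1) E kK by (elim disjE) linarith+
      then show ?thesis using j 2 by simp
    qed
  qed
qed

lemma diffsD:
  assumes "d \<in> diffs"
  shows "0 < d" "d < n" "d \<noteq> \<delta>" "K = k \<Longrightarrow> d \<noteq> 4 * k + 2"
proof -
  obtain a b where ab: "(a, b) \<in> triples" "d = a \<or> d = b \<or> d = b - a"
    using assms unfolding diffs_def by auto
  have "0 < d \<and> d < n \<and> d \<noteq> \<delta> \<and> (K = k \<longrightarrow> d \<noteq> 4 * k + 2)"
    using ab(1)
  proof (cases rule: triplesE)
    case (1 j)
    then show ?thesis using ab(2) K n \<delta> by (elim disjE) auto
  next
    case (2 j)
    then show ?thesis using ab(2) K n \<delta> E by (elim disjE) auto
  qed
  then show "0 < d" "d < n" "d \<noteq> \<delta>" "K = k \<Longrightarrow> d \<noteq> 4 * k + 2" by auto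
qed

lemma diffsI:
  assumes "0 < d" "d < n" "d \<noteq> \<delta>" "\<not> (K = k \<and> d = 4 * k + 2)"
  shows "d \<in> diffs"
proof -
  have 1: "d \<in> diffs" if "1 \<le> j" "j \<le> k" "d = 2 * j \<or> d = \<delta> + j \<or> d + j = \<delta>" for j
  proof -
    have "(2 * j, \<delta> + j) \<in> triples" using that unfolding triples_def by auto
    moreover have "d \<in> {2 * j, \<delta> + j, \<delta> + j - 2 * j}" using that by auto
    ultimately show ?thesis unfolding diffs_def by blast
  qed
  have 2: "d \<in> diffs" if "j < K" "d = 2 * j + 1 \<or> d = E + j \<or> d + (j + 1) = E" for j
  proof -
    have "(2 * j + 1, E + j) \<in> triples" using that unfolding triples_def by auto
    moreover have "d \<in> {2 * j + 1, E + j, E + j - (2 * j + 1)}" using that by auto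
    ultimately show ?thesis unfolding diffs_def by blast
  qed
  \<comment> \<open>The differences fill intervals: the small ones up to \<open>k + K\<close>, the
    pairs around \<open>\<delta>\<close> from \<open>k + K + 1\<close> to
    \<open>\<delta> + k\<close>, the pairs around \<open>E\<close> from \<open>4 k + 3\<close> to
    \<open>n - 1\<close>. Between the last two, \<open>4 k + 2\<close> is left over if
    \<open>K = k\<close>.\<close>
  consider "d \<le> k + K" | "k + K < d" "d < \<delta>" | "\<delta> < d" "d \<le> \<delta> + k" | "\<delta> + k < d" "d < E" | "E \<le> d"
    using assms(3) by linarith
  then show ?thesis
  proof cases
    case a: 1
    show ?thesis
    proof (cases "even d")
      case True
      then obtain j where "d = 2 * j" by (rule evenE)
      then show ?thesis using 1[of j] a assms(1) K by auto
    next
      case False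
      then obtain j where "d = 2 * j + 1" by (rule oddE)
      then show ?thesis using 2[of j] a K by auto
    qed
  next
    case 2
    then show ?thesis using 1[of "\<delta> - d"] \<delta> by auto
  next
    case 3
    then show ?thesis using 1[of "d - \<delta>"] by auto
  next
    case 4
    then have "E - (d + 1) < K" using assms(4) K \<delta> E by auto
    then show ?thesis using 2[of "E - (d + 1)"] 4 by auto
  next
    case 5
    then show ?thesis using 2[of "d - E"] assms(2) E n by auto
  qed
qed

section \<open>Translates and short orbits as a partial triple system\<close>

definition short :: "nat \<Rightarrow> nat set" where
  "short x = {x, (x + (4 * k + 2)) mod (2 * n), (x + 2 * (4 * k + 2)) mod (2 * n)}"

definition base :: "nat set set" where
  "base = translates \<union> {short x | x. x < 2 * n \<and> K = k}"

text \<open>The Cayley graph of the integers modulo \<open>2 n\<close> with connection set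
  \<open>\<delta>\<close>, \<open>- \<delta>\<close>, \<open>n\<close>; the last needs one clause
  only, because \<open>n = - n\<close>.\<close>

definition adj :: "nat \<Rightarrow> nat \<Rightarrow> bool" where
  "adj u v \<longleftrightarrow> v = (u + \<delta>) mod (2 * n) \<or> u = (v + \<delta>) mod (2 * n) \<or> v = (u + n) mod (2 * n)"

text \<open>For \<open>K = k\<close> the modulus is \<open>3 * (4 * k + 2)\<close>, so adding
  \<open>4 * k + 2\<close> permutes the points of \<open>short x\<close> cyclically and each of them
  determines the block.\<close>

lemma short_pair:
  assumes "K = k" "x < 2 * n" "u \<in> short x" "v \<in> short x" "u \<noteq> v"
  shows "short u = short x" "v = (u + (4 * k + 2)) mod (2 * n) \<or> u = (v + (4 * k + 2)) mod (2 * n)"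
    "u < 2 * n"
proof -
  define g where "g = 4 * k + 2"
  have N: "2 * n = 3 * g" unfolding g_def n using assms(1) by simp
  have x: "x < 3 * g" using assms(2) N by simp
  define y where "y = (x + g) mod (3 * g)"
  define z where "z = (x + 2 * g) mod (3 * g)"
  have lt: "y < 3 * g" "z < 3 * g" unfolding y_def z_def using x by simp_all
  have y2: "(y + g) mod (3 * g) = z" "(y + 2 * g) mod (3 * g) = x"
  proof -
    have e: "x + g + g = x + 2 * g" "x + g + 2 * g = x + 3 * g" by simp_all
    show "(y + g) mod (3 * g) = z" unfolding y_def z_def mod_add_left_eq e ..
    show "(y + 2 * g) mod (3 * g) = x" unfolding y_def mod_add_left_eq e using x by simp
  qed
  have z2: "(z + g) mod (3 * g) = x" "(z + 2 * g) mod (3 * g) = y"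
  proof -
    have e: "x + 2 * g + 2 * g = x + g + 3 * g" "x + 2 * g + g = x + 3 * g" by simp_all
    show "(z + g) mod (3 * g) = x" unfolding z_def mod_add_left_eq e using x by simp
    show "(z + 2 * g) mod (3 * g) = y" unfolding z_def y_def mod_add_left_eq e by (rule mod_add_self2)
  qed
  have sh: "short w = {w, (w + g) mod (3 * g), (w + 2 * g) mod (3 * g)}" for w
    unfolding short_def N g_def[symmetric] by simp
  have sx: "short x = {x, y, z}" "short y = {x, y, z}" "short z = {x, y, z}"
    unfolding sh y2 z2 y_def[symmetric] z_def[symmetric] by auto
  show "short u = short x" "u < 2 * n" using assms(3) lt x unfolding sx N by (auto simp: sx)
  show "v = (u + (4 * k + 2)) mod (2 * n) \<or> u = (v + (4 * k + 2)) mod (2 * n)"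
    using assms(3-5) unfolding sx N g_def[symmetric]
    by (elim insertE emptyE) (simp_all add: y2 z2 flip: y_def)
qed

lemma add_mod_cases:
  assumes "v = (u + d) mod (2 * n)" "u < 2 * n" "d < 2 * n"
  shows "v = u + d \<or> v + 2 * n = u + d"
  using assms by (simp add: mod_double)

lemma direction_unique:
  assumes uv: "u < 2 * n" "v < 2 * n" and d: "v = (u + d) mod (2 * n) \<or> u = (v + d) mod (2 * n)"
    and d': "v = (u + d') mod (2 * n) \<or> u = (v + d') mod (2 * n)"
    and bd: "0 < d" "d < n" "0 < d'" "d' \<le> n"
  shows "d = d'"
proof -
  have "v = u + d \<or> v + 2 * n = u + d \<or> u = v + d \<or> u + 2 * n = v + d"
    using d add_mod_cases[of v u d] add_mod_cases[of u v d] uv bd by linarith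
  moreover have "v = u + d' \<or> v + 2 * n = u + d' \<or> u = v + d' \<or> u + 2 * n = v + d'"
    using d' add_mod_cases[of v u d'] add_mod_cases[of u v d'] uv bd by linarith
  ultimately show ?thesis using uv bd by (elim disjE) linarith+
qed

lemma base_subset:
  assumes "t \<in> base"
  shows "t \<subseteq> {..<2 * n}"
proof (cases "t \<in> translates")
  case False
  then obtain x where "t = short x" "x < 2 * n" using assms unfolding base_def by auto
  then show ?thesis unfolding short_def by auto
qed (rule translates_card)

lemma base_card:
  assumes "t \<in> base"
  shows "card t = 3"
proof (cases "t \<in> translates")
  case False
  then obtain x where x: "t = short x" "x < 2 * n" "K = k" using assms unfolding base_def by auto
  have "2 * n = 3 * (4 * k + 2)" using x n by simp
  then have "x \<noteq> (x + (4 * k + 2)) mod (2 * n)" "x \<noteq> (x + 2 * (4 * k + 2)) mod (2 * n)"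
    "(x + (4 * k + 2)) mod (2 * n) \<noteq> (x + 2 * (4 * k + 2)) mod (2 * n)"
    using x(2) by (auto simp: mod_double split: if_splits)
  then show ?thesis unfolding x(1) short_def by simp
qed (rule translates_card)

text \<open>The difference tells translates from short blocks: the latter exist only for
  \<open>K = k\<close>, and then \<open>4 * k + 2\<close> is not in \<open>diffs\<close>.\<close>

lemma base_diff:
  assumes "t \<in> base" "{u, v} \<subseteq> t" "u \<noteq> v"
  obtains d where "0 < d" "d < n" "d \<noteq> \<delta>" "v = (u + d) mod (2 * n) \<or> u = (v + d) mod (2 * n)"
    "t \<in> translates \<longleftrightarrow> d \<in> diffs"
proof (cases "t \<in> translates")
  case True
  then show ?thesis using translates_diff[OF True assms(2,3)] diffsD that by metis
next
  case False
  then obtain x where x: "t = short x" "x < 2 * n" "K = k" using assms(1) unfolding base_def by auto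
  have "v = (u + (4 * k + 2)) mod (2 * n) \<or> u = (v + (4 * k + 2)) mod (2 * n)"
    using short_pair(2)[OF x(3,2)] x assms by auto
  moreover have "4 * k + 2 \<notin> diffs" using diffsD(4) x(3) by auto
  moreover have "4 * k + 2 < n" "4 * k + 2 \<noteq> \<delta>" using x(3) n \<delta> by auto
  ultimately show ?thesis using that[of "4 * k + 2"] False by simp
qed

lemma base_unique:
  assumes "t \<in> base" "t' \<in> base" "{u, v} \<subseteq> t" "{u, v} \<subseteq> t'" "u \<noteq> v"
  shows "t = t'"
proof -
  have uv: "u < 2 * n" "v < 2 * n" using base_subset[OF assms(1)] assms(3) by auto
  obtain d where d: "0 < d" "d < n" "v = (u + d) mod (2 * n) \<or> u = (v + d) mod (2 * n)"
      "t \<in> translates \<longleftrightarrow> d \<in> diffs"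
    using base_diff[OF assms(1,3,5)] by metis
  obtain d' where d': "0 < d'" "d' < n" "v = (u + d') mod (2 * n) \<or> u = (v + d') mod (2 * n)"
      "t' \<in> translates \<longleftrightarrow> d' \<in> diffs"
    using base_diff[OF assms(2,4,5)] by metis
  have "d = d'" using direction_unique[OF uv d(3) d'(3) d(1,2) d'(1)] d'(2) by simp
  then have iff: "t \<in> translates \<longleftrightarrow> t' \<in> translates" using d(4) d'(4) by simp
  show ?thesis
  proof (cases "t \<in> translates")
    case True
    then show ?thesis using translates_unique[OF True _ uv assms(5,3,4)] iff by simp
  next
    case False
    obtain x where x: "t = short x" "x < 2 * n" "K = k" using assms(1) False unfolding base_def by auto
    obtain x' where x': "t' = short x'" "x' < 2 * n" using assms(2) False iff unfolding base_def by auto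
    have "short u = short x" "short u = short x'"
      using short_pair(1)[OF x(3) x(2), of u v] short_pair(1)[OF x(3) x'(2), of u v] assms x x' by auto
    then show ?thesis using x x' by simp
  qed
qed

lemma adj_not_base:
  assumes "u < 2 * n" "v < 2 * n" "adj u v" "u \<noteq> v" "t \<in> base"
  shows "\<not> {u, v} \<subseteq> t"
proof
  assume "{u, v} \<subseteq> t"
  then obtain d where d: "0 < d" "d < n" "d \<noteq> \<delta>" "v = (u + d) mod (2 * n) \<or> u = (v + d) mod (2 * n)"
    using base_diff[OF assms(5) _ assms(4)] by metis
  obtain d' where d': "d' = \<delta> \<or> d' = n" "v = (u + d') mod (2 * n) \<or> u = (v + d') mod (2 * n)"
    using assms(3) unfolding adj_def by metis
  have "0 < d'" "d' \<le> n" using d'(1) n \<delta> by auto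
  then have "d = d'" using direction_unique[OF assms(1,2) d(4) d'(2) d(1,2)] by simp
  then show False using d d'(1) by auto
qed

lemma base_exists:
  assumes "u < 2 * n" "v < 2 * n" "u \<noteq> v" "\<not> adj u v"
  shows "\<exists>t\<in>base. {u, v} \<subseteq> t"
proof -
  have *: "\<exists>t\<in>base. {s, e} \<subseteq> t"
    if sd: "s < 2 * n" "e = (s + d) mod (2 * n)" "0 < d" "d < n" "d \<noteq> \<delta>" for s e d
  proof (cases "K = k \<and> d = 4 * k + 2")
    case True
    then have "{s, e} \<subseteq> short s" using sd unfolding short_def by auto
    moreover have "short s \<in> base" using True sd(1) unfolding base_def by auto
    ultimately show ?thesis by auto
  next
    case False
    then obtain t where "t \<in> translates" "{s, e} \<subseteq> t"
      using translates_exist[OF diffsI[OF sd(3-5)] sd(1)] sd(2) by auto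
    then show ?thesis unfolding base_def by auto
  qed
  have na: "v \<noteq> (u + \<delta>) mod (2 * n)" "u \<noteq> (v + \<delta>) mod (2 * n)" "v \<noteq> (u + n) mod (2 * n)"
    using assms(4) unfolding adj_def by auto
  \<comment> \<open>One of the two ways around has length at most \<open>n\<close>; the half turn
    goes into the first alternative, where non-adjacency excludes it.\<close>
  have "(\<exists>d. 0 < d \<and> d \<le> n \<and> v = (u + d) mod (2 * n)) \<or> (\<exists>d. 0 < d \<and> d < n \<and> u = (v + d) mod (2 * n))"
  proof (cases "u < v")
    case True
    show ?thesis
    proof (cases "v - u \<le> n")
      case True
      then show ?thesis using \<open>u < v\<close> assms by (intro disjI1 exI[of _ "v - u"]) auto
    next
      case False
      then show ?thesis using \<open>u < v\<close> assms by (intro disjI2 exI[of _ "2 * n - (v - u)"]) auto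
    qed
  next
    case False
    show ?thesis
    proof (cases "u - v < n")
      case True
      then show ?thesis using False assms by (intro disjI2 exI[of _ "u - v"]) auto
    next
      case f: False
      have "(u + (2 * n - (u - v))) mod (2 * n) = v" using f False assms by (simp add: mod_double)
      then show ?thesis using f False assms by (intro disjI1 exI[of _ "2 * n - (u - v)"]) auto
    qed
  qed
  then show ?thesis
  proof (elim disjE exE conjE)
    fix d assume d: "0 < d" "d \<le> n" "v = (u + d) mod (2 * n)"
    then have "d \<noteq> n" "d \<noteq> \<delta>" using na by auto
    then show ?thesis using *[OF assms(1) d(3,1)] d(2) by simp
  next
    fix d assume d: "0 < d" "d < n" "u = (v + d) mod (2 * n)"
    then have "d \<noteq> \<delta>" using na by auto
    then show ?thesis using *[OF assms(2) d(3,1,2)] by (simp add: insert_commute)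
  qed
qed

text \<open>Since \<open>2\<delta> = n - 1\<close>, the multiples of \<open>\<delta>\<close> run through all
  residues modulo \<open>n\<close>, so the graph of the uncovered pairs is a prism or a Moebius ladder
  with the two rims \<open>front\<close> and \<open>rear\<close>.\<close>

definition front :: "nat \<Rightarrow> nat" where
  "front j = (j * \<delta>) mod (2 * n)"

definition rear :: "nat \<Rightarrow> nat" where
  "rear j = (j * \<delta> + n) mod (2 * n)"

lemma n\<delta>: "n = 2 * \<delta> + 1" and n_ge: "n \<ge> 9"
  using k K n \<delta> by auto

lemma rim_less: "front j < 2 * n" "rear j < 2 * n"
  unfolding front_def rear_def using n_ge by auto

lemma adj_commute:
  assumes "u < 2 * n" "v < 2 * n" "adj u v"
  shows "adj v u"
proof -
  have "u = (v + n) mod (2 * n)" if "v = (u + n) mod (2 * n)"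
    using add_mod_cases[OF that assms(1)] n_ge assms(1) by (auto simp: mod_double)
  then show ?thesis using assms(3) unfolding adj_def by auto
qed

lemma front_Suc: "front (Suc j) = (front j + \<delta>) mod (2 * n)"
  unfolding front_def mod_add_left_eq by (simp add: add.commute)

lemma rear_Suc: "rear (Suc j) = (rear j + \<delta>) mod (2 * n)"
  unfolding rear_def mod_add_left_eq by (simp add: ac_simps)

lemma rear_front: "rear j = (front j + n) mod (2 * n)"
  unfolding front_def rear_def mod_add_left_eq ..

lemma rim_adj: "adj (front j) (front (Suc j))" "adj (rear j) (rear (Suc j))" "adj (front j) (rear j)"
  unfolding adj_def front_Suc rear_Suc rear_front[of j] by simp_all

lemma rim_0: "front 0 = 0" "rear 0 = n"
  unfolding front_def rear_def using n_ge by auto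

text \<open>\<open>n * \<delta>\<close> is 0 or \<open>n\<close> modulo \<open>2 n\<close> by the
  parity of \<open>\<delta>\<close>: if it is even, the rims close up separately to a prism; if it
  is odd, they join to a Moebius ladder.\<close>

lemma rim_n: "front n = (if even \<delta> then front 0 else rear 0)"
  "rear n = (if even \<delta> then rear 0 else front 0)"
proof -
  have "front n = n * (\<delta> mod 2)"
    unfolding front_def mult.commute[of 2 n] by (rule mult_mod_right[symmetric])
  then show f: "front n = (if even \<delta> then front 0 else rear 0)"
    unfolding rim_0 by (simp add: mod_2_eq_odd)
  then show "rear n = (if even \<delta> then rear 0 else front 0)"
    using n_ge by (simp add: rear_front[of n] rim_0 flip: mult_2)
qed

text \<open>As \<open>2 * \<delta>\<close> is \<open>- 1\<close> modulo \<open>n\<close>, twice a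
  point of rung \<open>j\<close> is \<open>- j\<close>; the number of the rung can thus be read off
  from the point.\<close>

lemma rung_dvd: "n dvd 2 * front j + j" "n dvd 2 * rear j + j"
proof -
  have "(2 * (x mod (2 * n)) + j) mod n = (2 * x + j) mod n" for x
  proof -
    have red: "(2 * y + j) mod n = (2 * (y mod n) + j) mod n" for y
      by (metis mod_add_left_eq mod_mult_right_eq)
    have "(2 * (x mod (2 * n)) + j) mod n = (2 * (x mod (2 * n) mod n) + j) mod n" by (rule red)
    also have "x mod (2 * n) mod n = x mod n" by (simp add: mod_mod_cancel)
    also have "(2 * (x mod n) + j) mod n = (2 * x + j) mod n" by (rule red[symmetric])
    finally show ?thesis .
  qed
  note mod = this
  have e: "2 * (j * \<delta>) + j = j * n" unfolding n\<delta> by (simp add: algebra_simps)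
  have "2 * (j * \<delta> + n) + j = (2 * (j * \<delta>) + j) + 2 * n" by simp
  also have "\<dots> = (j + 2) * n" unfolding e by (simp add: algebra_simps)
  finally have e': "2 * (j * \<delta> + n) + j = (j + 2) * n" .
  have "(2 * front j + j) mod n = (j * n) mod n" "(2 * rear j + j) mod n = ((j + 2) * n) mod n"
    by (simp_all only: front_def rear_def mod e e')
  then show "n dvd 2 * front j + j" "n dvd 2 * rear j + j" by auto
qed

lemma rung_unique:
  assumes "n dvd 2 * w + i" "n dvd 2 * w + j" "i < n" "j < n"
  shows "i = j"
proof -
  have "n dvd i - j" "n dvd j - i"
    using dvd_diff_nat[OF assms(1,2)] dvd_diff_nat[OF assms(2,1)] by simp_all
  then show ?thesis using assms(3,4) by (metis diff_is_0_eq dual_order.antisym less_imp_diff_less nat_dvd_not_less not_gr_zero)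
qed

lemma front_neq_rear: "front j \<noteq> rear j"
  using rim_less(1)[of j] n_ge unfolding rear_front[of j] by (auto simp: mod_double split: if_splits)

text \<open>A Hamiltonian cycle of the ladder: along the front, across the rung
  \<open>n - 1\<close>, back along the rear, and home across the rung \<open>0\<close>.\<close>

definition pos :: "nat \<Rightarrow> nat" where
  "pos i = (if i \<le> n then front (i - 1) else rear (2 * n - i))"

definition nxt :: "nat \<Rightarrow> nat" where
  "nxt i = (if i = 2 * n then 1 else i + 1)"

text \<open>The edges off this cycle: all rungs but the two just used, and the two edges that close
  the rims, whose ends depend on the parity of \<open>\<delta>\<close>.\<close>

definition match :: "nat \<Rightarrow> nat" where
  "match i =
    (if i = n then (if even \<delta> then 1 else 2 * n)
     else if i = n + 1 then (if even \<delta> then 2 * n else 1)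
     else if i = 1 then (if even \<delta> then n else n + 1)
     else if i = 2 * n then (if even \<delta> then n + 1 else n)
     else 2 * n + 1 - i)"

lemma pos_less: "pos i < 2 * n"
  unfolding pos_def using rim_less by simp

lemma pos_inj: "inj_on pos {1..2 * n}"
proof (rule inj_onI)
  fix i j assume ij: "i \<in> {1..2 * n}" "j \<in> {1..2 * n}" "pos i = pos j"
  define r where "r = (\<lambda>i. if i \<le> n then i - 1 else 2 * n - i)"
  have r: "n dvd 2 * pos i + r i" "r i < n" if "i \<in> {1..2 * n}" for i
  proof -
    show "n dvd 2 * pos i + r i"
      using rung_dvd(1)[of "i - 1"] rung_dvd(2)[of "2 * n - i"] unfolding pos_def r_def
      by (cases "i \<le> n") (simp_all only: if_True if_False)
    show "r i < n" using that n_ge unfolding r_def by auto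
  qed
  have "r i = r j" using rung_unique[of "pos i"] r[OF ij(1)] r[OF ij(2)] ij(3) by simp
  moreover have "i \<le> n \<longleftrightarrow> j \<le> n"
  proof (rule ccontr)
    assume "\<not> (i \<le> n \<longleftrightarrow> j \<le> n)"
    then show False
      using ij(3) \<open>r i = r j\<close> front_neq_rear[of "r i"] front_neq_rear[of "r j"]
      by (auto simp: pos_def r_def split: if_splits)
  qed
  ultimately show "i = j" using ij(1,2) unfolding r_def by (auto split: if_splits)
qed

lemma pos_image: "pos ` {1..2 * n} = {..<2 * n}"
proof (rule card_subset_eq)
  show "card (pos ` {1..2 * n}) = card {..<2 * n}" using card_image[OF pos_inj] by simp
qed (use pos_less in auto)

lemma nxt_mem: "i \<in> {1..2 * n} \<Longrightarrow> nxt i \<in> {1..2 * n}"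
  unfolding nxt_def by auto

lemma match_mem:
  assumes "i \<in> {1..2 * n}"
  shows "match i \<in> {1..2 * n} \<and> match i \<noteq> i \<and> match (match i) = i \<and> match i \<noteq> nxt i"
proof -
  consider "i = n" | "i = n + 1" | "i = 1" | "i = 2 * n" | "i \<notin> {1, n, n + 1, 2 * n}" by auto
  then show ?thesis using assms n_ge
    by cases (auto simp: match_def nxt_def)
qed

lemma pos_nxt:
  assumes "i \<in> {1..2 * n}"
  shows "adj (pos i) (pos (nxt i))"
proof -
  consider "i < n" | "i = n" | "n < i" "i < 2 * n" | "i = 2 * n" using assms by fastforce
  then show ?thesis
  proof cases
    case 1
    then have "pos i = front (i - 1)" "pos (nxt i) = front (Suc (i - 1))"
      using assms n_ge by (auto simp: pos_def nxt_def)
    then show ?thesis using rim_adj(1) by simp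
  next
    case 2
    then have "pos i = front (n - 1)" "pos (nxt i) = rear (n - 1)"
      using n_ge by (auto simp: pos_def nxt_def)
    then show ?thesis using rim_adj(3) by simp
  next
    case 3
    then have "pos i = rear (Suc (2 * n - (i + 1)))" "pos (nxt i) = rear (2 * n - (i + 1))"
      by (auto simp: pos_def nxt_def Suc_diff_Suc)
    then show ?thesis using rim_adj(2) adj_commute rim_less by simp
  next
    case 4
    then have "pos i = rear 0" "pos (nxt i) = front 0"
      using n_ge by (auto simp: pos_def nxt_def)
    then show ?thesis using rim_adj(3) adj_commute rim_less by simp
  qed
qed

lemma pos_match:
  assumes "i \<in> {1..2 * n}"
  shows "adj (pos i) (pos (match i))"
proof -
  have f: "adj (front (n - 1)) (front n)" and b: "adj (rear (n - 1)) (rear n)"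
    using rim_adj(1)[of "n - 1"] rim_adj(2)[of "n - 1"] n_ge by simp_all
  have p: "pos n = front (n - 1)" "pos (n + 1) = rear (n - 1)" "pos 1 = front 0" "pos (2 * n) = rear 0"
    using n_ge by (auto simp: pos_def)
  have ends: "adj (pos n) (pos (match n))" "adj (pos (n + 1)) (pos (match (n + 1)))"
    using f b n_ge unfolding match_def p rim_n by (auto simp: p simp del: One_nat_def)
  consider "i = n" | "i = n + 1" | "i = 1" | "i = 2 * n" | "i \<notin> {1, n, n + 1, 2 * n}" by auto
  then show ?thesis
  proof cases
    case 3
    have "match (match 1) = 1" using match_mem[of 1] n_ge by simp
    moreover have "match 1 = n \<or> match 1 = n + 1" using n_ge unfolding match_def by auto
    ultimately show ?thesis using 3 ends adj_commute pos_less by metis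
  next
    case 4
    have "match (match (2 * n)) = 2 * n" using match_mem[of "2 * n"] n_ge by simp
    moreover have "match (2 * n) = n \<or> match (2 * n) = n + 1" using n_ge unfolding match_def by auto
    ultimately show ?thesis using 4 ends adj_commute pos_less by metis
  next
    case 5
    show ?thesis
    proof (cases "i \<le> n")
      case True
      then have "pos i = front (i - 1)" "pos (match i) = rear (i - 1)"
        using 5 assms by (auto simp: pos_def match_def)
      then show ?thesis using rim_adj(3) by simp
    next
      case False
      then have "pos i = rear (2 * n - i)" "pos (match i) = front (2 * n - i)"
        using 5 assms by (auto simp: pos_def match_def)
      then show ?thesis using rim_adj(3) adj_commute rim_less by simp
    qed
  qed (use ends in simp_all)
qed

text \<open>No vertex has more than three neighbours, and the two on the cycle and the partner in
  the matching are three distinct ones, so there are no others.\<close>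

lemma pos_adj_iff:
  assumes "i \<in> {1..2 * n}" "j \<in> {1..2 * n}"
  shows "adj (pos i) (pos j) \<longleftrightarrow> j = nxt i \<or> i = nxt j \<or> j = match i"
proof
  assume "j = nxt i \<or> i = nxt j \<or> j = match i"
  then show "adj (pos i) (pos j)"
    using pos_nxt[OF assms(1)] pos_nxt[OF assms(2)] pos_match[OF assms(1)] adj_commute pos_less by metis
next
  assume ij: "adj (pos i) (pos j)"
  define u where "u = pos i"
  have u: "u < 2 * n" unfolding u_def by (rule pos_less)
  define nb where "nb = {j \<in> {1..2 * n}. adj u (pos j)}"
  define prv where "prv = (if i = 1 then 2 * n else i - 1)"
  have prv: "prv \<in> {1..2 * n}" "nxt prv = i" using assms(1) n_ge unfolding prv_def nxt_def by auto
  let ?C = "{(u + \<delta>) mod (2 * n), (u + (2 * n - \<delta>)) mod (2 * n), (u + n) mod (2 * n)}"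
  have sub: "v \<in> ?C" if "adj u v" "v < 2 * n" for v
  proof -
    have "v = (u + (2 * n - \<delta>)) mod (2 * n)" if "u = (v + \<delta>) mod (2 * n)"
      using add_mod_cases[OF that \<open>v < 2 * n\<close>] u \<open>v < 2 * n\<close> n\<delta> by (auto simp: mod_double)
    then show ?thesis using that(1) unfolding adj_def by auto
  qed
  have "pos ` nb \<subseteq> ?C" using sub pos_less unfolding nb_def by auto
  then have "card (pos ` nb) \<le> card ?C" by (intro card_mono) auto
  also have "card ?C \<le> 3" by (rule card_insert_le_m1; simp add: card_insert_le_m1)
  finally have "card (pos ` nb) \<le> 3" .
  moreover have "nb \<subseteq> {1..2 * n}" unfolding nb_def by auto
  ultimately have "card nb \<le> 3" using card_image[OF inj_on_subset[OF pos_inj]] by simp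
  moreover have "{nxt i, prv, match i} \<subseteq> nb"
    using pos_nxt[OF assms(1)] pos_match[OF assms(1)] pos_nxt[OF prv(1)] prv nxt_mem[OF assms(1)]
      match_mem[OF assms(1)] adj_commute[OF pos_less pos_less] unfolding nb_def u_def by auto
  moreover have "card {nxt i, prv, match i} = 3"
  proof -
    have "nxt i \<noteq> prv" using assms(1) n_ge unfolding nxt_def prv_def by auto
    moreover have "match i \<noteq> nxt i" "match i \<noteq> prv"
      using match_mem[OF assms(1)] match_mem[OF prv(1)] prv(2) by auto
    ultimately show ?thesis by auto
  qed
  moreover have "finite nb" unfolding nb_def by simp
  ultimately have "nb = {nxt i, prv, match i}" by (metis card_seteq)
  moreover have "j \<in> nb" using ij assms(2) unfolding nb_def u_def by simp
  ultimately show "j = nxt i \<or> i = nxt j \<or> j = match i" using prv(2) by auto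
qed

definition preimage :: "nat set \<Rightarrow> nat set" where
  "preimage t = {i \<in> {1..2 * n}. pos i \<in> t}"

definition cycle_triples :: "nat set set" where
  "cycle_triples = preimage ` base \<union> (\<lambda>i. {0, i, match i}) ` {1..2 * n}"

lemma cycle_triples_design: "pair_design {..<2 * n + 1} (cycle_triples \<union> cycle_edges (2 * n))"
  unfolding cycle_triples_def
proof (rule pair_design_cycle)
  have pre: "{i, j} \<subseteq> preimage t \<longleftrightarrow> {pos i, pos j} \<subseteq> t" if "i \<in> {1..2 * n}" "j \<in> {1..2 * n}" for i j t
    using that unfolding preimage_def by auto
  have neq: "pos i \<noteq> pos j" if "i \<in> {1..2 * n}" "j \<in> {1..2 * n}" "i \<noteq> j" for i j
    using inj_onD[OF pos_inj _ that(1,2)] that(3) by auto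
  show "match i \<in> {1..2 * n} \<and> match i \<noteq> i \<and> match (match i) = i" if "i \<in> {1..2 * n}" for i
    using match_mem[OF that] by simp
  show "match i \<noteq> (if i = 2 * n then 1 else i + 1)" if "i \<in> {1..2 * n}" for i
    using match_mem[OF that] unfolding nxt_def by simp
  show "t \<subseteq> {1..2 * n}" if "t \<in> preimage ` base" for t
    using that unfolding preimage_def by auto
  show "\<not> {i, j} \<subseteq> t" if "i \<in> {1..2 * n}" "j \<in> {1..2 * n}" "i \<noteq> j"
    "j = (if i = 2 * n then 1 else i + 1) \<or> i = (if j = 2 * n then 1 else j + 1) \<or> j = match i"
    "t \<in> preimage ` base" for i j t
  proof -
    have "adj (pos i) (pos j)" using pos_adj_iff[OF that(1,2)] that(4) unfolding nxt_def by simp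
    then show ?thesis
      using that(5) pre[OF that(1,2)] adj_not_base[OF pos_less pos_less _ neq[OF that(1-3)]] by auto
  qed
  show "\<exists>!t. t \<in> preimage ` base \<and> {i, j} \<subseteq> t" if ij: "i \<in> {1..2 * n}" "j \<in> {1..2 * n}" "i \<noteq> j"
    "\<not> (j = (if i = 2 * n then 1 else i + 1) \<or> i = (if j = 2 * n then 1 else j + 1) \<or> j = match i)" for i j
  proof -
    have "\<not> adj (pos i) (pos j)" using pos_adj_iff[OF ij(1,2)] ij(4) unfolding nxt_def by simp
    then obtain t where t: "t \<in> base" "{pos i, pos j} \<subseteq> t"
      using base_exists[OF pos_less pos_less neq[OF ij(1-3)]] by auto
    show ?thesis
    proof (rule ex1I[of _ "preimage t"])
      show "preimage t \<in> preimage ` base \<and> {i, j} \<subseteq> preimage t"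
        using t pre[OF ij(1,2)] by simp
      fix s assume "s \<in> preimage ` base \<and> {i, j} \<subseteq> s"
      then obtain t' where t': "t' \<in> base" "s = preimage t'" "{i, j} \<subseteq> preimage t'" by auto
      then have "t' = t"
        using base_unique[OF t'(1) t(1) _ t(2) neq[OF ij(1-3)]] pre[OF ij(1,2)] by simp
      then show "s = preimage t" using t' by simp
    qed
  qed
qed (use n_ge in simp)

lemma cycle_triples_card:
  assumes "t \<in> cycle_triples"
  shows "card t = 3"
proof (cases "t \<in> preimage ` base")
  case True
  then obtain s where s: "s \<in> base" "t = preimage s" by auto
  have "s \<subseteq> pos ` {1..2 * n}" using base_subset[OF s(1)] unfolding pos_image .
  then have "pos ` t = s" using s(2) unfolding preimage_def by auto
  moreover have "t \<subseteq> {1..2 * n}" unfolding s(2) preimage_def by auto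
  ultimately show ?thesis
    using base_card[OF s(1)] card_image[OF inj_on_subset[OF pos_inj \<open>t \<subseteq> {1..2 * n}\<close>]] by simp
next
  case False
  then obtain i where "i \<in> {1..2 * n}" "t = {0, i, match i}" using assms unfolding cycle_triples_def by auto
  then show ?thesis using match_mem[of i] by auto
qed

end

subsection \<open>Embeddings of all stars\<close>

lemma star_embeds_prism:
  assumes "k \<ge> 1" "K = k \<or> K = k + 1" "a = 4 * k + 2 * K + 4"
  shows "embeds_in_order (star a) (4 * a - 3)"
proof -
  define n where "n = 4 * k + 2 * K + 3"
  interpret prism_design k K n "2 * k + K + 1" "4 * k + K + 3"
    by unfold_locales (use assms n_def in simp_all)
  have D: "doubling {..<2 * n + 1} {..2 * n + 1} (gk (2 * n + 1)) {n, n + 1} cycle_triples"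
    by (rule gk_doubling_cycle[OF refl _ cycle_triples_card cycle_triples_design]) (use n_ge in simp)
  \<comment> \<open>This choice makes the removed edge \<open>{q + 1, q + 2}\<close> equal to
    \<open>{n, n + 1}\<close>, for which the missing colours form the cycle.\<close>
  define q where "q = n - 1"
  have q: "q \<ge> 7" "2 * n + 1 = 2 * q + 3" using n_ge unfolding q_def by simp_all
  have "{q + 1..<2 * n + 1 - q} = {n, n + 1}" using n_ge unfolding q_def by auto
  then have "embeds_in_order (star (q + 2)) (2 * n + 1 + 2 * q + 2)"
    using star_embeds_untraded[OF q(1), of "2 * n + 1" cycle_triples] q(2) D by simp
  moreover have "q + 2 = a" "2 * n + 1 + 2 * q + 2 = 4 * a - 3"
    using assms(3) n_def n_ge unfolding q_def by simp_all
  ultimately show ?thesis by simp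
qed

lemma star_embeds_full:
  assumes a: "a = q + 2" "q \<ge> 7" and T: "steiner_triple_system (2 * q + 1) {..<2 * q + 1} T"
  shows "embeds_in_order (star a) (4 * a - 5)"
proof -
  have "doubling {..<2 * q + 1} {..2 * q + 1} (gk (2 * q + 1)) {} T"
    by (rule gk_doubling_steiner[OF _ T]) simp
  then have "embeds_in_order (star (q + 2)) (2 * q + 1 + 2 * q + 2)"
    using star_embeds_untraded[OF a(2), of "2 * q + 1" T] by (simp del: add_2_eq_Suc')
  moreover have "2 * q + 1 + 2 * q + 2 = 4 * a - 5" "q + 2 = a" using a by simp_all
  ultimately show ?thesis by (simp only:)
qed

lemma star_embeds_2:
  assumes "k \<ge> 1"
  shows "embeds_in_order (star (6 * k + 2)) (24 * k + 7)"
proof -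
  let ?F = "{{2, 5, 7}, {6, 8, 10}} :: nat set set"
  \<comment> \<open>With \<open>q = 6 k + 1\<close> there are \<open>m = 2 q + 1 = 12 k + 3\<close>
    colours, in \<open>4 k + 1\<close> Bose columns.\<close>
  obtain T where T: "steiner_triple_system (12 * k + 3) {..<12 * k + 3} T" "?F \<subseteq> T"
  proof (rule steiner_triple_system_with_blocks[of "12 * k + 3" "2 * k" ?F])
    show "A \<subseteq> {..<12 * k + 3} \<and> card A = 3" if "A \<in> ?F" for A
      using that assms by (elim insertE emptyE) auto
    show "A \<inter> A' = {}" if "A \<in> ?F" "A' \<in> ?F" "A \<noteq> A'" for A A'
      using that by (elim insertE emptyE) auto
    show "card ?F \<le> 2 * (2 * k) + 1"
      using assms card_insert_le_m1[of 2 "{{6, 8, 10}} :: nat set set" "{2, 5, 7}"] by simp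
  qed (use assms in auto)
  have "embeds_in_order (star (6 * k + 1 + 1)) (2 * (12 * k + 3) + 1)"
    by (rule star_embeds_traded[where T = T]) (use assms T in auto)
  then show ?thesis by (simp add: algebra_simps)
qed

lemma star_embeds_1:
  assumes "k \<ge> 2"
  shows "embeds_in_order (star (6 * k + 1)) (24 * k + 7)"
proof -
  \<comment> \<open>Now \<open>m = 2 q + 3\<close> is again \<open>12 k + 3\<close>;
    \<open>k \<ge> 2\<close> gives the bound \<open>q \<ge> 12\<close> of the second pair of
    trades.\<close>
  define q where "q = 6 * k"
  have q: "q \<ge> 12" "2 * q + 3 = 12 * k + 3" using assms unfolding q_def by simp_all
  let ?F = "{{2, 5, 7}, {6, 8, 10}, {4, q + 2, q + 4}, {11, q + 7, q + 8}} :: nat set set"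
  obtain T where T: "steiner_triple_system (2 * q + 3) {..<2 * q + 3} T" "?F \<subseteq> T"
  proof (rule steiner_triple_system_with_blocks[of "2 * q + 3" "2 * k" ?F])
    show "2 * q + 3 = 3 * (2 * (2 * k) + 1)" using q by simp
    show "A \<subseteq> {..<2 * q + 3} \<and> card A = 3" if "A \<in> ?F" for A
      using that q(1) by (elim insertE emptyE) auto
    show "A \<inter> A' = {}" if "A \<in> ?F" "A' \<in> ?F" "A \<noteq> A'" for A A'
      using that q(1) by (elim insertE emptyE) auto
    have "card (set [{2, 5, 7}, {6, 8, 10}, {4, q + 2, q + 4}, {11, q + 7, q + 8}]) \<le> 4"
      by (rule order_trans[OF card_length]) simp
    then show "card ?F \<le> 2 * (2 * k) + 1" using assms by simp
  qed simp
  have "embeds_in_order (star (q + 1)) (2 * (2 * q + 3) + 1)"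
    by (rule star_embeds_traded[where T = T]) (use q T in auto)
  then show ?thesis unfolding q_def by (simp add: algebra_simps)
qed

lemma steiner_triple_system_3_mod_6:
  obtains T where "steiner_triple_system (3 * (2 * t + 1)) {..<3 * (2 * t + 1)} T"
  using steiner_triple_system_with_blocks[OF refl, of "{}" t] by auto

lemma star_embeds_large:
  assumes "a \<ge> 9"
  shows "embeds_in_order (star a) (star_order a)"
proof -
  define k where "k = a div 6"
  have a: "a = 6 * k + a mod 6" and k: "k \<ge> 1" using assms unfolding k_def by simp_all
  have "a mod 6 < 6" by simp
  then consider "a mod 6 = 0" | "a mod 6 = 1" | "a mod 6 = 2" | "a mod 6 = 3" | "a mod 6 = 4" | "a mod 6 = 5"
    by linarith
  then show ?thesis
  proof cases
    case 1
    then have "star_order a = 4 * a - 3" by (simp add: star_order_def)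
    \<comment> \<open>A multiple of 6 needs one more odd than even difference, hence the parameters
      \<open>k - 1\<close> and \<open>k\<close>.\<close>
    moreover have "a = 4 * (k - 1) + 2 * (k - 1 + 1) + 4" "k - 1 \<ge> 1" using a 1 k assms by auto
    ultimately show ?thesis using star_embeds_prism[of "k - 1" "k - 1 + 1" a] by simp
  next
    case 2
    then have "star_order a = 24 * k + 7" "k \<ge> 2" using a assms by (auto simp: star_order_def)
    then show ?thesis using star_embeds_1[of k] a 2 by simp
  next
    case 3
    then have "star_order a = 24 * k + 7" using a by (auto simp: star_order_def)
    then show ?thesis using star_embeds_2[of k] a 3 k by simp
  next
    case 4
    obtain T where T: "steiner_triple_system (3 * (2 * (2 * k) + 1)) {..<3 * (2 * (2 * k) + 1)} T"
      by (rule steiner_triple_system_3_mod_6)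
    have eq: "3 * (2 * (2 * k) + 1) = 2 * (6 * k + 1) + 1" by simp
    have "embeds_in_order (star a) (4 * a - 5)"
    proof (rule star_embeds_full)
      show "a = 6 * k + 1 + 2" "6 * k + 1 \<ge> 7" using a 4 k by simp_all
    qed (rule T[unfolded eq])
    then show ?thesis using 4 by (simp add: star_order_def)
  next
    case 5
    then have "star_order a = 4 * a - 3" by (simp add: star_order_def)
    then show ?thesis using star_embeds_prism[of k k a] a 5 k by simp
  next
    case 6
    \<comment> \<open>The \<open>2 a - 3 = 12 k + 7\<close> colours are 1 modulo 6, out of reach of
      Bose's construction, but this number is \<open>2 * (6 k + 3) + 1\<close>.\<close>
    obtain S where S: "steiner_triple_system (3 * (2 * k + 1)) {..<3 * (2 * k + 1)} S"
      by (rule steiner_triple_system_3_mod_6)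
    obtain T where T: "steiner_triple_system (2 * (3 * (2 * k + 1)) + 1) {..<2 * (3 * (2 * k + 1)) + 1} T"
      by (rule steiner_triple_system_double[OF _ S]) simp_all
    have eq: "2 * (3 * (2 * k + 1)) + 1 = 2 * (6 * k + 3) + 1" by simp
    have "embeds_in_order (star a) (4 * a - 5)"
    proof (rule star_embeds_full)
      show "a = 6 * k + 3 + 2" "6 * k + 3 \<ge> 7" using a 6 k by simp_all
    qed (rule T[unfolded eq])
    then show ?thesis using 6 by (simp add: star_order_def)
  qed
qed

section \<open>Stars with at most nine vertices\<close>

lemma star_positionI:
  assumes S: "steiner_triple_system v V \<B>"
    and sub: "P \<subseteq> V" "L \<subseteq> V" "c \<in> V" and disj: "c \<notin> P" "c \<notin> L" "P \<inter> L = {}"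
    and PP: "\<And>p q. \<lbrakk>p \<in> P; q \<in> P; p \<noteq> q\<rbrakk> \<Longrightarrow> \<exists>u. u \<notin> P \<union> L \<union> {c} \<and> {p, q, u} \<in> \<B>"
    and LL: "\<And>p q. \<lbrakk>p \<in> L; q \<in> L; p \<noteq> q\<rbrakk> \<Longrightarrow> \<exists>u. u \<notin> P \<union> L \<union> {c} \<and> {p, q, u} \<in> \<B>"
    and cL: "\<And>l. l \<in> L \<Longrightarrow> \<exists>p\<in>P. {c, l, p} \<in> \<B>"
    and U: "\<And>u. u \<in> V - P - L - {c} \<Longrightarrow> \<exists>p\<in>P. \<exists>q\<in>P. p \<noteq> q \<and> {u, p, q} \<in> \<B>"
  shows "star_position V \<B> P c L"
proof -
  have *: "B \<inter> (P \<union> L \<union> {c}) = {p, q}"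
    if "B \<in> \<B>" "{p, q} \<subseteq> B" "p \<noteq> q" "{p, q} \<subseteq> P \<or> {p, q} \<subseteq> L" for B p q
  proof -
    obtain u where u: "u \<notin> P \<union> L \<union> {c}" "{p, q, u} \<in> \<B>"
      using PP[of p q] LL[of p q] \<open>p \<noteq> q\<close> \<open>_ \<or> _\<close> by auto
    then have "B = {p, q, u}" using steiner_triple_system_unique[OF S that(1) u(2) that(2) _ that(3)] by simp
    then show ?thesis using u(1) that(4) by auto
  qed
  show ?thesis
    unfolding star_position_def using sub disj cL U * by (intro conjI ballI impI) simp_all
qed

context bose
begin

text \<open>A closed form of the third point, with \<open>s h x\<close> the solution of
  \<open>f x z = h\<close>, makes concrete positions checkable by evaluation.\<close>

lemma third_block:
  assumes sub: "\<And>x h. \<lbrakk>x \<in> Q; h \<in> Q\<rbrakk> \<Longrightarrow> s h x \<in> Q \<and> f x (s h x) = h"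
    and "x \<in> Q" "y \<in> Q" "i < 3" "j < 3" "(x, i) \<noteq> (y, j)"
  shows "{(x, i), (y, j), if i = j then (f x y, Suc i mod 3) else if x = y then (x, 3 - (i + j))
    else if j = Suc i mod 3 then (s y x, i) else (s x y, j)} \<in> blocks"
proof -
  have ij: "i = 0 \<or> i = 1 \<or> i = 2" "j = 0 \<or> j = 1 \<or> j = 2" using assms(4,5) by linarith+
  have succ: "{(x, i), (y, j), (s y x, i)} \<in> blocks"
    if "x \<in> Q" "y \<in> Q" "i < 3" "x \<noteq> y" "j = Suc i mod 3" for x y i j
  proof -
    have s: "s y x \<in> Q" "f x (s y x) = y" using sub that by auto
    then have "s y x \<noteq> x" using idem that by auto
    then have "triple i x (s y x) \<in> blocks" using triple_in_blocks that s by simp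
    then show ?thesis using s that unfolding triple_def by (simp add: insert_commute)
  qed
  have lev: "i = j \<or> j = Suc i mod 3 \<or> i = Suc j mod 3" using ij by (elim disjE) simp_all
  have neq: "i \<noteq> j \<or> x \<noteq> y" using assms(6) by blast
  consider "i = j" "x \<noteq> y" | "x = y" "i \<noteq> j" | "i \<noteq> j" "x \<noteq> y" "j = Suc i mod 3"
    | "i \<noteq> j" "x \<noteq> y" "j \<noteq> Suc i mod 3" "i = Suc j mod 3"
    using lev neq by metis
  then show ?thesis
  proof cases
    case 1
    then show ?thesis using triple_in_blocks[of i x y] assms unfolding triple_def by simp
  next
    case 2
    have "{(x, i), (x, j), (x, 3 - (i + j))} = column x"
      using ij 2(2) by (auto simp: column_def)
    then show ?thesis using 2 column_in_blocks[OF assms(2)] by simp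
  next
    case 3
    then show ?thesis using succ[of x y i j] assms by simp
  next
    case 4
    then show ?thesis using succ[of y x j i] assms by (simp add: insert_commute)
  qed
qed

end

text \<open>The third point in Bose's system on 21 points. The mean of \<open>x\<close> and
  \<open>z\<close> is \<open>y\<close> for \<open>z = 2 y - x\<close>, where the summand 7 prevents
  truncated subtraction.\<close>

fun bose7_third :: "nat \<times> nat \<Rightarrow> nat \<times> nat \<Rightarrow> nat \<times> nat" where
  "bose7_third (x, i) (y, j) =
     (if i = j then ((x + y) * (3 + 1) mod (2 * 3 + 1), Suc i mod 3) else if x = y then (x, 3 - (i + j))
      else if j = Suc i mod 3 then ((2 * y + 7 - x) mod 7, i) else ((2 * x + 7 - y) mod 7, j))"

lemma star_embeds_bose7:
  assumes V: "P \<union> L \<union> {c} \<subseteq> {0, 1, 2, 3, 4, 5, 6} \<times> {0, 1, 2}"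
    and disj: "c \<notin> P" "c \<notin> L" "P \<inter> L = {}"
    and PP: "\<forall>p\<in>P. \<forall>q\<in>P. p \<noteq> q \<longrightarrow> bose7_third p q \<notin> P \<union> L \<union> {c}"
    and LL: "\<forall>p\<in>L. \<forall>q\<in>L. p \<noteq> q \<longrightarrow> bose7_third p q \<notin> P \<union> L \<union> {c}"
    and cL: "\<forall>l\<in>L. bose7_third c l \<in> P"
    and U: "\<forall>u\<in>{0, 1, 2, 3, 4, 5, 6} \<times> {0, 1, 2}.
      u \<in> P \<or> u \<in> L \<or> u = c \<or> (\<exists>p\<in>P. bose7_third u p \<in> P - {p})"
  shows "embeds_in_order (star (Suc (card L))) 21"
proof -
  interpret bose "{..<2 * 3 + 1 :: nat}" "\<lambda>x y. ((x + y) * (3 + 1)) mod (2 * 3 + 1)"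
    by (rule bose_mod)
  have Q: "{0, 1, 2, 3, 4, 5, 6} = {..<2 * 3 + 1 :: nat}" "{0, 1, 2} = {..<3 :: nat}" by auto
  have third: "{p, q, bose7_third p q} \<in> blocks"
    if "p \<in> {..<2 * 3 + 1} \<times> {..<3}" "q \<in> {..<2 * 3 + 1} \<times> {..<3}" "p \<noteq> q" for p q
  proof -
    obtain x i y j where p: "p = (x, i)" "q = (y, j)" by (cases p, cases q)
    have s: "(2 * h + 7 - x) mod 7 \<in> {..<2 * 3 + 1} \<and>
        ((x + (2 * h + 7 - x) mod 7) * (3 + 1)) mod (2 * 3 + 1) = h"
      if "x \<in> {..<2 * 3 + 1}" "h \<in> {..<2 * 3 + 1}" for x h :: nat
    proof -
      have "((x + (2 * h + 7 - x) mod 7) * 4) mod 7 = ((x + (2 * h + 7 - x)) * 4) mod 7"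
        by (metis mod_add_right_eq mod_mult_left_eq)
      also have "(x + (2 * h + 7 - x)) * 4 = h + 7 * (h + 4)" using that by simp
      also have "(h + 7 * (h + 4)) mod 7 = h mod 7" by (rule mod_mult_self2)
      finally show ?thesis using that by simp
    qed
    show ?thesis
      unfolding p bose7_third.simps
      by (rule third_block[of "\<lambda>h x. (2 * h + 7 - x) mod 7" x y i j, OF s]) (use that p in auto)
  qed
  have st: "steiner_triple_system 21 ({..<2 * 3 + 1} \<times> {..<3}) blocks" using steiner by simp
  have sub: "P \<subseteq> {..<2 * 3 + 1} \<times> {..<3}" "L \<subseteq> {..<2 * 3 + 1} \<times> {..<3}"
    "c \<in> {..<2 * 3 + 1} \<times> {..<3}" using V unfolding Q by auto
  have "star_position ({..<2 * 3 + 1} \<times> {..<3}) blocks P c L"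
  proof (rule star_positionI[OF st sub disj])
    show "\<exists>u. u \<notin> P \<union> L \<union> {c} \<and> {p, q, u} \<in> blocks" if "p \<in> P" "q \<in> P" "p \<noteq> q" for p q
      using third[of p q] PP that sub by (intro exI[of _ "bose7_third p q"]) auto
    show "\<exists>u. u \<notin> P \<union> L \<union> {c} \<and> {p, q, u} \<in> blocks" if "p \<in> L" "q \<in> L" "p \<noteq> q" for p q
      using third[of p q] LL that sub by (intro exI[of _ "bose7_third p q"]) auto
    show "\<exists>p\<in>P. {c, l, p} \<in> blocks" if "l \<in> L" for l
      using third[of c l] cL that sub disj by (intro bexI[of _ "bose7_third c l"]) auto
    show "\<exists>p\<in>P. \<exists>q\<in>P. p \<noteq> q \<and> {u, p, q} \<in> blocks"
      if u: "u \<in> {..<2 * 3 + 1} \<times> {..<3} - P - L - {c}" for u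
    proof -
      obtain p where p: "p \<in> P" "bose7_third u p \<in> P - {p}"         using bspec[OF U[unfolded Q], of u] u by (metis DiffE insertCI)
      moreover have "{u, p, bose7_third u p} \<in> blocks" using third[of u p] p u sub by auto
      ultimately show ?thesis by (intro bexI[of _ p] bexI[of _ "bose7_third u p"]) auto
    qed
  qed
  then show ?thesis by (rule star_position_embeds_in_order[OF st])
qed

text \<open>The positions for three and four vertices and the triples on 13 points below were found
  by computer.\<close>

lemma star_3_embeds: "embeds_in_order (star 3) 21"
proof -
  have "embeds_in_order (star (Suc (card {(1 :: nat, 0 :: nat), (1, 2)}))) 21"
    by (rule star_embeds_bose7[where c = "(2, 0)"
        and P = "{(0, 0), (2, 1), (3, 2), (5, 1), (5, 2), (6, 0), (6, 1)}"]) simp_all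
  then show ?thesis by (simp add: numeral_3_eq_3)
qed

lemma star_4_embeds: "embeds_in_order (star 4) 21"
proof -
  have "embeds_in_order (star (Suc (card {(2 :: nat, 0 :: nat), (3, 1), (6, 1)}))) 21"
    by (rule star_embeds_bose7[where c = "(2, 1)"
        and P = "{(0, 0), (0, 1), (1, 0), (2, 2), (4, 2), (6, 2)}"]) simp_all
  then show ?thesis by (simp add: eval_nat_numeral)
qed

text \<open>One colour and two vertices, with \<open>1\<close> as the point at infinity; there is no
  nonzero colour to realise.\<close>

lemma star_2_embeds: "embeds_in_order (star 2) 3"
proof -
  have "steiner_triple_system 1 {..<1 :: nat} {}" by (simp add: steiner_triple_system_def)
  then have D: "doubling {..<1} {..1} (gk 1) {} {}" by (intro gk_doubling_steiner) simp_all
  have "embeds_in_order (star (Suc (card {1 :: nat}))) (1 + card ({..1 :: nat} - {}))"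
    by (rule doubling_star_embeds[OF D, where P = "{0}"]) (auto simp: gk_def)
  then show ?thesis by (simp add: numeral_2_eq_2 numeral_3_eq_3)
qed

lemma star_5_embeds: "embeds_in_order (star 5) 15"
proof -
  obtain S where S: "steiner_triple_system (3 * (2 * 0 + 1)) {..<3 * (2 * 0 + 1) :: nat} S"
    by (rule steiner_triple_system_3_mod_6)
  obtain T where T: "steiner_triple_system (2 * (3 * (2 * 0 + 1)) + 1) {..<2 * (3 * (2 * 0 + 1)) + 1 :: nat} T"
    by (rule steiner_triple_system_double[OF _ S]) simp_all
  then have "steiner_triple_system 7 {..<7} T" by simp
  then have D: "doubling {..<7} {..7} (gk 7) {} T" by (intro gk_doubling_steiner) simp_all
  \<comment> \<open>The six pairwise sums of \<open>{0, 1, 2, 4}\<close> are exactly the nonzero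
    residues modulo 7.\<close>
  have c: "\<forall>u\<in>{1, 2, 3, 4, 5, 6}. \<exists>p\<in>{0, 1, 2, 4}. \<exists>q\<in>{0, 1, 2, 4}. p \<noteq> q \<and> gk 7 p q = u"
    by (simp add: gk_def)
  have "embeds_in_order (star (Suc (card {3, 5, 6, 7 :: nat}))) (7 + card ({..7 :: nat} - {}))"
  proof (rule doubling_star_embeds[OF D, where P = "{0, 1, 2, 4}"])
    show "{..7 :: nat} - {} = {0, 1, 2, 4} \<union> {3, 5, 6, 7}" by auto
    show "\<exists>p\<in>{0, 1, 2, 4}. \<exists>q\<in>{0, 1, 2, 4}. p \<noteq> q \<and> gk 7 p q = u" if "0 < u" "u < 7" for u
    proof -
      have "u \<in> {1, 2, 3, 4, 5, 6}" using that by auto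
      then show ?thesis by (rule bspec[OF c])
    qed
  qed (auto simp: gk_def)
  then show ?thesis by (simp add: eval_nat_numeral)
qed

lemma star_6_embeds: "embeds_in_order (star 6) 19"
proof -
  obtain T where T: "steiner_triple_system (3 * (2 * 1 + 1)) {..<3 * (2 * 1 + 1) :: nat} T"
    by (rule steiner_triple_system_3_mod_6)
  then have "steiner_triple_system 9 {..<9} T" by simp
  then have D: "doubling {..<9} {..9} (gk 9) {} T" by (intro gk_doubling_steiner) simp_all
  have c: "\<forall>u\<in>{1, 2, 3, 4, 5, 6, 7, 8}.
      \<exists>p\<in>{0, 1, 2, 3, 5}. \<exists>q\<in>{0, 1, 2, 3, 5}. p \<noteq> q \<and> gk 9 p q = u"
    by (simp add: gk_def)
  have "embeds_in_order (star (Suc (card {4, 6, 7, 8, 9 :: nat}))) (9 + card ({..9 :: nat} - {}))"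
  proof (rule doubling_star_embeds[OF D, where P = "{0, 1, 2, 3, 5}"])
    show "{..9 :: nat} - {} = {0, 1, 2, 3, 5} \<union> {4, 6, 7, 8, 9}"
      by (rule set_eqI, simp, presburger)
    show "\<exists>p\<in>{0, 1, 2, 3, 5}. \<exists>q\<in>{0, 1, 2, 3, 5}. p \<noteq> q \<and> gk 9 p q = u" if "0 < u" "u < 9" for u
    proof -
      have "u \<in> {1, 2, 3, 4, 5, 6, 7, 8}" using that by (simp, presburger)
      then show ?thesis by (rule bspec[OF c])
    qed
  qed (auto simp: gk_def)
  then show ?thesis by (simp add: eval_nat_numeral)
qed

text \<open>Counting occurrences in a list turns the covering condition into one that evaluation
  decides.\<close>

lemma pair_design_list:
  fixes V :: "nat set"
  assumes sub: "\<And>b. b \<in> set bs \<Longrightarrow> set b \<subseteq> V"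
    and once: "\<forall>x\<in>V. \<forall>y\<in>V. x < y \<longrightarrow> length (filter (\<lambda>b. x \<in> set b \<and> y \<in> set b) bs) = 1"
  shows "pair_design V (set ` set bs)"
proof -
  have *: "\<exists>!B. B \<in> set ` set bs \<and> {x, y} \<subseteq> B" if "x \<in> V" "y \<in> V" "x < y" for x y
  proof -
    have "length (filter (\<lambda>b. x \<in> set b \<and> y \<in> set b) bs) = 1" using once that by simp
    then obtain b where eq: "filter (\<lambda>b. x \<in> set b \<and> y \<in> set b) bs = [b]"
      by (auto simp: length_Suc_conv)
    have "c \<in> set (filter (\<lambda>b. x \<in> set b \<and> y \<in> set b) bs) \<longleftrightarrow> c = b" for c
      unfolding eq by simp
    then have b: "c \<in> set bs \<and> x \<in> set c \<and> y \<in> set c \<longleftrightarrow> c = b" for c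
      unfolding set_filter mem_Collect_eq .
    show ?thesis
    proof (rule ex1I[of _ "set b"])
      show "set b \<in> set ` set bs \<and> {x, y} \<subseteq> set b" using b[of b] by simp
      fix B assume B: "B \<in> set ` set bs \<and> {x, y} \<subseteq> B"
      then obtain c where "c \<in> set bs" "B = set c" by auto
      then show "B = set b" using b[of c] B by simp
    qed
  qed
  show ?thesis
    unfolding pair_design_def
  proof (intro conjI ballI impI)
    show "B \<subseteq> V" if "B \<in> set ` set bs" for B using that sub by auto
    fix x y assume xy: "x \<in> V" "y \<in> V" "x \<noteq> y"
    show "\<exists>!B. B \<in> set ` set bs \<and> {x, y} \<subseteq> B"
    proof (cases "x < y")
      case False
      then have "\<exists>!B. B \<in> set ` set bs \<and> {y, x} \<subseteq> B" using *[of y x] xy by simp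
      then show ?thesis by (simp only: insert_commute)
    qed (use * xy in simp)
  qed
qed

definition triples13 :: "nat list list" where
  "triples13 =
    [[0, 1, 7], [0, 2, 8], [0, 3, 12], [0, 4, 10], [0, 5, 9], [0, 6, 11], [1, 3, 6], [1, 4, 9],
     [1, 5, 10], [1, 8, 11], [2, 4, 6], [2, 5, 11], [2, 7, 9], [2, 10, 12], [3, 5, 8], [3, 7,
     10], [3, 9, 11], [4, 7, 11], [4, 8, 12], [5, 7, 12], [6, 8, 10], [6, 9, 12]]"

definition edges12 :: "nat list list" where
  "edges12 = [[1, 2], [2, 3], [3, 4], [4, 5], [5, 6], [6, 7], [7, 8], [8, 9], [9, 10], [10, 11],
    [11, 12], [12, 1]]"

lemma triples13_design: "pair_design {..<13} (set ` set triples13 \<union> cycle_edges 12)"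
proof -
  have V: "{..<13} = {0, 1, 2, 3, 4, 5, 6, 7, 8, 9, 10, 11, 12 :: nat}"
    by (rule set_eqI, simp, presburger)
  have "{1..12} = {1, 2, 3, 4, 5, 6, 7, 8, 9, 10, 11, 12 :: nat}"
    by (rule set_eqI, simp, presburger)
  then have E: "cycle_edges 12 = set ` set edges12"
    unfolding cycle_edges_def edges12_def by (simp add: eval_nat_numeral)
  have "pair_design {..<13} (set ` set (triples13 @ edges12))"
  proof (rule pair_design_list)
    have "\<forall>b\<in>set (triples13 @ edges12). set b \<subseteq> {..<13}"
      by (simp add: triples13_def edges12_def)
    then show "set b \<subseteq> {..<13}" if "b \<in> set (triples13 @ edges12)" for b using that by (rule bspec)
    show "\<forall>x\<in>{..<13}. \<forall>y\<in>{..<13}. x < y \<longrightarrow>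
        length (filter (\<lambda>b. x \<in> set b \<and> y \<in> set b) (triples13 @ edges12)) = 1"
      unfolding V by (simp add: triples13_def edges12_def)
  qed
  then show ?thesis unfolding E by (simp add: image_Un)
qed

text \<open>Deleting one edge requires \<open>n = 6\<close> here, while \<open>prism_design\<close>
  yields odd \<open>n\<close> only; hence the explicit triples.\<close>

lemma star_7_embeds: "embeds_in_order (star 7) 25"
proof -
  have "\<forall>t\<in>set triples13. card (set t) = 3" by (simp add: triples13_def)
  then have D: "doubling {..<13} {..13} (gk 13) {6, 6 + 1} (set ` set triples13)"
    using triples13_design by (intro gk_doubling_cycle) auto
  have c: "\<forall>u\<in>{1, 2, 3, 4, 5, 6, 7, 8, 9, 10, 11, 12}.
      \<exists>p\<in>{0, 1, 2, 3, 5, 9}. \<exists>q\<in>{0, 1, 2, 3, 5, 9}. p \<noteq> q \<and> gk 13 p q = u"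
    by (simp add: gk_def)
  have O: "{..13 :: nat} - {6, 6 + 1} = {0, 1, 2, 3, 5, 9} \<union> {4, 8, 10, 11, 12, 13}"
    by (rule set_eqI, simp, presburger)
  have "embeds_in_order (star (Suc (card {4, 8, 10, 11, 12, 13 :: nat})))
      (13 + card ({..13 :: nat} - {6, 6 + 1}))"
  proof (rule doubling_star_embeds[OF D _ O])
    show "\<exists>p\<in>{0, 1, 2, 3, 5, 9}. \<exists>q\<in>{0, 1, 2, 3, 5, 9}. p \<noteq> q \<and> gk 13 p q = u"
      if "0 < u" "u < 13" for u
    proof -
      have "u \<in> {1, 2, 3, 4, 5, 6, 7, 8, 9, 10, 11, 12}" using that by (simp, presburger)
      then show ?thesis by (rule bspec[OF c])
    qed
  qed (auto simp: gk_def)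
  then show ?thesis unfolding O by (simp add: eval_nat_numeral)
qed

lemma star_embeds_small:
  assumes "2 \<le> a" "a \<le> 9"
  shows "\<exists>v. embeds_in_order (star a) v"
proof -
  have "a = 2 \<or> a = 3 \<or> a = 4 \<or> a = 5 \<or> a = 6 \<or> a = 7 \<or> a = 8 \<or> a = 9" using assms by auto
  then show ?thesis
    using star_2_embeds star_3_embeds star_4_embeds star_5_embeds star_6_embeds star_7_embeds
      star_embeds_2[of 1] star_embeds_large[of 9]
    by (elim disjE) auto
qed

text \<open>The orders are well-ordered, so an embedding of any order suffices; those given for few
  vertices are not claimed to be least.\<close>

lemma embeds_minimally:
  assumes "embeds_in_order G v"
  shows "\<exists>v. embeds_minimally_in_order G v"
proof -
  have "embeds_in_order G (LEAST v. embeds_in_order G v)" using assms by (rule LeastI)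
  then show ?thesis unfolding embeds_minimally_in_order_def using not_less_Least by blast
qed

theorem theorem3p5:
  fixes a :: nat
  assumes "a \<ge> 2"
  shows "(a \<le> 9 \<longrightarrow> (\<exists>v. embeds_minimally_in_order (star a) v)) \<and>
         (a \<ge> 9 \<longrightarrow> embeds_in_order (star a) (star_order a)) \<and>
         (a \<ge> 9 \<longrightarrow>
           (a mod 6 \<in> {3, 4, 5} \<longrightarrow> embeds_minimally_in_order (star a) (star_order a)) \<and>
           (a mod 6 \<in> {0, 2} \<longrightarrow> star_order a = enumerate (admissible_orders a) 1) \<and>
           (a mod 6 = 1 \<longrightarrow> star_order a = enumerate (admissible_orders a) 2))"
proof (intro conjI impI)
  show "\<exists>v. embeds_minimally_in_order (star a) v" if "a \<le> 9"
    using star_embeds_small[OF assms that] embeds_minimally by metis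
  show "embeds_in_order (star a) (star_order a)" if "a \<ge> 9"
    using star_embeds_large[OF that] .
  show "embeds_minimally_in_order (star a) (star_order a)" if "a \<ge> 9" "a mod 6 \<in> {3, 4, 5}"
    using star_embeds_large[OF that(1)] star_order_minimal[OF that] leD
    unfolding embeds_minimally_in_order_def by metis
  show "star_order a = enumerate (admissible_orders a) 1" if "a \<ge> 9" "a mod 6 \<in> {0, 2}"
    using star_order_second[OF that] .
  show "star_order a = enumerate (admissible_orders a) 2" if "a \<ge> 9" "a mod 6 = 1"
    using star_order_third[OF that] .
qed

end
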